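(* Let $0<\xi<1$, $\alpha>0$, $\bar w(x)=|x-\xi|^\alpha$, $0\le\lambda\le 1$ and $\varphi(x)=\sqrt{x(1-x)}$. In each of the two statements below, $C>0$ denotes a constant independent of $n$ and $x$, and the inequality holds for all admissible $n$ and all $x\in[0,1]$. (i) If $f\in C_{\bar w}$, then $$|\bar w(x)\varphi^{2\lambda}(x)\bar B_n''(f,x)|\le C\,n\,\max\{n^{1-\lambda},\varphi^{2(\lambda-1)}(x)\}\,\|\bar w f\|$$ (the maximum being $+\infty$ if $\lambda<1$ and $\varphi(x)=0$). (ii) If $f\in W^2_{\bar w,\lambda}$, then $$|\bar w(x)\varphi^{2\lambda}(x)\bar B_n''(f,x)|\le C\,\|\bar w\varphi^{2\lambda}f''\|.$$ Here $\bar B_n''(f,x)$ is the second derivative in $x$ of the polynomial $\bar B_n(f,x)$, and $\|\cdot\|$ is the supremum norm on $[0,1]$.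
   Context: Fix $0<\xi<1$, $\alpha>0$, and $\bar w(x)=|x-\xi|^\alpha$. $C_{\bar w}$ is the set of all $f\in C([0,1]\setminus\{\xi\})$ with $\lim_{x\to\xi}(\bar w f)(x)=0$; $\|\bar w f\|=\sup_{0\le x\le 1}|(\bar w f)(x)|$, with $(\bar w f)(\xi):=0$. With $\varphi(x)=\sqrt{x(1-x)}$, $$W^2_{\bar w,\lambda}=\{f\in C_{\bar w}: f'\in A.C.((0,1)),\ \|\bar w\varphi^{2\lambda}f''\|<\infty\},$$ where $f'\in A.C.((0,1))$ means that $f$ is differentiable on $(0,1)$ (after assigning a value at $\xi$) and $f'$ is locally absolutely continuous on $(0,1)$; since $f''$ exists only almost everywhere, $\|\bar w\varphi^{2\lambda}f''\|$ is an essential supremum. By convention $\varphi^0\equiv1$. For $n\in\mathbb N$, $p_{n,k}(x)=\binom nk x^k(1-x)^{n-k}$ and $B_n(g,x)=\sum_{k=0}^n g(k/n)p_{n,k}(x)$ is the Bernstein operator. Let $\psi(x)=10x^3-15x^4+6x^5$ for $0<x<1$, $\psi(x)=0$ for $x\le 0$, $\psi(x)=1$ for $x\ge 1$. With $[\cdot]$ the integer part, put $$x_1=\tfrac{[n\xi-2\sqrt n]}{n},\quad x_2=\tfrac{[n\xi-\sqrt n]}{n},\quad x_3=\tfrac{[n\xi+\sqrt n]}{n},\quad x_4=\tfrac{[n\xi+2\sqrt n]}{n},$$ $\bar\psi_1(x)=\psi\big(\tfrac{x-x_1}{x_2-x_1}\big)$, $\bar\psi_2(x)=\psi\big(\tfrac{x-x_3}{x_4-x_3}\big)$.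 A positive integer $n$ is called admissible if $x_1\ge 0$ and $x_4\le 1$ (true for all large $n$). Let $$P(x)=P(f,x)=\tfrac{x-x_4}{x_1-x_4}f(x_1)+\tfrac{x_1-x}{x_1-x_4}f(x_4),$$ $$\bar F_n(f,x)=f(x)\big(1-\bar\psi_1(x)+\bar\psi_2(x)\big)+\bar\psi_1(x)\big(1-\bar\psi_2(x)\big)P(x),$$ so that $\bar F_n(f,\cdot)=f$ on $[0,x_1]\cup[x_4,1]$ and $\bar F_n(f,\cdot)=P$ on $[x_2,x_3]$ (where the value of $f$ is not used). Define $\bar B_n(f,x)=B_n(\bar F_n(f),x)$. *)

theory Defs
  imports "HOL-Analysis.Analysis" "HOL-Probability.Essential_Supremum"
begin

definition wbar :: "real \<Rightarrow> real \<Rightarrow> real \<Rightarrow> real" where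
  "wbar \<xi> \<alpha> x = \<bar>x - \<xi>\<bar> powr \<alpha>"

definition phi :: "real \<Rightarrow> real" where
  "phi x = sqrt (x * (1 - x))"

text \<open>The case distinction implements the convention that the zeroth power of \<open>phi\<close> is identically 1,
  also at the endpoints, where \<open>0 powr 0 = 0\<close>.\<close>

definition phi_pow :: "real \<Rightarrow> real \<Rightarrow> real" where
  "phi_pow s x = (if s = 0 then 1 else phi x powr s)"

text \<open>Functions on \<open>[0,1]\<close> without \<open>\<xi>\<close> are represented by total functions on the reals. Nothing
  below depends on the value at \<open>\<xi>\<close> or on values outside \<open>[0,1]\<close>.\<close>

definition C_wbar :: "real \<Rightarrow> real \<Rightarrow> (real \<Rightarrow> real) set" where
  "C_wbar \<xi> \<alpha> = {f. continuous_on ({0..1} - {\<xi>}) f \<and>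
     ((\<lambda>x. wbar \<xi> \<alpha> x * f x) \<longlongrightarrow> 0) (at \<xi>)}"

text \<open>Since \<open>wbar \<xi> \<alpha> \<xi> = 0\<close>, the product with the weight automatically has the value 0 at \<open>\<xi>\<close>.\<close>

definition wnorm :: "real \<Rightarrow> real \<Rightarrow> (real \<Rightarrow> real) \<Rightarrow> ereal" where
  "wnorm \<xi> \<alpha> f = (SUP x\<in>{0..1}. ereal \<bar>wbar \<xi> \<alpha> x * f x\<bar>)"

definition abs_cont_on :: "real set \<Rightarrow> (real \<Rightarrow> real) \<Rightarrow> bool" where
  "abs_cont_on S g \<longleftrightarrow> (\<forall>\<epsilon>>0. \<exists>\<delta>>0. \<forall>(m::nat) a b.
     (\<forall>i<m. a i \<le> b i \<and> {a i..b i} \<subseteq> S) \<and>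
     disjoint_family_on (\<lambda>i. {a i<..<b i}) {..<m} \<and>
     (\<Sum>i<m. b i - a i) < \<delta> \<longrightarrow>
     (\<Sum>i<m. \<bar>g (b i) - g (a i)\<bar>) < \<epsilon>)"

definition locally_abs_cont_on :: "real set \<Rightarrow> (real \<Rightarrow> real) \<Rightarrow> bool" where
  "locally_abs_cont_on S g \<longleftrightarrow> (\<forall>a b. a \<le> b \<and> {a..b} \<subseteq> S \<longrightarrow> abs_cont_on {a..b} g)"

text \<open>The second derivative is only meaningful almost everywhere; the values of \<open>deriv\<close> at the
  remaining points (including \<open>\<xi>\<close>) do not affect the essential supremum.\<close>

definition w2norm :: "real \<Rightarrow> real \<Rightarrow> real \<Rightarrow> (real \<Rightarrow> real) \<Rightarrow> ereal" where
  "w2norm \<xi> \<alpha> lam f = esssup (lebesgue_on {0<..<1})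
     (\<lambda>x. ereal \<bar>wbar \<xi> \<alpha> x * phi_pow (2 * lam) x * (deriv ^^ 2) f x\<bar>)"

text \<open>The number \<open>c\<close> is the value assigned to \<open>f\<close> at \<open>\<xi>\<close>.\<close>

definition W2 :: "real \<Rightarrow> real \<Rightarrow> real \<Rightarrow> (real \<Rightarrow> real) set" where
  "W2 \<xi> \<alpha> lam = {f \<in> C_wbar \<xi> \<alpha>.
     (\<exists>c. (\<forall>x\<in>{0<..<1}. f(\<xi> := c) differentiable (at x)) \<and>
          locally_abs_cont_on {0<..<1} (deriv (f(\<xi> := c)))) \<and>
     w2norm \<xi> \<alpha> lam f < \<infinity>}"

definition bernstein_op :: "nat \<Rightarrow> (real \<Rightarrow> real) \<Rightarrow> real \<Rightarrow> real" where
  "bernstein_op n g x = (\<Sum>k\<le>n. g (real k / real n) * Bernstein n k x)"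

definition psi :: "real \<Rightarrow> real" where
  "psi x = (if x \<le> 0 then 0 else if x < 1 then 10 * x ^ 3 - 15 * x ^ 4 + 6 * x ^ 5 else 1)"

definition node :: "real \<Rightarrow> nat \<Rightarrow> real \<Rightarrow> real" where
  "node \<xi> n c = of_int \<lfloor>real n * \<xi> + c * sqrt (real n)\<rfloor> / real n"

abbreviation "x1 \<xi> n \<equiv> node \<xi> n (-2)"
abbreviation "x2 \<xi> n \<equiv> node \<xi> n (-1)"
abbreviation "x3 \<xi> n \<equiv> node \<xi> n 1"
abbreviation "x4 \<xi> n \<equiv> node \<xi> n 2"

definition admissible :: "real \<Rightarrow> nat \<Rightarrow> bool" where
  "admissible \<xi> n \<longleftrightarrow> 0 < n \<and> 0 \<le> x1 \<xi> n \<and> x4 \<xi> n \<le> 1"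

definition psi1 :: "real \<Rightarrow> nat \<Rightarrow> real \<Rightarrow> real" where
  "psi1 \<xi> n x = psi ((x - x1 \<xi> n) / (x2 \<xi> n - x1 \<xi> n))"

definition psi2 :: "real \<Rightarrow> nat \<Rightarrow> real \<Rightarrow> real" where
  "psi2 \<xi> n x = psi ((x - x3 \<xi> n) / (x4 \<xi> n - x3 \<xi> n))"

definition P :: "real \<Rightarrow> nat \<Rightarrow> (real \<Rightarrow> real) \<Rightarrow> real \<Rightarrow> real" where
  "P \<xi> n f x = (x - x4 \<xi> n) / (x1 \<xi> n - x4 \<xi> n) * f (x1 \<xi> n)
             + (x1 \<xi> n - x) / (x1 \<xi> n - x4 \<xi> n) * f (x4 \<xi> n)"

definition Fbar :: "real \<Rightarrow> nat \<Rightarrow> (real \<Rightarrow> real) \<Rightarrow> real \<Rightarrow> real" where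
  "Fbar \<xi> n f x = f x * (1 - psi1 \<xi> n x + psi2 \<xi> n x)
                + psi1 \<xi> n x * (1 - psi2 \<xi> n x) * P \<xi> n f x"

definition Bbar :: "real \<Rightarrow> nat \<Rightarrow> (real \<Rightarrow> real) \<Rightarrow> real \<Rightarrow> real" where
  "Bbar \<xi> n f = bernstein_op n (Fbar \<xi> n f)"

definition max_factor :: "real \<Rightarrow> nat \<Rightarrow> real \<Rightarrow> ereal" where
  "max_factor lam n x = (if lam < 1 \<and> phi x = 0 then \<infinity>
     else ereal (max (real n powr (1 - lam)) (phi_pow (2 * (lam - 1)) x)))"

end

theory Submission
  imports Defs "HOL-Real_Asymp.Real_Asymp"
begin

text \<open>Put \<open>d(y) = |y - \<xi>| + 1/\<surd>n\<close> and \<open>X = x (1 - x)\<close>. Since \<open>|x - \<xi>| \<le> d(k/n) (1 + \<surd>n |x - k/n|)\<close>, the weight at \<open>x\<close> can be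
  traded for \<open>d(k/n)\<^sup>\<alpha>\<close> at the price of a factor \<open>exp (\<surd>n |x - k/n|)\<close>, which the Bernstein
  kernel absorbs because its moment generating function satisfies
  \<open>\<Sum>\<^sub>k p\<^sub>n\<^sub>k(x) exp (t (k - n x)) \<le> exp (n X t\<^sup>2)\<close> for \<open>|t| \<le> 1\<close>.

  For (i), the modified function is \<open>O(d\<^sup>-\<^sup>\<alpha>)\<close> at the nodes; the second derivative is expanded through second
  differences of the values when \<open>n X \<le> 1\<close>, and through \<open>p\<^sub>n\<^sub>k'' = p\<^sub>n\<^sub>k ((k - n x)\<^sup>2 - n X - (k - n x)(1 - 2x)) / X\<^sup>2\<close>
  when \<open>n X \<ge> 1\<close>.

  For (ii), it suffices that the second differences of the modified function with step \<open>1/n\<close> are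
  \<open>O(n\<^sup>-\<^sup>2 \<phi>\<^sup>-\<^sup>2\<^sup>\<lambda> d\<^sup>-\<^sup>\<alpha>)\<close>, because \<open>n (n-1) X p\<^bsub>n-2,k\<^esub>(x) = (k+1)(n-k-1) p\<^bsub>n,k+1\<^esub>(x)\<close> takes care of \<open>\<phi>\<close>.
  Away from \<open>\<xi>\<close> this is a comparison of \<open>f\<close> with an explicit convex majorant; it only needs that
  an absolutely continuous function is nondecreasing if its derivative is nonnegative wherever it exists, up to
  a null set, which is proved with Vitali's covering theorem. Near \<open>\<xi>\<close> one uses
  \<open>|f'(s) - f'(t)| = O(\<rho>\<^bsup>1-\<alpha>\<^esup>)\<close> for \<open>s, t\<close> within \<open>\<rho>\<close> of \<open>\<xi>\<close>, with a constant that may depend on \<open>f\<close>.\<close>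

section \<open>Absolutely continuous functions with nonnegative derivative\<close>

text \<open>The two constants are quantified differently: in (i) one constant serves every f, in
  (ii) it is chosen after f. Hence in (ii) the finitely many n too small for the asymptotic
  estimates are absorbed into the constant, and a positive norm is divided out at the end; only norm
  zero, where f is affine, needs an exact argument. For \<alpha> >= 1 the function |t -
  \<xi>|^(-\<alpha>) is not integrable at \<xi>, so the oscillation of f' near \<xi> is controlled
  through continuity of f' there; this is where the dependence on f enters. The monotonicity
  criterion speaks of derivatives that exist because \<open>deriv\<close> takes an unspecified value
  elsewhere. Almost everywhere differentiability is not presupposed: Vitali coverings show that two
  kinds of bad points form null sets, those with lower derivate -infinity and those where the lower
  derivate lies below the upper one. The convex majorant involves t ln t because f'' may grow like
  1/(t (1 - t)): t ln t is a second antiderivative of 1/t and is still continuous at the endpoint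
  that the outermost second differences use.\<close>

definition nonoverlapping :: "real \<Rightarrow> real \<Rightarrow> (real \<times> real) set \<Rightarrow> bool" where
  "nonoverlapping u v R \<longleftrightarrow> finite R \<and> (\<forall>(c, d)\<in>R. u \<le> c \<and> c \<le> d \<and> d \<le> v) \<and>
     pairwise (\<lambda>p q. {fst p<..<snd p} \<inter> {fst q<..<snd q} = {}) R"

text \<open>Covering arguments produce finite sets of intervals, whereas the definition of absolute
  continuity uses families indexed by naturals; enumerating the set converts one into the
  other.\<close>

lemma abs_cont_on_pairs:
  assumes "abs_cont_on {a..b} g" "\<epsilon> > 0"
  shows "\<exists>\<delta>>0. \<forall>R. nonoverlapping a b R \<and> (\<Sum>(c, d)\<in>R. d - c) < \<delta> \<longrightarrow> (\<Sum>(c, d)\<in>R. \<bar>g d - g c\<bar>) < \<epsilon>"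
proof -
  obtain \<delta> where d0: "\<delta> > 0" and D: "\<forall>(m::nat) u v. 
     (\<forall>i<m. u i \<le> v i \<and> {u i..v i} \<subseteq> {a..b}) \<and>
     disjoint_family_on (\<lambda>i. {u i<..<v i}) {..<m} \<and>
     (\<Sum>i<m. v i - u i) < \<delta> \<longrightarrow> (\<Sum>i<m. \<bar>g (v i) - g (u i)\<bar>) < \<epsilon>"
    using assms(1)[unfolded abs_cont_on_def, rule_format, OF assms(2)] by (elim exE conjE) (rule that)
  show ?thesis
  proof (intro exI[of _ \<delta>] conjI d0 allI impI)
    fix R :: "(real \<times> real) set"
    assume "nonoverlapping a b R \<and> (\<Sum>(c, d)\<in>R. d - c) < \<delta>"
    then have fin: "finite R" and R: "\<And>c d. (c, d) \<in> R \<Longrightarrow> a \<le> c \<and> c \<le> d \<and> d \<le> b"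
      and pw: "pairwise (\<lambda>p q. {fst p<..<snd p} \<inter> {fst q<..<snd q} = {}) R"
      and S: "(\<Sum>(c, d)\<in>R. d - c) < \<delta>"
      by (auto simp: nonoverlapping_def)
    obtain h where h: "bij_betw h {..<card R} R"
      using ex_bij_betw_nat_finite[OF fin] by (auto simp: atLeast0LessThan)
    have hR: "h i \<in> R" if "i < card R" for i
      using h that by (auto simp: bij_betw_def)
    have inj: "h i \<noteq> h j" if "i < card R" "j < card R" "i \<noteq> j" for i j
      using h that by (auto simp: bij_betw_def inj_on_def)
    have 1: "(\<Sum>(c, d)\<in>R. d - c) = (\<Sum>i<card R. snd (h i) - fst (h i))"
      using sum.reindex_bij_betw[OF h, of "\<lambda>(c, d). d - c"] by (simp add: case_prod_beta)
    have 2: "(\<Sum>(c, d)\<in>R. \<bar>g d - g c\<bar>) = (\<Sum>i<card R. \<bar>g (snd (h i)) - g (fst (h i))\<bar>)"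
      using sum.reindex_bij_betw[OF h, of "\<lambda>(c, d). \<bar>g d - g c\<bar>"] by (simp add: case_prod_beta)
    have "\<forall>i<card R. fst (h i) \<le> snd (h i) \<and> {fst (h i)..snd (h i)} \<subseteq> {a..b}"
    proof (intro allI impI)
      fix i assume "i < card R"
      from R[of "fst (h i)" "snd (h i)"] hR[OF this]
      show "fst (h i) \<le> snd (h i) \<and> {fst (h i)..snd (h i)} \<subseteq> {a..b}" by auto
    qed
    moreover have "disjoint_family_on (\<lambda>i. {fst (h i)<..<snd (h i)}) {..<card R}"
      using pw hR inj unfolding disjoint_family_on_def pairwise_def by blast
    ultimately show "(\<Sum>(c, d)\<in>R. \<bar>g d - g c\<bar>) < \<epsilon>"
      using D[rule_format, of "card R" "\<lambda>i. fst (h i)" "\<lambda>i. snd (h i)"] S unfolding 1 2 by simp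
  qed
qed

text \<open>Induction that peels off the member of J with the largest left endpoint: the gap to its
  right is a single piece, and all other members lie to its left. Both identities then telescope
  over the endpoints.\<close>

lemma interval_complement_pairs:
  fixes g :: "real \<Rightarrow> real"
  assumes "finite J" "u \<le> v" "\<And>c d. (c, d) \<in> J \<Longrightarrow> u \<le> c \<and> c < d \<and> d \<le> v"
    "pairwise (\<lambda>p q. {fst p..snd p} \<inter> {fst q..snd q} = {}) J"
  shows "\<exists>R. nonoverlapping u v R \<and>
     (\<Sum>(c, d)\<in>J. d - c) + (\<Sum>(c, d)\<in>R. d - c) = v - u \<and>
     (\<Sum>(c, d)\<in>J. g d - g c) + (\<Sum>(c, d)\<in>R. g d - g c) = g v - g u"
  unfolding nonoverlapping_def
  using assms
proof (induction "card J" arbitrary: J v)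
  case 0
  then have "J = {}" by simp
  then show ?case using 0 by (intro exI[of _ "{(u, v)}"]) auto
next
  case (Suc k)
  then have ne: "J \<noteq> {}" and fin: "finite J" by auto
  have "Max (fst ` J) \<in> fst ` J" using ne fin by (intro Max_in) auto
  then obtain c d where cd: "(c, d) \<in> J" and c: "c = Max (fst ` J)" by auto
  have max: "c' \<le> c" if "(c', d') \<in> J" for c' d'
    unfolding c using fin that by (intro Max_ge) force+
  define J' where "J' = J - {(c, d)}"
  have J: "J = insert (c, d) J'" "(c, d) \<notin> J'" "finite J'" using cd fin by (auto simp: J'_def)
  have ucd: "u \<le> c" "c < d" "d \<le> v" using Suc.prems(3)[OF cd] by auto
  have J'1: "u \<le> c' \<and> c' < d' \<and> d' \<le> c" if "(c', d') \<in> J'" for c' d'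
  proof -
    have "(c', d') \<in> J" "(c', d') \<noteq> (c, d)" using that by (auto simp: J'_def)
    then have "{c'..d'} \<inter> {c..d} = {}" using pairwiseD[OF Suc.prems(4) _ cd, of "(c', d')"] by simp
    moreover have "c' \<le> c" "u \<le> c'" "c' < d'" using max Suc.prems(3) \<open>(c', d') \<in> J\<close> by auto
    ultimately have "c \<notin> {c'..d'}" using ucd by auto
    then show ?thesis using \<open>c' \<le> c\<close> \<open>u \<le> c'\<close> \<open>c' < d'\<close> by auto
  qed
  have "k = card J'" using Suc.hyps(2) J by simp
  moreover have "pairwise (\<lambda>p q. {fst p..snd p} \<inter> {fst q..snd q} = {}) J'"
    using Suc.prems(4) by (rule pairwise_mono) (auto simp: J'_def)
  ultimately obtain R where R: "finite R" "\<forall>(c', d')\<in>R. u \<le> c' \<and> c' \<le> d' \<and> d' \<le> c"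
     "pairwise (\<lambda>p q. {fst p<..<snd p} \<inter> {fst q<..<snd q} = {}) R"
     "(\<Sum>(c, d)\<in>J'. d - c) + (\<Sum>(c, d)\<in>R. d - c) = c - u"
     "(\<Sum>(c, d)\<in>J'. g d - g c) + (\<Sum>(c, d)\<in>R. g d - g c) = g c - g u"
    using Suc.hyps(1)[of J' c] J J'1 ucd by auto
  \<comment> \<open>The new gap starts at d, while every member of R ends at c < d or earlier, so
    inserting it really adds a term to the sums.\<close>
  have nR: "(d, v) \<notin> R" using R(2) ucd by auto
  have "pairwise (\<lambda>p q. {fst p<..<snd p} \<inter> {fst q<..<snd q} = {}) (insert (d, v) R)"
  proof -
    have "{d<..<v} \<inter> {fst p<..<snd p} = {}" if "p \<in> R" for p
    proof -
      have "snd p \<le> c" using R(2) that by (cases p) auto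
      then show ?thesis using ucd by auto
    qed
    then show ?thesis unfolding pairwise_insert using R(3) by (simp add: Int_commute)
  qed
  moreover have "u \<le> c' \<and> c' \<le> d' \<and> d' \<le> v" if "(c', d') \<in> insert (d, v) R" for c' d'
    using R(2) ucd that by auto
  then have "\<forall>(c', d')\<in>insert (d, v) R. u \<le> c' \<and> c' \<le> d' \<and> d' \<le> v" by auto
  ultimately show ?case
    using R(1,4,5) nR J by (intro exI[of _ "insert (d, v) R"]) auto
qed

text \<open>Vitali gives countably many disjoint intervals with property Q that cover S up to a null
  set; finitely many of them already capture all but \<epsilon> of the measure of S. In the
  applications Q is a condition on the slope of a function over the interval.\<close>

lemma Vitali_finite_intervals:
  fixes S U :: "real set"
  assumes S: "S \<in> lmeasurable" and U: "open U" "S \<subseteq> U"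
    and Q: "\<And>x \<delta>. \<lbrakk>x \<in> S; \<delta> > 0\<rbrakk> \<Longrightarrow> \<exists>c d. c < d \<and> x \<in> {c..d} \<and> d - c < \<delta> \<and> Q c d"
    and e: "\<epsilon> > 0"
  obtains J where "finite J" "\<And>c d. (c, d) \<in> J \<Longrightarrow> c < d \<and> {c..d} \<subseteq> U \<and> Q c d"
    "pairwise (\<lambda>p q. {fst p..snd p} \<inter> {fst q..snd q} = {}) J"
    "(\<Sum>(c, d)\<in>J. measure lebesgue (S \<inter> {c<..<d})) > measure lebesgue S - \<epsilon>"
proof -
  define K where "K = {(c, d). c < d \<and> {c..d} \<subseteq> U \<and> Q c d}"
  define a r where "a = (\<lambda>(c::real, d::real). (c + d) / 2)" and "r = (\<lambda>(c::real, d::real). (d - c) / 2)"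
  have cb: "cball (a p) (r p) = {fst p..snd p}" for p
    unfolding a_def r_def cball_eq_atLeastAtMost by (cases p) (simp add: field_simps)
  have "\<exists>i. i \<in> K \<and> x \<in> cball (a i) (r i) \<and> r i < \<delta>" if x: "x \<in> S" "\<delta> > 0" for x \<delta>
  proof -
    obtain \<eta> where \<eta>: "\<eta> > 0" "ball x \<eta> \<subseteq> U" using U x openE by (metis subsetD)
    obtain c d where cd: "c < d" "x \<in> {c..d}" "d - c < min \<eta> \<delta>" "Q c d"
      using Q[OF x(1), of "min \<eta> \<delta>"] \<eta>(1) x(2) by auto
    have "{c..d} \<subseteq> ball x \<eta>" using cd by (auto simp: dist_real_def)
    then have "(c, d) \<in> K" using cd \<eta> by (auto simp: K_def)
    moreover have "r (c, d) < \<delta>" using cd x by (simp add: r_def)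
    ultimately show ?thesis using cd(2) unfolding cb by fastforce
  qed
  moreover have "0 < r i" if "i \<in> K" for i using that by (auto simp: K_def r_def)
  ultimately obtain C where C: "countable C" "C \<subseteq> K"
     "pairwise (\<lambda>i j. disjnt (cball (a i) (r i)) (cball (a j) (r j))) C"
     "negligible (S - (\<Union>i\<in>C. cball (a i) (r i)))"
    using Vitali_covering_theorem_cballs[of K r S a] by blast
  define D where "D = (\<lambda>p. S \<inter> {fst p..snd p})"
  have Dm: "D p \<in> lmeasurable" for p unfolding D_def
    by (intro fmeasurable.Int) (use S in auto)
  have SD: "(\<Union>p\<in>C. D p) \<subseteq> S" by (auto simp: D_def)
  have "measure lebesgue S = measure lebesgue (\<Union>p\<in>C. D p)"
  proof (rule measure_negligible_symdiff[symmetric])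
    show "S \<in> lmeasurable" by (rule S)
    have "S - (\<Union>p\<in>C. D p) \<union> ((\<Union>p\<in>C. D p) - S) \<subseteq> S - (\<Union>i\<in>C. cball (a i) (r i))"
      unfolding cb D_def by auto
    then show "negligible (S - (\<Union>p\<in>C. D p) \<union> ((\<Union>p\<in>C. D p) - S))"
      using C(4) negligible_subset by blast
  qed
  moreover obtain D' where D': "D' \<subseteq> D ` C" "finite D'"
      "measure lebesgue (\<Union>(D ` C)) - \<epsilon> < measure lebesgue (\<Union>D')"
  proof (rule measure_countable_Union_approachable[of "D ` C" \<epsilon> "measure lebesgue S"])
    show "measure lebesgue (\<Union>D') \<le> measure lebesgue S" if "D' \<subseteq> D ` C" "finite D'" for D'
    proof (rule measure_mono_fmeasurable[OF _ _ S])
      show "\<Union>D' \<subseteq> S" using that SD by blast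
      show "\<Union>D' \<in> sets lebesgue" using that Dm by (intro sets.finite_Union) auto
    qed
  qed (use C(1) Dm e in auto)
  moreover obtain J where J: "J \<subseteq> C" "finite J" "D' = D ` J"
    using finite_subset_image[OF D'(2,1)] by auto
  ultimately have less: "measure lebesgue S - \<epsilon> < measure lebesgue (\<Union>p\<in>J. D p)" by simp
  also have "\<dots> \<le> (\<Sum>p\<in>J. measure lebesgue (D p))"
    using J Dm by (intro measure_UNION_le) auto
  also have "\<dots> = (\<Sum>(c, d)\<in>J. measure lebesgue (S \<inter> {c<..<d}))"
  proof (rule sum.cong[OF refl], clarify)
    fix c d assume "(c, d) \<in> J"
    show "measure lebesgue (D (c, d)) = measure lebesgue (S \<inter> {c<..<d})"
    proof (rule measure_negligible_symdiff[symmetric])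
      show "D (c, d) \<in> lmeasurable" by (rule Dm)
      have "D (c, d) - S \<inter> {c<..<d} \<union> (S \<inter> {c<..<d} - D (c, d)) \<subseteq> {c, d}"
        by (auto simp: D_def)
      then show "negligible (D (c, d) - S \<inter> {c<..<d} \<union> (S \<inter> {c<..<d} - D (c, d)))"
        by (rule negligible_subset[rotated]) auto
    qed
  qed
  finally have "measure lebesgue S - \<epsilon> < (\<Sum>(c, d)\<in>J. measure lebesgue (S \<inter> {c<..<d}))" .
  moreover have "pairwise (\<lambda>p q. {fst p..snd p} \<inter> {fst q..snd q} = {}) J"
    using pairwise_subset[OF C(3) J(1)] unfolding cb disjnt_def .
  moreover have "c < d \<and> {c..d} \<subseteq> U \<and> Q c d" if "(c, d) \<in> J" for c d
    using that J(1) C(2) by (auto simp: K_def)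
  ultimately show thesis using that J(2) by blast
qed

text \<open>Intervals on which g does not decrease cover most of S, so a decrease of g over [u,v]
  can only come from the gaps R between them, whose total length exceeds that of the complement of S
  by less than \<epsilon>. In the applications absolute continuity makes the variation over R
  small.\<close>

lemma increment_ge_rest:
  fixes g :: "real \<Rightarrow> real"
  assumes "u \<le> v" and S: "S \<in> lmeasurable" "S \<subseteq> {u<..<v}"
    and Q: "\<And>x \<delta>. \<lbrakk>x \<in> S; \<delta> > 0\<rbrakk> \<Longrightarrow> \<exists>c d. c < d \<and> x \<in> {c..d} \<and> d - c < \<delta> \<and> g c \<le> g d"
    and e: "\<epsilon> > 0"
  shows "\<exists>R. nonoverlapping u v R \<and>
     (\<Sum>(c, d)\<in>R. d - c) < v - u - measure lebesgue S + \<epsilon> \<and>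
     g v - g u \<ge> - (\<Sum>(c, d)\<in>R. \<bar>g d - g c\<bar>)"
proof -
  obtain J where J: "finite J" "\<And>c d. (c, d) \<in> J \<Longrightarrow> c < d \<and> {c..d} \<subseteq> {u<..<v} \<and> g c \<le> g d"
    "pairwise (\<lambda>p q. {fst p..snd p} \<inter> {fst q..snd q} = {}) J"
    "(\<Sum>(c, d)\<in>J. measure lebesgue (S \<inter> {c<..<d})) > measure lebesgue S - \<epsilon>"
  proof (rule Vitali_finite_intervals[of S "{u<..<v}" "\<lambda>c d. g c \<le> g d" \<epsilon>])
    show "\<exists>c d. c < d \<and> x \<in> {c..d} \<and> d - c < \<delta> \<and> g c \<le> g d" if "x \<in> S" "\<delta> > 0" for x \<delta>
      using Q that by blast
  qed (use S e in auto)
  have "u \<le> c \<and> c < d \<and> d \<le> v" if "(c, d) \<in> J" for c d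
  proof -
    have "c \<in> {c..d}" "d \<in> {c..d}" "{c..d} \<subseteq> {u<..<v}" "c < d" using J(2)[OF that] by auto
    then have "c \<in> {u<..<v}" "d \<in> {u<..<v}" "c < d" by blast+
    then show ?thesis by auto
  qed
  then obtain R where R: "nonoverlapping u v R"
     "(\<Sum>(c, d)\<in>J. d - c) + (\<Sum>(c, d)\<in>R. d - c) = v - u"
     "(\<Sum>(c, d)\<in>J. g d - g c) + (\<Sum>(c, d)\<in>R. g d - g c) = g v - g u"
    using interval_complement_pairs[OF J(1) \<open>u \<le> v\<close> _ J(3), of g] by blast
  have "(\<Sum>(c, d)\<in>J. measure lebesgue (S \<inter> {c<..<d})) \<le> (\<Sum>(c, d)\<in>J. d - c)"
  proof (rule sum_mono, clarify)
    fix c d assume "(c, d) \<in> J"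
    then have "c < d" using J(2) by auto
    have "measure lebesgue (S \<inter> {c<..<d}) \<le> measure lebesgue {c<..<d}"
      by (rule measure_mono_fmeasurable) (use S in auto)
    then show "measure lebesgue (S \<inter> {c<..<d}) \<le> d - c" using \<open>c < d\<close> by simp
  qed
  moreover have "0 \<le> (\<Sum>(c, d)\<in>J. g d - g c)"
    using J(2) by (intro sum_nonneg) auto
  moreover have "- (\<Sum>(c, d)\<in>R. \<bar>g d - g c\<bar>) \<le> (\<Sum>(c, d)\<in>R. g d - g c)"
    unfolding sum_negf[symmetric] by (rule sum_mono) auto
  ultimately show ?thesis using R J(4) by (intro exI[of _ R]) auto
qed

text \<open>If E had measure s > 0, intervals of slope at most -\<kappa> would nearly fill E, and g
  would fall on them by at least \<kappa> s/2 in total. But E is also nearly filled by intervals on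
  which g does not fall, so the whole fall happens on gaps of small total length, which contradicts
  absolute continuity.\<close>

lemma abs_cont_on_opposite_slopes_negligible:
  fixes g :: "real \<Rightarrow> real"
  assumes ac: "abs_cont_on {a..b} g" and k: "\<kappa> > 0"
    and E: "E \<in> lmeasurable" "E \<subseteq> {a<..<b}"
    and up: "\<And>x \<delta>. \<lbrakk>x \<in> E; \<delta> > 0\<rbrakk> \<Longrightarrow> \<exists>c d. c < d \<and> x \<in> {c..d} \<and> d - c < \<delta> \<and> g c \<le> g d"
    and lo: "\<And>x \<delta>. \<lbrakk>x \<in> E; \<delta> > 0\<rbrakk> \<Longrightarrow> \<exists>c d. c < d \<and> x \<in> {c..d} \<and> d - c < \<delta> \<and> g d - g c \<le> - \<kappa> * (d - c)"
  shows "negligible E"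
proof (rule ccontr)
  assume "\<not> negligible E"
  define s where "s = measure lebesgue E"
  have s: "s > 0" using \<open>\<not> negligible E\<close> negligible_iff_measure[of E] E measure_nonneg[of lebesgue E]
    unfolding s_def by linarith
  \<comment> \<open>Half of the guaranteed fall \<open>\<kappa> * (s/2)\<close>, so a variation
    below \<eta> is contradictory.\<close>
  define \<eta> where "\<eta> = \<kappa> * s / 4"
  have eta: "\<eta> > 0" using k s by (simp add: \<eta>_def)
  obtain \<delta>0 where d0: "\<delta>0 > 0" and AC: 
    "\<And>R. \<lbrakk>nonoverlapping a b R; (\<Sum>(c, d)\<in>R. d - c) < \<delta>0\<rbrakk> \<Longrightarrow> (\<Sum>(c, d)\<in>R. \<bar>g d - g c\<bar>) < \<eta>"
    using abs_cont_on_pairs[OF ac eta] by blast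
  define \<delta> where "\<delta> = min \<delta>0 s"
  have d: "0 < \<delta>" "\<delta> \<le> \<delta>0" "\<delta> \<le> s" using d0 s by (auto simp: \<delta>_def)
  obtain U0 where U0: "open U0" "E \<subseteq> U0" "U0 \<in> lmeasurable" "measure lebesgue U0 < s + \<delta>/4"
  proof -
    obtain T where T: "open T" "E \<subseteq> T" "(T - E) \<in> lmeasurable" "emeasure lebesgue (T - E) < ennreal (\<delta>/4)"
      using sets_lebesgue_outer_open[of E "\<delta>/4"] E(1) d(1) by auto
    have "measure lebesgue (T - E) < \<delta>/4"
      using T(4) emeasure_eq_measure2[OF T(3)] by (simp add: ennreal_less_iff)
    have TE: "T = E \<union> (T - E)" using T(2) by auto
    have "T \<in> lmeasurable" using T(3) E(1) TE fmeasurable.Un by metis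
    moreover have "measure lebesgue T \<le> measure lebesgue E + measure lebesgue (T - E)"
      by (subst TE, rule measure_Un_le) (use T E in auto)
    ultimately show thesis using that[of T] T(1,2) \<open>measure lebesgue (T - E) < \<delta>/4\<close> unfolding s_def by linarith
  qed
  define U where "U = U0 \<inter> {a<..<b}"
  have U: "open U" "E \<subseteq> U" "U \<in> lmeasurable" using U0 E by (auto simp: U_def)
  have mU: "measure lebesgue U < s + \<delta>/4"
  proof -
    have "measure lebesgue U \<le> measure lebesgue U0"
      by (rule measure_mono_fmeasurable) (use U U0 in \<open>auto simp: U_def\<close>)
    then show ?thesis using U0(4) by simp
  qed
  obtain I where I: "finite I" "\<And>c d. (c, d) \<in> I \<Longrightarrow> c < d \<and> {c..d} \<subseteq> U \<and> g d - g c \<le> - \<kappa> * (d - c)"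
    "pairwise (\<lambda>p q. {fst p..snd p} \<inter> {fst q..snd q} = {}) I"
    "(\<Sum>(c, d)\<in>I. measure lebesgue (E \<inter> {c<..<d})) > measure lebesgue E - \<delta>/4"
  proof (rule Vitali_finite_intervals[OF E(1) U(1,2), of "\<lambda>c d. g d - g c \<le> - \<kappa> * (d - c)" "\<delta>/4"])
    show "\<exists>c d. c < d \<and> x \<in> {c..d} \<and> d - c < \<delta>' \<and> g d - g c \<le> - \<kappa> * (d - c)" if "x \<in> E" "\<delta>' > 0" for x \<delta>'
      using lo that by blast
  qed (use d in auto)
  \<comment> \<open>Refilling a member of I with non-falling intervals wastes at most \<epsilon>;
    dividing by the cardinality keeps the total waste within \<delta>/4. The excess of U over E and
    the part of E missed by I cost another \<delta>/4 each.\<close>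
  define \<epsilon> where "\<epsilon> = \<delta> / (4 * (real (card I) + 1))"
  have eps: "\<epsilon> > 0" using d(1) by (simp add: \<epsilon>_def)
  define good where "good p R \<longleftrightarrow> nonoverlapping (fst p) (snd p) R \<and>
     (\<Sum>(c, d)\<in>R. d - c) < snd p - fst p - measure lebesgue (E \<inter> {fst p<..<snd p}) + \<epsilon> \<and>
     g (snd p) - g (fst p) \<ge> - (\<Sum>(c, d)\<in>R. \<bar>g d - g c\<bar>)" for p :: "real \<times> real" and R
  have "\<exists>R. good p R" if "p \<in> I" for p
    unfolding good_def
  proof (rule increment_ge_rest)
    show "fst p \<le> snd p" using I(2)[of "fst p" "snd p"] that by simp
    show "E \<inter> {fst p<..<snd p} \<in> lmeasurable" by (intro fmeasurable.Int) (use E in auto)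
  qed (use eps up in auto)
  then obtain R where "\<And>p. p \<in> I \<Longrightarrow> good p (R p)" by metis
  then have R: "\<And>p. p \<in> I \<Longrightarrow> finite (R p)"
     "\<And>p. p \<in> I \<Longrightarrow> (\<forall>(c, d)\<in>R p. fst p \<le> c \<and> c \<le> d \<and> d \<le> snd p)"
     "\<And>p. p \<in> I \<Longrightarrow> pairwise (\<lambda>p q. {fst p<..<snd p} \<inter> {fst q<..<snd q} = {}) (R p)"
     "\<And>p. p \<in> I \<Longrightarrow> (\<Sum>(c, d)\<in>R p. d - c) < snd p - fst p - measure lebesgue (E \<inter> {fst p<..<snd p}) + \<epsilon>"
     "\<And>p. p \<in> I \<Longrightarrow> g (snd p) - g (fst p) \<ge> - (\<Sum>(c, d)\<in>R p. \<bar>g d - g c\<bar>)"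
    unfolding good_def nonoverlapping_def by blast+
  have disj: "R p \<inter> R q = {}" and disj': "\<And>r t. r \<in> R p \<Longrightarrow> t \<in> R q \<Longrightarrow> {fst r<..<snd r} \<inter> {fst t<..<snd t} = {}"
    if "p \<in> I" "q \<in> I" "p \<noteq> q" for p q
  proof -
    have pq: "{fst p..snd p} \<inter> {fst q..snd q} = {}" using pairwiseD[OF I(3) that] .
    have 1: "fst r \<in> {fst p..snd p}" "{fst r<..<snd r} \<subseteq> {fst p..snd p}" if "r \<in> R p" for r
      using R(2)[OF \<open>p \<in> I\<close>] that by (auto simp: case_prod_beta)
    have 2: "fst r \<in> {fst q..snd q}" "{fst r<..<snd r} \<subseteq> {fst q..snd q}" if "r \<in> R q" for r
      using R(2)[OF \<open>q \<in> I\<close>] that by (auto simp: case_prod_beta)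
    show "R p \<inter> R q = {}" using 1(1) 2(1) pq by blast
    show "{fst r<..<snd r} \<inter> {fst t<..<snd t} = {}" if "r \<in> R p" "t \<in> R q" for r t
      using 1(2)[OF that(1)] 2(2)[OF that(2)] pq by blast
  qed
  define T where "T = (\<Union>p\<in>I. R p)"
  have sumT: "(\<Sum>r\<in>T. f r) = (\<Sum>p\<in>I. \<Sum>r\<in>R p. f r)" for f :: "real \<times> real \<Rightarrow> real"
    unfolding T_def by (rule sum.UNION_disjoint) (use I(1) R(1) disj in auto)
  have pU: "{fst p..snd p} \<subseteq> U" "fst p < snd p" if "p \<in> I" for p
    using I(2)[of "fst p" "snd p"] that by auto
  have lenI: "(\<Sum>p\<in>I. snd p - fst p) \<le> measure lebesgue U"
  proof -
    have "(\<Sum>p\<in>I. snd p - fst p) = (\<Sum>p\<in>I. measure lebesgue {fst p..snd p})"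
      using pU(2) by (intro sum.cong) (auto simp: less_imp_le)
    also have "\<dots> = measure lebesgue (\<Union>p\<in>I. {fst p..snd p})"
      using I(1,3) by (intro measure_UNION'[symmetric]) (auto simp: disjnt_def)
    also have "\<dots> \<le> measure lebesgue U"
      using pU I(1) U(3) by (intro measure_mono_fmeasurable) auto
    finally show ?thesis .
  qed
  have Esum: "(\<Sum>p\<in>I. measure lebesgue (E \<inter> {fst p<..<snd p})) > s - \<delta>/4"
    using I(4) by (simp add: case_prod_beta s_def)
  have "(\<Sum>(c, d)\<in>T. d - c) \<le> (\<Sum>p\<in>I. snd p - fst p - measure lebesgue (E \<inter> {fst p<..<snd p}) + \<epsilon>)"
    unfolding sumT by (rule sum_mono) (use R(4) in \<open>auto simp: less_imp_le\<close>)
  also have "\<dots> = (\<Sum>p\<in>I. snd p - fst p) - (\<Sum>p\<in>I. measure lebesgue (E \<inter> {fst p<..<snd p})) + card I * \<epsilon>"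
    by (simp add: sum.distrib sum_subtractf)
  also have "\<dots> < \<delta>"
  proof -
    have "card I * \<epsilon> \<le> \<delta>/4" using d(1) by (simp add: \<epsilon>_def field_simps)
    then show ?thesis using lenI mU Esum d(1) by linarith
  qed
  finally have lenT: "(\<Sum>(c, d)\<in>T. d - c) < \<delta>0" using d by simp
  have "(\<Sum>(c, d)\<in>T. \<bar>g d - g c\<bar>) < \<eta>"
  proof (rule AC[OF _ lenT], unfold nonoverlapping_def, intro conjI)
    show "finite T" using I(1) R(1) by (auto simp: T_def)
    have "a \<le> c \<and> c \<le> d \<and> d \<le> b" if cdT: "(c, d) \<in> T" for c d
    proof -
      obtain p where p: "p \<in> I" "(c, d) \<in> R p" using cdT unfolding T_def by blast
      have "fst p \<in> U" "snd p \<in> U" using pU[OF p(1)] by auto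
      then have "a < fst p" "snd p < b" by (auto simp: U_def)
      then show ?thesis using R(2)[OF p(1)] p(2) by auto
    qed
    then show "\<forall>(c, d)\<in>T. a \<le> c \<and> c \<le> d \<and> d \<le> b" by auto
    show "pairwise (\<lambda>p q. {fst p<..<snd p} \<inter> {fst q<..<snd q} = {}) T"
    proof (rule pairwiseI)
      fix r t assume "r \<in> T" "t \<in> T" "r \<noteq> t"
      then obtain p q where "p \<in> I" "r \<in> R p" "q \<in> I" "t \<in> R q" unfolding T_def by blast
      then show "{fst r<..<snd r} \<inter> {fst t<..<snd t} = {}"
        using disj'[of p q r t] pairwiseD[OF R(3)[of p], of r t] \<open>r \<noteq> t\<close> by (cases "p = q") auto
    qed
  qed
  then have "(\<Sum>p\<in>I. \<Sum>(c, d)\<in>R p. \<bar>g d - g c\<bar>) < \<eta>" unfolding sumT .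
  moreover have "(\<Sum>p\<in>I. \<kappa> * (snd p - fst p)) \<le> (\<Sum>p\<in>I. \<Sum>(c, d)\<in>R p. \<bar>g d - g c\<bar>)"
  proof (rule sum_mono)
    fix p assume p: "p \<in> I"
    show "\<kappa> * (snd p - fst p) \<le> (\<Sum>(c, d)\<in>R p. \<bar>g d - g c\<bar>)"
      using R(5)[OF p] I(2)[of "fst p" "snd p"] p by auto
  qed
  ultimately have "\<kappa> * (\<Sum>p\<in>I. snd p - fst p) < \<eta>" by (simp add: sum_distrib_left)
  moreover have "(\<Sum>p\<in>I. snd p - fst p) \<ge> s / 2"
  proof -
    have "(\<Sum>p\<in>I. measure lebesgue (E \<inter> {fst p<..<snd p})) \<le> (\<Sum>p\<in>I. snd p - fst p)"
    proof (rule sum_mono)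
      fix p assume p: "p \<in> I"
      have "measure lebesgue (E \<inter> {fst p<..<snd p}) \<le> measure lebesgue {fst p<..<snd p}"
        by (rule measure_mono_fmeasurable) (use E in auto)
      then show "measure lebesgue (E \<inter> {fst p<..<snd p}) \<le> snd p - fst p" using pU(2)[OF p] by simp
    qed
    then show ?thesis using Esum d s by linarith
  qed
  then have "\<kappa> * (s/2) \<le> \<kappa> * (\<Sum>p\<in>I. snd p - fst p)" using k by (intro mult_left_mono) auto
  ultimately show False using k s by (simp add: \<eta>_def)
qed

text \<open>In a window shorter than \<delta> the variation of g stays below 1. If E had positive
  measure s there, intervals of slope at least 2/s filling more than half of it would already give
  variation above 1. Windows with rational left endpoints cover E.\<close>

lemma abs_cont_on_infinite_slopes_negligible:
  fixes g :: "real \<Rightarrow> real"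
  assumes ac: "abs_cont_on {a..b} g" 
    and E: "E \<in> lmeasurable" "E \<subseteq> {a<..<b}"
    and lo: "\<And>x \<delta> q. \<lbrakk>x \<in> E; \<delta> > 0\<rbrakk> \<Longrightarrow> \<exists>c d. c < d \<and> x \<in> {c..d} \<and> d - c < \<delta> \<and> q * (d - c) \<le> g d - g c"
  shows "negligible E"
proof -
  obtain \<delta> where d: "\<delta> > 0" and AC: 
    "\<And>R. \<lbrakk>nonoverlapping a b R; (\<Sum>(c, d)\<in>R. d - c) < \<delta>\<rbrakk> \<Longrightarrow> (\<Sum>(c, d)\<in>R. \<bar>g d - g c\<bar>) < 1"
    using abs_cont_on_pairs[OF ac zero_less_one] by blast
  define h where "h = \<delta>/2"
  have h: "0 < h" "h < \<delta>" using d by (auto simp: h_def)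
  have "negligible (E \<inter> {t<..<t+h})" for t
  proof (rule ccontr)
    assume nn: "\<not> negligible (E \<inter> {t<..<t+h})"
    define S where "S = E \<inter> {t<..<t+h}"
    have S: "S \<in> lmeasurable" unfolding S_def by (intro fmeasurable.Int) (use E in auto)
    define s where "s = measure lebesgue S"
    have s: "s > 0" using nn negligible_iff_measure[of S] S measure_nonneg[of lebesgue S]
      unfolding s_def S_def by linarith
    define q where "q = 2 / s"
    have q: "q > 0" using s by (simp add: q_def)
    have SU: "S \<subseteq> {a<..<b} \<inter> {t<..<t+h}" using E by (auto simp: S_def)
    obtain J where J: "finite J" "\<And>c d. (c, d) \<in> J \<Longrightarrow> c < d \<and> {c..d} \<subseteq> {a<..<b} \<inter> {t<..<t+h} \<and> q * (d - c) \<le> g d - g c"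
      "pairwise (\<lambda>p q. {fst p..snd p} \<inter> {fst q..snd q} = {}) J"
      "(\<Sum>(c, d)\<in>J. measure lebesgue (S \<inter> {c<..<d})) > measure lebesgue S - s/2"
    proof (rule Vitali_finite_intervals[OF S _ SU, of "\<lambda>c d. q * (d - c) \<le> g d - g c" "s/2"])
      show "open ({a<..<b} \<inter> {t<..<t+h})" by auto
      show "\<exists>c d. c < d \<and> x \<in> {c..d} \<and> d - c < \<delta>' \<and> q * (d - c) \<le> g d - g c" if "x \<in> S" "\<delta>' > 0" for x \<delta>'
        using lo that by (auto simp: S_def)
    qed (use s in auto)
    have pw: "pairwise (\<lambda>p q. {fst p<..<snd p} \<inter> {fst q<..<snd q} = {}) J"
    proof (rule pairwise_mono[OF J(3)])
      fix x y :: "real \<times> real" assume "{fst x..snd x} \<inter> {fst y..snd y} = {}"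
      moreover have "{fst x<..<snd x} \<subseteq> {fst x..snd x}" "{fst y<..<snd y} \<subseteq> {fst y..snd y}" by auto
      ultimately show "{fst x<..<snd x} \<inter> {fst y<..<snd y} = {}" by blast
    qed auto
    have "(\<Sum>p\<in>J. snd p - fst p) = (\<Sum>p\<in>J. measure lebesgue {fst p..snd p})"
      using J(2) by (intro sum.cong) (auto simp: less_imp_le)
    also have "\<dots> = measure lebesgue (\<Union>p\<in>J. {fst p..snd p})"
      using J(1,3) by (intro measure_UNION'[symmetric]) (auto simp: disjnt_def)
    also have "\<dots> \<le> measure lebesgue {t<..<t+h}"
    proof (rule measure_mono_fmeasurable)
      show "(\<Union>p\<in>J. {fst p..snd p}) \<subseteq> {t<..<t+h}" using J(2) by fastforce
      show "(\<Union>p\<in>J. {fst p..snd p}) \<in> sets lebesgue" using J(1) by (intro sets.finite_UN) auto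
    qed auto
    also have "\<dots> < \<delta>" using h by simp
    finally have "(\<Sum>(c, d)\<in>J. d - c) < \<delta>" by (simp add: case_prod_beta)
    moreover have "a \<le> c \<and> c \<le> d \<and> d \<le> b" if "(c, d) \<in> J" for c d
    proof -
      have "c \<in> {c..d}" "d \<in> {c..d}" "{c..d} \<subseteq> {a<..<b} \<inter> {t<..<t+h}" "c < d" using J(2)[OF that] by auto
      then have "c \<in> {a<..<b}" "d \<in> {a<..<b}" "c < d" by blast+
      then show ?thesis by auto
    qed
    then have "nonoverlapping a b J" using J(1) pw by (auto simp: nonoverlapping_def)
    ultimately have "(\<Sum>(c, d)\<in>J. \<bar>g d - g c\<bar>) < 1" by (intro AC)
    moreover have "(\<Sum>(c, d)\<in>J. \<bar>g d - g c\<bar>) \<ge> (\<Sum>(c, d)\<in>J. q * measure lebesgue (S \<inter> {c<..<d}))"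
    proof (rule sum_mono, clarify)
      fix c d assume cd: "(c, d) \<in> J"
      have "measure lebesgue (S \<inter> {c<..<d}) \<le> measure lebesgue {c<..<d}"
        by (rule measure_mono_fmeasurable) (use S in auto)
      then have "q * measure lebesgue (S \<inter> {c<..<d}) \<le> q * (d - c)"
        using q J(2)[OF cd] by (intro mult_left_mono) auto
      then show "q * measure lebesgue (S \<inter> {c<..<d}) \<le> \<bar>g d - g c\<bar>" using J(2)[OF cd] by linarith
    qed
    moreover have "(\<Sum>(c, d)\<in>J. q * measure lebesgue (S \<inter> {c<..<d})) = q * (\<Sum>(c, d)\<in>J. measure lebesgue (S \<inter> {c<..<d}))"
      by (simp add: sum_distrib_left case_prod_beta)
    moreover have "q * (\<Sum>(c, d)\<in>J. measure lebesgue (S \<inter> {c<..<d})) > q * (s/2)"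
      using J(4) q by (intro mult_strict_left_mono) (auto simp: s_def)
    moreover have "q * (s/2) = 1" using s by (simp add: q_def)
    ultimately show False by linarith
  qed
  then have "negligible (\<Union>t\<in>\<rat>. E \<inter> {t<..<t+h})"
    by (intro negligible_countable_Union) (auto simp: countable_rat)
  moreover have "E \<subseteq> (\<Union>t\<in>\<rat>. E \<inter> {t<..<t+h})"
  proof
    fix x assume "x \<in> E"
    obtain t where "t \<in> \<rat>" "x - h < t" "t < x" using Rats_dense_in_real[of "x - h" x] h by auto
    then show "x \<in> (\<Union>t\<in>\<rat>. E \<inter> {t<..<t+h})" using \<open>x \<in> E\<close> by auto
  qed
  ultimately show ?thesis using negligible_subset by blast
qed

section \<open>Closure properties of absolute continuity\<close>

lemma lipschitz_imp_abs_cont_on: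
  assumes "\<And>x y. \<lbrakk>x \<in> S; y \<in> S; x \<le> y\<rbrakk> \<Longrightarrow> \<bar>h y - h x\<bar> \<le> L * (y - x)"
  shows "abs_cont_on S h"
  unfolding abs_cont_on_def
proof (intro allI impI)
  fix \<epsilon> :: real assume e: "\<epsilon> > 0"
  define L' where "L' = \<bar>L\<bar> + 1"
  have L': "L' > 0" "L \<le> L'" by (auto simp: L'_def)
  show "\<exists>\<delta>>0. \<forall>(m::nat) a b.
     (\<forall>i<m. a i \<le> b i \<and> {a i..b i} \<subseteq> S) \<and>
     disjoint_family_on (\<lambda>i. {a i<..<b i}) {..<m} \<and>
     (\<Sum>i<m. b i - a i) < \<delta> \<longrightarrow>
     (\<Sum>i<m. \<bar>h (b i) - h (a i)\<bar>) < \<epsilon>"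
  proof (intro exI[of _ "\<epsilon> / L'"] conjI allI impI)
    show "\<epsilon> / L' > 0" using e L' by simp
    fix m :: nat and a b :: "nat \<Rightarrow> real"
    assume A: "(\<forall>i<m. a i \<le> b i \<and> {a i..b i} \<subseteq> S) \<and>
     disjoint_family_on (\<lambda>i. {a i<..<b i}) {..<m} \<and> (\<Sum>i<m. b i - a i) < \<epsilon> / L'"
    have "(\<Sum>i<m. \<bar>h (b i) - h (a i)\<bar>) \<le> (\<Sum>i<m. L' * (b i - a i))"
    proof (rule sum_mono)
      fix i assume "i \<in> {..<m}"
      then have i: "a i \<le> b i" "{a i..b i} \<subseteq> S" using A by auto
      then have "a i \<in> S" "b i \<in> S" by auto
      then have "\<bar>h (b i) - h (a i)\<bar> \<le> L * (b i - a i)" using assms i by blast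
      also have "\<dots> \<le> L' * (b i - a i)" using L' i by (intro mult_right_mono) auto
      finally show "\<bar>h (b i) - h (a i)\<bar> \<le> L' * (b i - a i)" .
    qed
    also have "\<dots> = L' * (\<Sum>i<m. b i - a i)" by (simp add: sum_distrib_left)
    also have "\<dots> < \<epsilon>" using A L' by (simp add: field_simps)
    finally show "(\<Sum>i<m. \<bar>h (b i) - h (a i)\<bar>) < \<epsilon>" .
  qed
qed

lemma abs_cont_on_add:
  assumes "abs_cont_on S g" "abs_cont_on S h"
  shows "abs_cont_on S (\<lambda>x. g x + h x)"
  unfolding abs_cont_on_def
proof (intro allI impI)
  fix \<epsilon> :: real assume "\<epsilon> > 0"
  then have e: "\<epsilon>/2 > 0" by simp
  obtain \<delta>1 where d1: "\<delta>1 > 0" and D1: "\<forall>(m::nat) u v. 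
     (\<forall>i<m. u i \<le> v i \<and> {u i..v i} \<subseteq> S) \<and>
     disjoint_family_on (\<lambda>i. {u i<..<v i}) {..<m} \<and>
     (\<Sum>i<m. v i - u i) < \<delta>1 \<longrightarrow> (\<Sum>i<m. \<bar>g (v i) - g (u i)\<bar>) < \<epsilon>/2"
    using assms(1)[unfolded abs_cont_on_def, rule_format, OF e] by (elim exE conjE) (rule that)
  obtain \<delta>2 where d2: "\<delta>2 > 0" and D2: "\<forall>(m::nat) u v. 
     (\<forall>i<m. u i \<le> v i \<and> {u i..v i} \<subseteq> S) \<and>
     disjoint_family_on (\<lambda>i. {u i<..<v i}) {..<m} \<and>
     (\<Sum>i<m. v i - u i) < \<delta>2 \<longrightarrow> (\<Sum>i<m. \<bar>h (v i) - h (u i)\<bar>) < \<epsilon>/2"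
    using assms(2)[unfolded abs_cont_on_def, rule_format, OF e] by (elim exE conjE) (rule that)
  show "\<exists>\<delta>>0. \<forall>(m::nat) a b.
     (\<forall>i<m. a i \<le> b i \<and> {a i..b i} \<subseteq> S) \<and>
     disjoint_family_on (\<lambda>i. {a i<..<b i}) {..<m} \<and>
     (\<Sum>i<m. b i - a i) < \<delta> \<longrightarrow>
     (\<Sum>i<m. \<bar>g (b i) + h (b i) - (g (a i) + h (a i))\<bar>) < \<epsilon>"
  proof (intro exI[of _ "min \<delta>1 \<delta>2"] conjI allI impI)
    show "min \<delta>1 \<delta>2 > 0" using d1 d2 by simp
    fix m :: nat and a b :: "nat \<Rightarrow> real"
    assume A: "(\<forall>i<m. a i \<le> b i \<and> {a i..b i} \<subseteq> S) \<and>
     disjoint_family_on (\<lambda>i. {a i<..<b i}) {..<m} \<and> (\<Sum>i<m. b i - a i) < min \<delta>1 \<delta>2"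
    have "(\<Sum>i<m. \<bar>g (b i) + h (b i) - (g (a i) + h (a i))\<bar>)
        \<le> (\<Sum>i<m. \<bar>g (b i) - g (a i)\<bar> + \<bar>h (b i) - h (a i)\<bar>)"
      by (rule sum_mono) linarith
    also have "\<dots> < \<epsilon>"
      using D1[rule_format, of m a b] D2[rule_format, of m a b] A by (simp add: sum.distrib)
    finally show "(\<Sum>i<m. \<bar>g (b i) + h (b i) - (g (a i) + h (a i))\<bar>) < \<epsilon>" .
  qed
qed

lemma abs_cont_on_uminus: "abs_cont_on S g \<Longrightarrow> abs_cont_on S (\<lambda>x. - g x)"
  unfolding abs_cont_on_def by (simp add: abs_minus_commute)

lemma abs_cont_on_imp_continuous_on:
  assumes ac: "abs_cont_on {a..b} g"
  shows "continuous_on {a..b} g"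
  unfolding continuous_on_iff
proof (intro ballI allI impI)
  fix x \<epsilon> :: real assume x: "x \<in> {a..b}" and e: "\<epsilon> > 0"
  obtain \<delta> where d: "\<delta> > 0" and AC: 
    "\<And>R. \<lbrakk>nonoverlapping a b R; (\<Sum>(c, d)\<in>R. d - c) < \<delta>\<rbrakk> \<Longrightarrow> (\<Sum>(c, d)\<in>R. \<bar>g d - g c\<bar>) < \<epsilon>"
    using abs_cont_on_pairs[OF ac e] by blast
  show "\<exists>\<delta>>0. \<forall>y\<in>{a..b}. dist y x < \<delta> \<longrightarrow> dist (g y) (g x) < \<epsilon>"
  proof (intro exI[of _ \<delta>] conjI ballI impI d)
    fix y assume y: "y \<in> {a..b}" "dist y x < \<delta>"
    show "dist (g y) (g x) < \<epsilon>"
      using AC[of "{(min x y, max x y)}"] x y unfolding nonoverlapping_def by (cases "x \<le> y") (auto simp: dist_real_def)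
  qed
qed

text \<open>For open S, the limsup of the difference quotients is at least q on this set, and every
  point of S with limsup above q belongs to it; for -g the same construction describes the lower
  derivate.\<close>

definition steep :: "(real \<Rightarrow> real) \<Rightarrow> real set \<Rightarrow> real \<Rightarrow> real set" where
  "steep g S q = {x\<in>S. \<forall>\<delta>>0. \<exists>h. h \<noteq> 0 \<and> \<bar>h\<bar> < \<delta> \<and> x + h \<in> S \<and> (g (x + h) - g x) / h > q}"

lemma steep_interval:
  assumes "x \<in> steep g S q" "\<delta> > 0"
  shows "\<exists>c d. c < d \<and> x \<in> {c..d} \<and> d - c < \<delta> \<and> q * (d - c) < g d - g c"
proof -
  obtain h where h: "h \<noteq> 0" "\<bar>h\<bar> < \<delta>" "(g (x + h) - g x) / h > q"
    using assms unfolding steep_def by auto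
  show ?thesis
  proof (cases "h > 0")
    case True
    then show ?thesis using h by (intro exI[of _ x] exI[of _ "x + h"]) (auto simp: field_simps)
  next
    case False
    then show ?thesis using h by (intro exI[of _ "x + h"] exI[of _ x]) (auto simp: field_simps)
  qed
qed

text \<open>A G-delta set: by continuity of g the condition is open in x for each fixed h, arbitrary
  unions over h keep it open, and \<delta> may run through 1/(k+1).\<close>

lemma steep_lmeasurable:
  assumes g: "continuous_on {a<..<b} g"
  shows "steep g {a<..<b} q \<in> lmeasurable"
proof -
  let ?S = "{a<..<b}"
  define O' where "O' k = (\<Union>h\<in>{h. h \<noteq> 0 \<and> \<bar>h\<bar> < 1 / real (Suc k)}. {x \<in> ?S \<inter> {a-h<..<b-h}. (g (x + h) - g x) / h > q})" for k
  have "open (O' k)" for k unfolding O'_def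
  proof (intro open_UN ballI)
    fix h :: real assume "h \<in> {h. h \<noteq> 0 \<and> \<bar>h\<bar> < 1 / real (Suc k)}"
    then have h: "h \<noteq> 0" by auto
    have "continuous_on (?S \<inter> {a-h<..<b-h}) (\<lambda>x. g (x + h))"
      by (rule continuous_on_compose2[OF g]) (auto intro!: continuous_intros)
    then have "continuous_on (?S \<inter> {a-h<..<b-h}) (\<lambda>x. (g (x + h) - g x) / h)"
      using h by (intro continuous_intros continuous_on_subset[OF g]) auto
    then have "open ((?S \<inter> {a-h<..<b-h}) \<inter> (\<lambda>x. (g (x + h) - g x) / h) -` {q<..})"
      by (rule continuous_open_preimage) auto
    moreover have "(?S \<inter> {a-h<..<b-h}) \<inter> (\<lambda>x. (g (x + h) - g x) / h) -` {q<..} =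
        {x \<in> ?S \<inter> {a-h<..<b-h}. (g (x + h) - g x) / h > q}" by auto
    ultimately show "open {x \<in> ?S \<inter> {a-h<..<b-h}. (g (x + h) - g x) / h > q}" by simp
  qed
  then have "(\<Inter>k. O' k) \<in> sets lebesgue" by (intro sets.countable_INT) auto
  moreover have "steep g ?S q = (\<Inter>k. O' k)"
  proof (intro set_eqI iffI)
    fix x assume "x \<in> steep g ?S q"
    then have x: "x \<in> ?S" "\<And>\<delta>. \<delta> > 0 \<Longrightarrow> \<exists>h. h \<noteq> 0 \<and> \<bar>h\<bar> < \<delta> \<and> x + h \<in> ?S \<and> (g (x + h) - g x) / h > q"
      by (auto simp: steep_def)
    show "x \<in> (\<Inter>k. O' k)"
    proof
      fix k
      obtain h where "h \<noteq> 0 \<and> \<bar>h\<bar> < 1 / real (Suc k) \<and> x + h \<in> ?S \<and> (g (x + h) - g x) / h > q"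
        using x(2)[of "1 / real (Suc k)"] by auto
      then show "x \<in> O' k" using x(1) unfolding O'_def by (intro UN_I[of h]) auto
    qed
  next
    fix x assume x: "x \<in> (\<Inter>k. O' k)"
    then have "x \<in> O' 0" by blast
    then have xS: "x \<in> ?S" by (auto simp: O'_def)
    moreover have "\<exists>h. h \<noteq> 0 \<and> \<bar>h\<bar> < \<delta> \<and> x + h \<in> ?S \<and> (g (x + h) - g x) / h > q" if d: "\<delta> > 0" for \<delta>
    proof -
      obtain k where k: "1 / real (Suc k) < \<delta>" using d nat_approx_posE by metis
      have "x \<in> O' k" using x by blast
      then obtain h where "h \<noteq> 0" "\<bar>h\<bar> < 1 / real (Suc k)" "x \<in> {a-h<..<b-h}" "(g (x + h) - g x) / h > q"
        unfolding O'_def by blast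
      then show ?thesis using k by (intro exI[of _ h]) auto
    qed
    ultimately show "x \<in> steep g ?S q" by (auto simp: steep_def)
  qed
  moreover have "steep g ?S q \<subseteq> {a<..<b}" by (auto simp: steep_def)
  ultimately have "steep g ?S q \<subseteq> {a<..<b}" "steep g ?S q \<in> sets lebesgue" by simp_all
  moreover have "{a<..<b} \<in> lmeasurable" by simp
  ultimately show ?thesis using fmeasurableI2 by blast
qed

text \<open>D is the limsup of the difference quotients, taken as the infimum of their eventual
  upper bounds: \<open>hi\<close> makes this set of bounds nonempty, \<open>lo\<close> bounds it
  below, and a liminf below D would be separated from D by two rationals p < q, which
  \<open>rat\<close> forbids.\<close>

lemma has_real_derivative_between_steep:
  assumes S: "open S" "x \<in> S" and hi: "x \<notin> steep g S q\<^sub>0" and lo: "x \<notin> steep (\<lambda>t. - g t) S r\<^sub>0"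
    and rat: "\<And>p q. \<lbrakk>p \<in> \<rat>; q \<in> \<rat>; p < q\<rbrakk> \<Longrightarrow> x \<notin> steep g S q \<inter> steep (\<lambda>t. - g t) S (- p)"
  obtains D where "(g has_real_derivative D) (at x)" "D \<le> q\<^sub>0"
proof -
  have ev: "eventually (\<lambda>h. (f (x + h) - f x) / h \<le> q) (at 0)" if "x \<notin> steep f S q" for f q
  proof -
    obtain \<delta> where d: "\<delta> > 0" "\<And>h. h \<noteq> 0 \<Longrightarrow> \<bar>h\<bar> < \<delta> \<Longrightarrow> x + h \<in> S \<Longrightarrow> (f (x + h) - f x) / h \<le> q"
      using \<open>x \<notin> steep f S q\<close> S(2) unfolding steep_def mem_Collect_eq by (metis not_less)
    obtain e where e: "e > 0" "ball x e \<subseteq> S" using S openE by blast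
    show ?thesis unfolding eventually_at
    proof (intro exI[of _ "min e \<delta>"] conjI ballI impI)
      fix h :: real assume "h \<noteq> 0 \<and> dist h 0 < min e \<delta>"
      then have "h \<noteq> 0" "\<bar>h\<bar> < \<delta>" "x + h \<in> ball x e" by (auto simp: dist_real_def)
      then show "(f (x + h) - f x) / h \<le> q" using d e by blast
    qed (use d e in auto)
  qed
  have ev': "eventually (\<lambda>h. (g (x + h) - g x) / h \<ge> - q) (at 0)" if "x \<notin> steep (\<lambda>t. - g t) S q" for q
    using ev[OF that] by eventually_elim (simp add: field_split_simps split: if_splits)
  define A where "A = {q. eventually (\<lambda>h. (g (x + h) - g x) / h \<le> q) (at 0)}"
  have q0: "q\<^sub>0 \<in> A" using ev[OF hi] by (simp add: A_def)
  have bd: "- r\<^sub>0 \<le> q" if "q \<in> A" for q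
  proof -
    have "eventually (\<lambda>h. (g (x + h) - g x) / h \<le> q \<and> (g (x + h) - g x) / h \<ge> - r\<^sub>0) (at 0)"
      using that ev'[OF lo] unfolding A_def by (auto intro: eventually_conj)
    then have "\<exists>h. (g (x + h) - g x) / h \<le> q \<and> (g (x + h) - g x) / h \<ge> - r\<^sub>0"
      by (rule eventually_happens'[OF at_neq_bot])
    then show ?thesis by linarith
  qed
  then have bdd: "bdd_below A" by (auto simp: bdd_below_def)
  define D where "D = Inf A"
  have "((\<lambda>h. (g (x + h) - g x) / h) \<longlongrightarrow> D) (at 0)"
  proof (rule order_tendstoI)
    fix u assume "u < D"
    obtain p where p: "p \<in> \<rat>" "u < p" "p < D" using Rats_dense_in_real[OF \<open>u < D\<close>] by auto
    obtain q where q: "q \<in> \<rat>" "p < q" "q < D" using Rats_dense_in_real[OF \<open>p < D\<close>] by auto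
    have "q \<notin> A" using q(3) cInf_lower[OF _ bdd, of q] unfolding D_def by auto
    then have "x \<in> steep g S q" using ev[of g q] by (auto simp: A_def)
    then have "x \<notin> steep (\<lambda>t. - g t) S (- p)" using rat[OF p(1) q(1,2)] by auto
    from ev'[OF this] show "eventually (\<lambda>h. u < (g (x + h) - g x) / h) (at 0)"
      by eventually_elim (use p in auto)
  next
    fix u assume "D < u"
    then obtain q where "q \<in> A" "q < u" unfolding D_def using q0 cInf_lessD by blast
    then show "eventually (\<lambda>h. (g (x + h) - g x) / h < u) (at 0)"
      unfolding A_def by (auto elim: eventually_mono)
  qed
  then have "(g has_real_derivative D) (at x)" by (simp add: DERIV_def)
  moreover have "D \<le> q\<^sub>0" unfolding D_def by (rule cInf_lower[OF q0 bdd])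
  ultimately show thesis by (rule that)
qed

text \<open>Away from a null set the upper derivate is at least -e for every e > 0: otherwise the
  derivative would exist there and be at most -e. So g + e x has nonnegative increments on a Vitali
  family filling almost all of [a,b], and absolute continuity controls the rest.\<close>

theorem abs_cont_on_deriv_nonneg_imp_le:
  fixes g :: "real \<Rightarrow> real"
  assumes "a \<le> b" and ac: "abs_cont_on {a..b} g" and N: "negligible N"
    and pos: "\<And>x D. \<lbrakk>x \<in> {a<..<b} - N; (g has_real_derivative D) (at x)\<rbrakk> \<Longrightarrow> D \<ge> 0"
  shows "g a \<le> g b"
proof -
  let ?S = "{a<..<b}" and ?g' = "\<lambda>t. - g t"
  have ac': "abs_cont_on {a..b} ?g'" by (rule abs_cont_on_uminus[OF ac])
  have cont: "continuous_on ?S g"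
    using abs_cont_on_imp_continuous_on[OF ac] by (rule continuous_on_subset) auto
  then have cont': "continuous_on ?S ?g'" by (intro continuous_intros)
  define Z where "Z p q = steep g ?S q \<inter> steep ?g' ?S (- p)" for p q
  \<comment> \<open>Only a lower derivate of -infinity has to be excluded; infinitely steep ascent
    does not hurt monotonicity.\<close>
  define Y where "Y = (\<Inter>k. steep ?g' ?S (real k))"
  have Z: "negligible (Z p q)" if "p < q" for p q
  proof (rule abs_cont_on_opposite_slopes_negligible)
    \<comment> \<open>Subtracting q x turns slopes above q into positive ones and slopes below p
      into slopes below -(q - p).\<close>
    show "abs_cont_on {a..b} (\<lambda>x. g x + (- q * x))"
      by (rule abs_cont_on_add[OF ac lipschitz_imp_abs_cont_on[of _ _ "\<bar>q\<bar>"]])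
        (auto simp: abs_mult right_diff_distrib[symmetric])
    show "q - p > 0" using that by simp
    show "Z p q \<in> lmeasurable" unfolding Z_def
      by (intro fmeasurable.Int steep_lmeasurable cont cont')
    show "Z p q \<subseteq> ?S" by (auto simp: Z_def steep_def)
    fix x \<delta> :: real assume x: "x \<in> Z p q" "\<delta> > 0"
    obtain c d where "c < d" "x \<in> {c..d}" "d - c < \<delta>" "q * (d - c) < g d - g c"
      using steep_interval[of x g ?S q \<delta>] x by (auto simp: Z_def)
    then show "\<exists>c d. c < d \<and> x \<in> {c..d} \<and> d - c < \<delta> \<and> g c + - q * c \<le> g d + - q * d"
      by (intro exI[of _ c] exI[of _ d]) (auto simp: algebra_simps)
    obtain c d where "c < d" "x \<in> {c..d}" "d - c < \<delta>" "- p * (d - c) < - g d - (- g c)"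
      using steep_interval[of x ?g' ?S "- p" \<delta>] x unfolding Z_def by blast
    then show "\<exists>c d. c < d \<and> x \<in> {c..d} \<and> d - c < \<delta> \<and> g d + - q * d - (g c + - q * c) \<le> - (q - p) * (d - c)"
      by (intro exI[of _ c] exI[of _ d]) (auto simp: algebra_simps)
  qed
  have Y: "negligible Y"
  proof (rule abs_cont_on_infinite_slopes_negligible[OF ac'])
    have "Y \<in> sets lebesgue" unfolding Y_def
      using steep_lmeasurable[OF cont'] by (intro sets.countable_INT) auto
    moreover have "Y \<subseteq> steep ?g' ?S 0" unfolding Y_def using INT_lower[of 0 UNIV "\<lambda>k. steep ?g' ?S (real k)"] by simp
    ultimately show "Y \<in> lmeasurable" using steep_lmeasurable[OF cont'] fmeasurableI2 by blast
    show YS: "Y \<subseteq> ?S" by (auto simp: Y_def steep_def)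
    fix x \<delta> q :: real assume x: "x \<in> Y" "\<delta> > 0"
    obtain k where k: "q \<le> real k" using real_arch_simple by blast
    have "x \<in> steep ?g' ?S (real k)" using x(1) unfolding Y_def by blast
    then obtain c d where cd: "c < d" "x \<in> {c..d}" "d - c < \<delta>" "real k * (d - c) < - g d - - g c"
      using steep_interval[of x ?g' ?S "real k" \<delta>] x(2) by blast
    have "q * (d - c) \<le> real k * (d - c)" using k cd by (intro mult_right_mono) auto
    then have "q * (d - c) \<le> - g d - - g c" using cd(4) by linarith
    then show "\<exists>c d. c < d \<and> x \<in> {c..d} \<and> d - c < \<delta> \<and> q * (d - c) \<le> - g d - - g c"
      using cd by blast
  qed
  define M where "M = N \<union> Y \<union> (\<Union>(p, q)\<in>{(p, q). p \<in> \<rat> \<and> q \<in> \<rat> \<and> p < q}. Z p q)"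
  have "countable {(p::real, q::real). p \<in> \<rat> \<and> q \<in> \<rat> \<and> p < q}"
    by (rule countable_subset[of _ "\<rat> \<times> \<rat>"]) (auto intro: countable_SIGMA countable_rat)
  then have M: "negligible M" unfolding M_def
    using N Y Z by (intro negligible_Un negligible_countable_Union) auto
  have up: "x \<in> steep g ?S (- e)" if x: "x \<in> ?S - M" and e: "e > 0" for x e
  proof (rule ccontr)
    assume hi: "x \<notin> steep g ?S (- e)"
    obtain k where lo: "x \<notin> steep ?g' ?S (real k)" using x by (auto simp: M_def Y_def)
    have "x \<notin> steep g ?S q \<inter> steep ?g' ?S (- p)" if "p \<in> \<rat>" "q \<in> \<rat>" "p < q" for p q
      using x that unfolding M_def Z_def by blast
    then obtain D where "(g has_real_derivative D) (at x)" "D \<le> - e"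
      using has_real_derivative_between_steep[OF _ _ hi lo] x by (metis DiffD1 open_greaterThanLessThan)
    then show False using pos[of x D] x e by (auto simp: M_def)
  qed
  have "g a \<le> g b + \<epsilon>" if e0: "\<epsilon> > 0" for \<epsilon>
  proof -
    obtain \<delta>0 where d0: "\<delta>0 > 0" and AC: 
      "\<And>R. \<lbrakk>nonoverlapping a b R; (\<Sum>(c, d)\<in>R. d - c) < \<delta>0\<rbrakk> \<Longrightarrow> (\<Sum>(c, d)\<in>R. \<bar>g d - g c\<bar>) < \<epsilon>/2"
      using abs_cont_on_pairs[OF ac half_gt_zero[OF e0]] by blast
    \<comment> \<open>Of the allowed loss \<epsilon>, the variation of g on the gaps takes one half,
      and the two contributions of the tilt e x, over the gaps and over [a,b], a quarter
      each.\<close>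
    define e where "e = \<epsilon> / 4 / (b - a + 1)"
    have e: "e > 0" "e * (b - a) \<le> \<epsilon>/4" using e0 \<open>a \<le> b\<close> by (auto simp: e_def field_simps)
    define \<delta> where "\<delta> = min \<delta>0 (b - a + 1)"
    have d: "\<delta> > 0" "\<delta> \<le> \<delta>0" "e * \<delta> \<le> \<epsilon>/4"
    proof -
      show "\<delta> > 0" "\<delta> \<le> \<delta>0" using d0 \<open>a \<le> b\<close> by (auto simp: \<delta>_def)
      have "e * \<delta> \<le> e * (b - a + 1)" using e by (intro mult_left_mono) (auto simp: \<delta>_def)
      also have "\<dots> = \<epsilon>/4"
      proof -
        have "b - a + 1 \<noteq> 0" using \<open>a \<le> b\<close> by linarith
        then show ?thesis using e_def nonzero_eq_divide_eq by blast
      qed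
      finally show "e * \<delta> \<le> \<epsilon>/4" .
    qed
    have SM: "?S - M \<in> lmeasurable" using M by (intro fmeasurable_Diff) (auto dest: negligible_imp_sets)
    have mS: "measure lebesgue (?S - M) = b - a"
    proof -
      have "measure lebesgue (?S - M) = measure lebesgue ?S"
        by (rule measure_negligible_symdiff) (auto intro: negligible_subset[OF M])
      then show ?thesis using \<open>a \<le> b\<close> by simp
    qed
    have "\<exists>R. nonoverlapping a b R \<and>
     (\<Sum>(c, d)\<in>R. d - c) < b - a - measure lebesgue (?S - M) + \<delta> \<and>
     (g b + e * b) - (g a + e * a) \<ge> - (\<Sum>(c, d)\<in>R. \<bar>(g d + e * d) - (g c + e * c)\<bar>)"
    proof (rule increment_ge_rest[OF \<open>a \<le> b\<close> SM _ _ d(1)])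
      fix x \<delta> :: real assume "x \<in> ?S - M" "\<delta> > 0"
      then obtain c d where "c < d" "x \<in> {c..d}" "d - c < \<delta>" "- e * (d - c) < g d - g c"
        using steep_interval[OF up[of x e]] e(1) by blast
      then show "\<exists>c d. c < d \<and> x \<in> {c..d} \<and> d - c < \<delta> \<and> g c + e * c \<le> g d + e * d"
        by (intro exI[of _ c] exI[of _ d]) (auto simp: algebra_simps)
    qed auto
    then obtain R where R: "nonoverlapping a b R"
      "(\<Sum>(c, d)\<in>R. d - c) < \<delta>"
      "(g b + e * b) - (g a + e * a) \<ge> - (\<Sum>(c, d)\<in>R. \<bar>(g d + e * d) - (g c + e * c)\<bar>)"
      unfolding mS by auto
    have Rle: "c \<le> d" if "(c, d) \<in> R" for c d using R(1) that by (auto simp: nonoverlapping_def)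
    have "(\<Sum>(c, d)\<in>R. \<bar>(g d + e * d) - (g c + e * c)\<bar>) \<le> (\<Sum>p\<in>R. \<bar>g (snd p) - g (fst p)\<bar> + e * (snd p - fst p))"
    proof (rule sum_mono, clarify)
      fix c d assume "(c, d) \<in> R"
      then have "c \<le> d" by (rule Rle)
      then have "0 \<le> e * (d - c)" using e by simp
      then show "\<bar>g d + e * d - (g c + e * c)\<bar> \<le> \<bar>g (snd (c, d)) - g (fst (c, d))\<bar> + e * (snd (c, d) - fst (c, d))"
        by (simp add: right_diff_distrib)
    qed
    also have "\<dots> = (\<Sum>(c, d)\<in>R. \<bar>g d - g c\<bar>) + e * (\<Sum>(c, d)\<in>R. d - c)"
      by (simp add: sum.distrib sum_distrib_left case_prod_beta)
    also have "\<dots> \<le> \<epsilon>/2 + \<epsilon>/4"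
    proof -
      have "(\<Sum>(c, d)\<in>R. \<bar>g d - g c\<bar>) < \<epsilon>/2"
        using AC[OF R(1)] R(2) d(2) by simp
      moreover have "e * (\<Sum>(c, d)\<in>R. d - c) \<le> e * \<delta>" using R(2) e by (intro mult_left_mono) auto
      ultimately show ?thesis using d(3) by linarith
    qed
    finally have "- (3/4 * \<epsilon>) \<le> (g b + e * b) - (g a + e * a)" using R(3) by linarith
    then show ?thesis using e(2) by (simp add: right_diff_distrib)
  qed
  then show ?thesis by (rule field_le_epsilon)
qed

section \<open>Second differences\<close>

lemma C1_imp_abs_cont_on:
  assumes "\<And>x. x \<in> {a..b} \<Longrightarrow> (H has_real_derivative H' x) (at x)" "continuous_on {a..b} H'"
  shows "abs_cont_on {a..b} H"
proof (cases "a \<le> b")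
  case True
  obtain L where L: "\<And>x. x \<in> {a..b} \<Longrightarrow> \<bar>H' x\<bar> \<le> L"
    using compact_imp_bounded[OF compact_continuous_image[OF assms(2) compact_Icc]]
    unfolding bounded_iff real_norm_def by blast
  show ?thesis
  proof (rule lipschitz_imp_abs_cont_on)
    fix x y assume xy: "x \<in> {a..b}" "y \<in> {a..b}" "x \<le> y"
    show "\<bar>H y - H x\<bar> \<le> L * (y - x)"
    proof (cases "x = y")
      case False
      then obtain z where z: "z > x" "z < y" "H y - H x = (y - x) * H' z"
        using MVT2[of x y H H'] assms(1) xy by auto
      then have "\<bar>H y - H x\<bar> = \<bar>H' z\<bar> * (y - x)" using xy by (simp add: abs_mult)
      also have "\<dots> \<le> L * (y - x)" using L[of z] z xy by (intro mult_right_mono) auto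
      finally show ?thesis .
    qed simp
  qed
qed (auto intro: lipschitz_imp_abs_cont_on)

text \<open>H + g and H - g are nondecreasing. The criterion only asks about points where this sum
  or difference is differentiable; H is differentiable, so g is so too at such a point and
  \<open>deriv g x\<close> is its true derivative. Unspecified values of \<open>deriv\<close> never
  enter.\<close>

lemma abs_cont_on_increment_le:
  assumes ac: "abs_cont_on {s..t} g" and st: "s \<le> t" and N: "negligible N"
    and H: "\<And>x. x \<in> {s..t} \<Longrightarrow> (H has_real_derivative H' x) (at x)" "continuous_on {s..t} H'"
    and le: "\<And>x. x \<in> {s..t} - N \<Longrightarrow> \<bar>deriv g x\<bar> \<le> H' x"
  shows "\<bar>g t - g s\<bar> \<le> H t - H s"
proof -
  note acH = C1_imp_abs_cont_on[OF H]
  have "H s + g s \<le> H t + g t"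
  proof (rule abs_cont_on_deriv_nonneg_imp_le[OF st abs_cont_on_add[OF acH ac] N])
    fix x D assume x: "x \<in> {s<..<t} - N" and D: "((\<lambda>x. H x + g x) has_real_derivative D) (at x)"
    have "((\<lambda>x. (H x + g x) - H x) has_real_derivative D - H' x) (at x)"
      using x by (intro DERIV_diff D H) auto
    then have "deriv g x = D - H' x" by (intro DERIV_imp_deriv) simp
    then show "D \<ge> 0" using le[of x] x by auto
  qed
  moreover have "H s + - g s \<le> H t + - g t"
  proof (rule abs_cont_on_deriv_nonneg_imp_le[OF st abs_cont_on_add[OF acH abs_cont_on_uminus[OF ac]] N])
    fix x D assume x: "x \<in> {s<..<t} - N" and D: "((\<lambda>x. H x + - g x) has_real_derivative D) (at x)"
    have "((\<lambda>x. H x - (H x + - g x)) has_real_derivative H' x - D) (at x)"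
      using x by (intro DERIV_diff D H) auto
    then have "deriv g x = H' x - D" by (intro DERIV_imp_deriv) simp
    then show "D \<ge> 0" using le[of x] x by auto
  qed
  ultimately show ?thesis by linarith
qed

lemma locally_abs_cont_onD:
  "\<lbrakk>locally_abs_cont_on S g; s \<le> t; {s..t} \<subseteq> S\<rbrakk> \<Longrightarrow> abs_cont_on {s..t} g"
  by (simp add: locally_abs_cont_on_def)

lemma locally_abs_cont_on_imp_continuous_on:
  fixes a b :: real
  assumes "locally_abs_cont_on {a<..<b} g"
  shows "continuous_on {a<..<b} g"
proof (rule continuous_at_imp_continuous_on, rule ballI)
  fix x assume x: "x \<in> {a<..<b}"
  have "abs_cont_on {(a + x) / 2..(x + b) / 2} g"
  proof (rule locally_abs_cont_onD[OF assms])
    show "(a + x) / 2 \<le> (x + b) / 2" using x by simp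
    show "{(a + x) / 2..(x + b) / 2} \<subseteq> {a<..<b}" using x by (intro subsetI) (auto simp: field_simps)
  qed
  then have "continuous_on {(a + x) / 2..(x + b) / 2} g" by (rule abs_cont_on_imp_continuous_on)
  moreover have "x \<in> interior {(a + x) / 2..(x + b) / 2}" using x by (simp add: interior_atLeastAtMost_real)
  ultimately show "isCont g x" by (simp add: continuous_on_interior)
qed

definition second_diff :: "(real \<Rightarrow> real) \<Rightarrow> real \<Rightarrow> real \<Rightarrow> real" where
  "second_diff f h y = f (y + h) - 2 * f y + f (y - h)"

text \<open>The mean value theorem on both halves. Differentiability is asked only inside the window
  and continuity up to its ends, because the window may touch 0 or 1, where f is merely
  continuous.\<close>

lemma second_diff_nonneg:
  assumes h: "h > 0" and c: "continuous_on {y-h..y+h} k"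
    and d: "\<And>t. t \<in> {y-h<..<y+h} \<Longrightarrow> (k has_real_derivative k' t) (at t)"
    and mono: "\<And>s t. \<lbrakk>y - h < s; s \<le> t; t < y + h\<rbrakk> \<Longrightarrow> k' s \<le> k' t"
  shows "second_diff k h y \<ge> 0"
proof -
  obtain z1 where z1: "y < z1" "z1 < y + h" "k (y + h) - k y = (y + h - y) * k' z1"
  proof -
    have "\<exists>l z. y < z \<and> z < y + h \<and> DERIV k z :> l \<and> k (y + h) - k y = (y + h - y) * l"
    proof (rule MVT)
      show "continuous_on {y..y+h} k" by (rule continuous_on_subset[OF c]) (use h in auto)
      show "k differentiable (at x)" if "y < x" "x < y + h" for x
        using d[of x] that h by (force simp: real_differentiable_def)
    qed (use h in auto)
    then obtain l z where z: "y < z" "z < y + h" "DERIV k z :> l" "k (y + h) - k y = (y + h - y) * l" by blast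
    have "l = k' z" using DERIV_unique[OF z(3) d[of z]] z h by simp
    then show thesis using that z by blast
  qed
  obtain z2 where z2: "y - h < z2" "z2 < y" "k y - k (y - h) = (y - (y - h)) * k' z2"
  proof -
    have "\<exists>l z. y - h < z \<and> z < y \<and> DERIV k z :> l \<and> k y - k (y - h) = (y - (y - h)) * l"
    proof (rule MVT)
      show "continuous_on {y-h..y} k" by (rule continuous_on_subset[OF c]) (use h in auto)
      show "k differentiable (at x)" if "y - h < x" "x < y" for x
        using d[of x] that h by (force simp: real_differentiable_def)
    qed (use h in auto)
    then obtain l z where z: "y - h < z" "z < y" "DERIV k z :> l" "k y - k (y - h) = (y - (y - h)) * l" by blast
    have "l = k' z" using DERIV_unique[OF z(3) d[of z]] z h by simp
    then show thesis using that z by blast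
  qed
  have "second_diff k h y = (k (y + h) - k y) - (k y - k (y - h))" by (simp add: second_diff_def)
  also have "\<dots> = h * (k' z1 - k' z2)" unfolding z1(3) z2(3) by (simp add: algebra_simps)
  also have "\<dots> \<ge> 0" using h mono[of z2 z1] z1 z2 by simp
  finally show ?thesis .
qed

text \<open>Increments of g are dominated by those of G', so G + f and G - f have nondecreasing
  derivatives and are convex on the window.\<close>

lemma second_diff_le_majorant:
  assumes h: "h > 0" and c: "continuous_on {y-h..y+h} f" "continuous_on {y-h..y+h} G"
    and f: "\<And>t. t \<in> {y-h<..<y+h} \<Longrightarrow> (f has_real_derivative g t) (at t)"
    and G: "\<And>t. t \<in> {y-h<..<y+h} \<Longrightarrow> (G has_real_derivative G' t) (at t)"
    and G': "\<And>t. t \<in> {y-h<..<y+h} \<Longrightarrow> (G' has_real_derivative G'' t) (at t)"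
    and cont: "continuous_on {y-h<..<y+h} G''"
    and ac: "\<And>s t. {s..t} \<subseteq> {y-h<..<y+h} \<Longrightarrow> s \<le> t \<Longrightarrow> abs_cont_on {s..t} g"
    and N: "negligible N" and le: "\<And>x. x \<in> {y-h<..<y+h} - N \<Longrightarrow> \<bar>deriv g x\<bar> \<le> G'' x"
  shows "\<bar>second_diff f h y\<bar> \<le> second_diff G h y"
proof -
  have inc: "\<bar>g t - g s\<bar> \<le> G' t - G' s" if st: "y - h < s" "s \<le> t" "t < y + h" for s t
  proof -
    have sub: "{s..t} \<subseteq> {y-h<..<y+h}" using st by auto
    show ?thesis
      by (rule abs_cont_on_increment_le[OF ac[OF sub st(2)] st(2) N _ continuous_on_subset[OF cont sub]])
        (use sub G' le in auto)
  qed
  have "second_diff (\<lambda>x. G x + f x) h y \<ge> 0"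
    by (rule second_diff_nonneg[OF h, where k' = "\<lambda>t. G' t + g t"])
      (use c f G inc in \<open>force intro!: continuous_intros derivative_intros\<close>)+
  moreover have "second_diff (\<lambda>x. G x - f x) h y \<ge> 0"
    by (rule second_diff_nonneg[OF h, where k' = "\<lambda>t. G' t - g t"])
      (use c f G inc in \<open>force intro!: continuous_intros derivative_intros\<close>)+
  ultimately show ?thesis by (simp add: second_diff_def)
qed

text \<open>The bound is uniform up to h = y, where the window reaches 0. It is linear in h, and the
  factor 2 h in the later majorant brings it to order h^2.\<close>

lemma second_diff_xlnx_le:
  assumes h: "h > 0" "h \<le> y"
  shows "second_diff (\<lambda>t. t * ln t) h y \<le> 2 * h"
proof -
  have y: "y > 0" using h by simp
  have "ln (y + h) - ln y \<le> h / y" using ln_diff_le[of "y + h" y] h y by simp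
  then have "(y + h) * ln (y + h) \<le> (y + h) * (ln y + h / y)" using h y by (intro mult_left_mono) auto
  moreover have "(y + h) * (h / y) \<le> (y + y) * (h / y)" using h y by (intro mult_right_mono) auto
  moreover have "(y + y) * (h / y) = 2 * h" using y by simp
  moreover have "(y - h) * ln (y - h) \<le> (y - h) * ln y"
  \<comment> \<open>For y = h the logarithm is taken at 0, a default value that its factor 0
    removes.\<close>
  proof (cases "y = h")
    case False
    then show ?thesis using h by (intro mult_left_mono) auto
  qed simp
  ultimately show ?thesis by (simp add: second_diff_def algebra_simps)
qed

lemma continuous_on_xlnx: "continuous_on {0..1} (\<lambda>t::real. t * ln t)"
  unfolding continuous_on_def
proof
  fix x :: real assume x: "x \<in> {0..1}"
  show "((\<lambda>t. t * ln t) \<longlongrightarrow> x * ln x) (at x within {0..1})"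
  proof (cases "x = 0")
    case True
    have "((\<lambda>t::real. t * ln t) \<longlongrightarrow> 0) (at_right 0)" by real_asymp
    then have "((\<lambda>t::real. t * ln t) \<longlongrightarrow> 0) (at 0 within {0..})"
      by (simp add: tendsto_within_subset at_within_Ici_at_right)
    then show ?thesis using True by (auto intro: tendsto_within_subset)
  next
    case False
    then show ?thesis using x by (intro tendsto_intros) auto
  qed
qed

section \<open>Powers of phi at neighbouring points and weighted second differences\<close>

lemma phi_pow_eq: "0 < t \<Longrightarrow> t < 1 \<Longrightarrow> phi_pow (2 * lam) t = (t * (1 - t)) powr lam"
  unfolding phi_pow_def phi_def by (simp add: powr_half_sqrt[symmetric] powr_powr)

lemma phi_pow_nonneg: "phi_pow s x \<ge> 0"
  by (simp add: phi_pow_def)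

lemma powr_le_of_le:
  fixes a R lam :: real
  assumes "0 \<le> a" "a \<le> R" "1 \<le> R" "0 \<le> lam" "lam \<le> 1"
  shows "a powr lam \<le> R"
proof -
  have "a powr lam \<le> R powr lam" using assms by (intro powr_mono2) auto
  also have "\<dots> \<le> R powr 1" using assms by (intro powr_mono) auto
  finally show ?thesis using assms by simp
qed

text \<open>The ratio of the weights may blow up as t nears an endpoint, but y (1 - y) \<le> t (1 -
  t) + 2 h, and dividing by t (1 - t) splits 2 h into two partial fractions. The bound is at least 1
  and therefore survives the power \<open>lam\<close> \<le> 1.\<close>

lemma phi_pow_ratio_le:
  assumes h: "h > 0" "0 \<le> y - h" "y + h \<le> 1" and t: "t \<in> {y-h<..<y+h}" and lam: "0 \<le> lam" "lam \<le> 1"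
  shows "phi_pow (2 * lam) y \<le> (1 + 2 * h / t + 2 * h / (1 - t)) * phi_pow (2 * lam) t"
proof -
  have t01: "0 < t" "t < 1" and y01: "0 < y" "y < 1" using h t by auto
  let ?R = "1 + 2 * h / t + 2 * h / (1 - t)"
  have R1: "?R \<ge> 1" using h t01 by simp
  have a: "y \<le> t + h" "1 - y \<le> (1 - t) + h" using t by auto
  have "y * (1 - y) \<le> (t + h) * (1 - t + h)" using a y01 t01 h by (intro mult_mono) auto
  also have "\<dots> = t * (1 - t) + h + h * h" by (simp add: algebra_simps)
  also have "\<dots> \<le> t * (1 - t) + 2 * h"
  proof -
    have "h * h \<le> h * 1" using h by (intro mult_left_mono) auto
    then show ?thesis by simp
  qed
  also have "\<dots> = ?R * (t * (1 - t))" using t01 by (simp add: field_simps)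
  finally have "y * (1 - y) / (t * (1 - t)) \<le> ?R" using t01 by (simp add: pos_divide_le_eq)
  then have "(y * (1 - y) / (t * (1 - t))) powr lam \<le> ?R"
    using R1 lam y01 t01 by (intro powr_le_of_le) auto
  then have "(y * (1 - y)) powr lam / (t * (1 - t)) powr lam \<le> ?R"
    using y01 t01 by (simp add: powr_divide)
  then show ?thesis using t01 y01 by (simp add: phi_pow_eq pos_divide_le_eq)
qed

text \<open>Freezing the weight at y costs the factor of \<open>phi_pow_ratio_le\<close>; the
  resulting bound on \<open>deriv g\<close> is integrated twice to a majorant whose logarithmic
  terms have second differences of order h. The constant 9 is 1 + 4 + 4.\<close>

lemma second_diff_phi_weighted_le:
  assumes cf: "continuous_on {0..1} f"
    and f: "\<And>t. t \<in> {0<..<1} \<Longrightarrow> (f has_real_derivative g t) (at t)"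
    and ac: "locally_abs_cont_on {0<..<1} g" and N: "negligible N"
    and h: "h > 0" "0 \<le> y - h" "y + h \<le> 1" and lam: "0 \<le> lam" "lam \<le> 1" and M: "M \<ge> 0"
    and le: "\<And>t. t \<in> {y-h<..<y+h} - N \<Longrightarrow> \<bar>deriv g t\<bar> * phi_pow (2 * lam) t \<le> M"
  shows "\<bar>second_diff f h y\<bar> * phi_pow (2 * lam) y \<le> 9 * M * h\<^sup>2"
proof -
  have y01: "0 < y" "y < 1" using h by auto
  have sub: "{y-h..y+h} \<subseteq> {0..1}" and subo: "{y-h<..<y+h} \<subseteq> {0<..<1}" using h by auto
  define w where "w = phi_pow (2 * lam) y"
  have w: "w > 0" using y01 by (simp add: w_def phi_pow_eq)
  define G where "G t = (M/w) * (t\<^sup>2 / 2 + 2 * h * (t * ln t) + 2 * h * ((1 - t) * ln (1 - t)))" for t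
  define G' where "G' t = (M/w) * (t + 2 * h * (ln t + 1) + 2 * h * (- (ln (1 - t) + 1)))" for t
  define G'' where "G'' t = (M/w) * (1 + 2 * h / t + 2 * h / (1 - t))" for t
  have "\<bar>second_diff f h y\<bar> \<le> second_diff G h y"
  proof (rule second_diff_le_majorant[OF h(1) _ _ _ _ _ _ _ N])
    show "continuous_on {y-h..y+h} f" using cf sub by (rule continuous_on_subset)
    have c0: "continuous_on {0..1} (\<lambda>t::real. t\<^sup>2 / 2)" by (intro continuous_intros) auto
    have c1: "continuous_on {0..1} (\<lambda>t::real. (1 - t) * ln (1 - t))"
      by (rule continuous_on_compose2[OF continuous_on_xlnx]) (auto intro!: continuous_intros)
    have "continuous_on {0..1} G" unfolding G_def
      by (intro continuous_on_mult_left continuous_on_add c0 c1 continuous_on_xlnx)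
    then show "continuous_on {y-h..y+h} G" using sub by (rule continuous_on_subset)
    show "abs_cont_on {s..t} g" if "{s..t} \<subseteq> {y-h<..<y+h}" "s \<le> t" for s t
      using locally_abs_cont_onD[OF ac that(2) order_trans[OF that(1) subo]] .
    show "continuous_on {y-h<..<y+h} G''"
      unfolding G''_def using subo by (intro continuous_intros) auto
    fix t assume t: "t \<in> {y-h<..<y+h}"
    then have t01: "0 < t" "t < 1" using subo by auto
    show "(f has_real_derivative g t) (at t)" using f t01 by simp
    show "(G has_real_derivative G' t) (at t)"
    proof -
      have "((\<lambda>t. t * ln t) has_real_derivative ln t + 1) (at t)"
        using t01 by (auto intro!: derivative_eq_intros)
      moreover have "((\<lambda>t. (1 - t) * ln (1 - t)) has_real_derivative - (ln (1 - t) + 1)) (at t)"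
        using t01 by (auto intro!: derivative_eq_intros simp: field_simps)
      moreover have "((\<lambda>t::real. t\<^sup>2 / 2) has_real_derivative t) (at t)"
        by (auto intro!: derivative_eq_intros)
      ultimately have "(G has_real_derivative (M/w) * (t + 2 * h * (ln t + 1) + 2 * h * (- (ln (1 - t) + 1)))) (at t)"
        unfolding G_def by (intro DERIV_cmult DERIV_add)
      then show ?thesis unfolding G'_def .
    qed
    show "(G' has_real_derivative G'' t) (at t)"
    proof -
      have "(ln has_real_derivative 1 / t) (at t)"
        using t01 by (auto intro!: derivative_eq_intros)
      moreover have "((\<lambda>t. ln (1 - t)) has_real_derivative - (1 / (1 - t))) (at t)"
        using t01 by (auto intro!: derivative_eq_intros)
      ultimately have "(G' has_real_derivative (M/w) * (1 + 2 * h * (1 / t + 0) + 2 * h * (- (- (1 / (1 - t)) + 0)))) (at t)"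
        unfolding G'_def by (intro DERIV_cmult DERIV_add DERIV_minus DERIV_ident DERIV_const)
      then show ?thesis unfolding G''_def by simp
    qed
  next
    fix t assume t: "t \<in> {y-h<..<y+h} - N"
    then have t01: "0 < t" "t < 1" using subo by auto
    let ?R = "1 + 2 * h / t + 2 * h / (1 - t)"
    have R: "?R \<ge> 0" using h t01 by simp
    have "\<bar>deriv g t\<bar> * w \<le> \<bar>deriv g t\<bar> * (?R * phi_pow (2 * lam) t)"
      unfolding w_def using t by (intro mult_left_mono phi_pow_ratio_le h lam) auto
    also have "\<dots> = ?R * (\<bar>deriv g t\<bar> * phi_pow (2 * lam) t)" by simp
    also have "\<dots> \<le> ?R * M" using le[OF t] R by (intro mult_left_mono)
    finally show "\<bar>deriv g t\<bar> \<le> G'' t" using w by (simp add: G''_def field_simps)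
  qed
  \<comment> \<open>By symmetry the second difference of (1 - t) ln (1 - t) at y is that of t ln t
    at 1 - y.\<close>
  also have "second_diff G h y = (M/w) * (h\<^sup>2 + 2 * h * second_diff (\<lambda>t. t * ln t) h y
      + 2 * h * second_diff (\<lambda>t. t * ln t) h (1 - y))"
    unfolding second_diff_def G_def by (simp add: algebra_simps power2_eq_square add_divide_distrib diff_divide_distrib)
  also have "\<dots> \<le> (M/w) * (h\<^sup>2 + 2 * h * (2 * h) + 2 * h * (2 * h))"
    using h w M by (intro mult_left_mono add_mono order_refl second_diff_xlnx_le) auto
  finally show ?thesis using w unfolding w_def[symmetric] by (simp add: field_simps power2_eq_square)
qed

text \<open>Integrating |t - \<xi>|^(-\<alpha>) gives \<rho>^(1-\<alpha>) when \<alpha> < 1. For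
  \<alpha> >= 1 the integral diverges, but then \<rho>^(1-\<alpha>) is at least 1 for small \<rho>,
  and boundedness of the continuous g near \<xi> is enough; in that case C depends on g itself and
  not only on K.\<close>

lemma deriv_variation_near_singularity:
  assumes xi: "0 < \<xi>" "\<xi> < 1" and alpha: "\<alpha> > 0" and lam: "0 \<le> lam" "lam \<le> 1"
    and ac: "locally_abs_cont_on {0<..<1} g" and N: "negligible N" and K: "K \<ge> 0"
    and le: "\<And>t. t \<in> {0<..<1} - N \<Longrightarrow> wbar \<xi> \<alpha> t * phi_pow (2 * lam) t * \<bar>deriv g t\<bar> \<le> K"
  obtains C \<rho>\<^sub>0 where "C \<ge> 0" "\<rho>\<^sub>0 > 0" "{\<xi>-\<rho>\<^sub>0..\<xi>+\<rho>\<^sub>0} \<subseteq> {0<..<1}"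
    "\<And>\<rho> s t. \<lbrakk>0 < \<rho>; \<rho> \<le> \<rho>\<^sub>0; s \<in> {\<xi>-\<rho>..\<xi>+\<rho>}; t \<in> {\<xi>-\<rho>..\<xi>+\<rho>}\<rbrakk> \<Longrightarrow> \<bar>g s - g t\<bar> \<le> C * \<rho> powr (1 - \<alpha>)"
proof -
  define r where "r = min \<xi> (1 - \<xi>) / 2"
  have r: "0 < r" "r < 1" "2 * r \<le> \<xi>" "2 * r \<le> 1 - \<xi>" using xi by (auto simp: r_def)
  have sub: "{\<xi>-r..\<xi>+r} \<subseteq> {0<..<1}" using r by auto
  have cont: "continuous_on {\<xi>-r..\<xi>+r} g"
    using locally_abs_cont_on_imp_continuous_on[OF ac] sub by (rule continuous_on_subset)
  show thesis
  proof (cases "\<alpha> \<ge> 1")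
    case True
    obtain B where B: "\<And>x. x \<in> {\<xi>-r..\<xi>+r} \<Longrightarrow> \<bar>g x\<bar> \<le> B"
      using compact_imp_bounded[OF compact_continuous_image[OF cont compact_Icc]]
      unfolding bounded_iff real_norm_def by blast
    have B0: "B \<ge> 0" using B[of \<xi>] r by auto
    show thesis
    proof (rule that[of "2 * B" r])
      fix \<rho> s t assume \<rho>: "0 < \<rho>" "\<rho> \<le> r" and st: "s \<in> {\<xi>-\<rho>..\<xi>+\<rho>}" "t \<in> {\<xi>-\<rho>..\<xi>+\<rho>}"
      have "\<bar>g s - g t\<bar> \<le> 2 * B * 1" using B[of s] B[of t] \<rho> st by auto
      also have "1 \<le> \<rho> powr (1 - \<alpha>)"
      proof -
        have "\<rho> powr 0 \<le> \<rho> powr (1 - \<alpha>)" using \<rho> r True by (intro powr_mono') auto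
        then show ?thesis using \<rho> by simp
      qed
      finally show "\<bar>g s - g t\<bar> \<le> 2 * B * \<rho> powr (1 - \<alpha>)" using B0 by (simp add: mult_left_mono)
    qed (use B0 r sub in auto)
  next
    case False
    then have a1: "\<alpha> < 1" by simp
    define m where "m = (r * r) powr lam"
    have m: "m > 0" using r by (simp add: m_def)
    define A where "A = K / m"
    have A: "A \<ge> 0" using K m by (simp add: A_def)
    have der: "\<bar>deriv g t\<bar> \<le> A * \<bar>t - \<xi>\<bar> powr (- \<alpha>)" if t: "t \<in> {\<xi>-r..\<xi>+r} - N" "t \<noteq> \<xi>" for t
    proof -
      have t01: "0 < t" "t < 1" "r \<le> t" "r \<le> 1 - t" using t r by auto
      have "m \<le> phi_pow (2 * lam) t"
        unfolding m_def phi_pow_eq[OF t01(1,2)] using t01 r lam by (intro powr_mono2 mult_mono) auto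
      then have "wbar \<xi> \<alpha> t * m * \<bar>deriv g t\<bar> \<le> wbar \<xi> \<alpha> t * phi_pow (2 * lam) t * \<bar>deriv g t\<bar>"
        by (intro mult_right_mono mult_left_mono) (auto simp: wbar_def)
      also have "\<dots> \<le> K" using le t t01 by auto
      finally show ?thesis using t m by (simp add: wbar_def A_def powr_minus field_simps)
    qed
    define C1 where "C1 = A / (1 - \<alpha>)"
    have C1: "C1 \<ge> 0" using A a1 by (simp add: C1_def)
    have right: "\<bar>g t - g \<xi>\<bar> \<le> C1 * (t - \<xi>) powr (1 - \<alpha>)" if t: "\<xi> < t" "t \<le> \<xi> + r" for t
    proof -
      \<comment> \<open>The comparison function has infinite slope at \<xi>, so the estimate is
        first made on [s,t] with s > \<xi>; continuity of g then lets s tend to \<xi>.\<close>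
      have "\<bar>g t - g s\<bar> \<le> C1 * (t - \<xi>) powr (1 - \<alpha>)" if s: "\<xi> < s" "s < t" for s
      proof -
        have "\<bar>g t - g s\<bar> \<le> C1 * (t - \<xi>) powr (1 - \<alpha>) - C1 * (s - \<xi>) powr (1 - \<alpha>)"
        proof (rule abs_cont_on_increment_le[OF _ _ N, where H' = "\<lambda>x. A * (x - \<xi>) powr (- \<alpha>)"])
          show "abs_cont_on {s..t} g" using s t by (intro locally_abs_cont_onD[OF ac] order_trans[OF _ sub]) auto
          show "((\<lambda>x. C1 * (x - \<xi>) powr (1 - \<alpha>)) has_real_derivative A * (x - \<xi>) powr - \<alpha>) (at x)"
            if "x \<in> {s..t}" for x
            using that s a1 unfolding C1_def by (auto intro!: derivative_eq_intros)
          show "continuous_on {s..t} (\<lambda>x. A * (x - \<xi>) powr - \<alpha>)"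
            using s by (intro continuous_intros) auto
          show "\<bar>deriv g x\<bar> \<le> A * (x - \<xi>) powr - \<alpha>" if "x \<in> {s..t} - N" for x
            using der[of x] that s t by auto
        qed (use s in auto)
        also have "\<dots> \<le> C1 * (t - \<xi>) powr (1 - \<alpha>)" using C1 by simp
        finally show ?thesis .
      qed
      then have ev: "eventually (\<lambda>s. \<bar>g t - g s\<bar> \<le> C1 * (t - \<xi>) powr (1 - \<alpha>)) (at_right \<xi>)"
        unfolding eventually_at_right_field using t by blast
      have "isCont g \<xi>" using cont r by (intro continuous_on_interior[OF cont]) (auto simp: interior_atLeastAtMost_real)
      then have "(g \<longlongrightarrow> g \<xi>) (at_right \<xi>)" by (simp add: isCont_def filterlim_at_split)
      then have "((\<lambda>s. \<bar>g t - g s\<bar>) \<longlongrightarrow> \<bar>g t - g \<xi>\<bar>) (at_right \<xi>)" by (intro tendsto_intros)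
      then show ?thesis using ev by (rule tendsto_upperbound) simp
    qed
    have left: "\<bar>g t - g \<xi>\<bar> \<le> C1 * (\<xi> - t) powr (1 - \<alpha>)" if t: "t < \<xi>" "\<xi> - r \<le> t" for t
    proof -
      have "\<bar>g t - g s\<bar> \<le> C1 * (\<xi> - t) powr (1 - \<alpha>)" if s: "t < s" "s < \<xi>" for s
      proof -
        have "\<bar>g s - g t\<bar> \<le> - C1 * (\<xi> - s) powr (1 - \<alpha>) - - C1 * (\<xi> - t) powr (1 - \<alpha>)"
        proof (rule abs_cont_on_increment_le[OF _ _ N, where H' = "\<lambda>x. A * (\<xi> - x) powr (- \<alpha>)"])
          show "abs_cont_on {t..s} g" using s t by (intro locally_abs_cont_onD[OF ac] order_trans[OF _ sub]) auto
          show "((\<lambda>x. - C1 * (\<xi> - x) powr (1 - \<alpha>)) has_real_derivative A * (\<xi> - x) powr - \<alpha>) (at x)"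
            if "x \<in> {t..s}" for x
            using that s a1 unfolding C1_def by (auto intro!: derivative_eq_intros)
          show "continuous_on {t..s} (\<lambda>x. A * (\<xi> - x) powr - \<alpha>)"
            using s by (intro continuous_intros) auto
          show "\<bar>deriv g x\<bar> \<le> A * (\<xi> - x) powr - \<alpha>" if "x \<in> {t..s} - N" for x
            using der[of x] that s t by (auto simp: abs_minus_commute)
        qed (use s in auto)
        also have "\<dots> \<le> C1 * (\<xi> - t) powr (1 - \<alpha>)" using C1 by simp
        finally show ?thesis by (simp add: abs_minus_commute)
      qed
      then have ev: "eventually (\<lambda>s. \<bar>g t - g s\<bar> \<le> C1 * (\<xi> - t) powr (1 - \<alpha>)) (at_left \<xi>)"
        unfolding eventually_at_left_field using t by blast
      have "isCont g \<xi>" using cont r by (intro continuous_on_interior[OF cont]) (auto simp: interior_atLeastAtMost_real)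
      then have "(g \<longlongrightarrow> g \<xi>) (at_left \<xi>)" by (simp add: isCont_def filterlim_at_split)
      then have "((\<lambda>s. \<bar>g t - g s\<bar>) \<longlongrightarrow> \<bar>g t - g \<xi>\<bar>) (at_left \<xi>)" by (intro tendsto_intros)
      then show ?thesis using ev by (rule tendsto_upperbound) simp
    qed
    have both: "\<bar>g t - g \<xi>\<bar> \<le> C1 * \<rho> powr (1 - \<alpha>)" if \<rho>: "0 < \<rho>" "\<rho> \<le> r" and t: "t \<in> {\<xi>-\<rho>..\<xi>+\<rho>}" for \<rho> t
    proof -
      have mono: "C1 * x powr (1 - \<alpha>) \<le> C1 * \<rho> powr (1 - \<alpha>)" if "0 \<le> x" "x \<le> \<rho>" for x
        using that a1 C1 by (intro mult_left_mono powr_mono2) auto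
      consider "t = \<xi>" | "t > \<xi>" | "t < \<xi>" by linarith
      then show ?thesis
      proof cases
        case 1 then show ?thesis using C1 by simp
      next
        case 2 then show ?thesis using right[of t] mono[of "t - \<xi>"] t \<rho> by auto
      next
        case 3 then show ?thesis using left[of t] mono[of "\<xi> - t"] t \<rho> by auto
      qed
    qed
    show thesis
    proof (rule that[of "2 * C1" r])
      fix \<rho> s t assume "0 < \<rho>" "\<rho> \<le> r" "s \<in> {\<xi>-\<rho>..\<xi>+\<rho>}" "t \<in> {\<xi>-\<rho>..\<xi>+\<rho>}"
      then have "\<bar>g s - g \<xi>\<bar> \<le> C1 * \<rho> powr (1 - \<alpha>)" "\<bar>g t - g \<xi>\<bar> \<le> C1 * \<rho> powr (1 - \<alpha>)"
        using both by auto
      then show "\<bar>g s - g t\<bar> \<le> 2 * C1 * \<rho> powr (1 - \<alpha>)" by (simp add: abs_le_iff)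
    qed (use C1 r sub in auto)
  qed
qed

section \<open>Bernstein polynomials\<close>

lemma exp_le_quadratic:
  fixes u :: real
  assumes "\<bar>u\<bar> \<le> 1"
  shows "exp u \<le> 1 + u + u\<^sup>2"
proof (cases "u \<ge> 0")
  case True
  then show ?thesis using exp_bound[of u] assms by simp
next
  case False
  \<comment> \<open>For u < 0 this product is at least 1, and 1 - u \<le> exp (- u) then gives the
    claim without a Taylor remainder.\<close>
  have p: "(1 - u) * (1 + u + u\<^sup>2) = 1 - u ^ 3" by (simp add: power2_eq_square power3_eq_cube algebra_simps)
  have "u ^ 3 \<le> 0" using False by (simp add: power3_eq_cube mult_nonneg_nonpos mult_nonpos_nonpos)
  then have "1 \<le> (1 - u) * (1 + u + u\<^sup>2)" using p by simp
  also have "\<dots> \<le> exp (- u) * (1 + u + u\<^sup>2)"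
  proof (intro mult_right_mono)
    show "1 - u \<le> exp (- u)" using exp_ge_add_one_self[of "- u"] by simp
    show "0 \<le> 1 + u + u\<^sup>2" using assms by (simp add: abs_le_iff)
  qed
  finally show ?thesis by (simp add: exp_minus field_simps)
qed

text \<open>The kernel is the binomial distribution, so its generating function is the n-th power of
  that of one centred Bernoulli variable, for which the linear terms of
  \<open>exp_le_quadratic\<close> cancel.\<close>

lemma Bernstein_mgf_le:
  fixes x t :: real
  assumes x: "0 \<le> x" "x \<le> 1" and t: "\<bar>t\<bar> \<le> 1"
  shows "(\<Sum>k\<le>n. Bernstein n k x * exp (t * (real k - real n * x))) \<le> exp (real n * (x * (1 - x)) * t\<^sup>2)"
proof -
  let ?p = "x * exp (t * (1 - x))" and ?q = "(1 - x) * exp (- (t * x))"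
  have "(\<Sum>k\<le>n. Bernstein n k x * exp (t * (real k - real n * x))) = (\<Sum>k\<le>n. real (n choose k) * ?p ^ k * ?q ^ (n - k))"
  proof (rule sum.cong[OF refl])
    fix k assume "k \<in> {..n}"
    then have k: "real (n - k) = real n - real k" by auto
    have "?p ^ k * ?q ^ (n - k) = x ^ k * (1 - x) ^ (n - k) * exp (real k * (t * (1 - x)) + real (n - k) * (- (t * x)))"
      by (simp add: power_mult_distrib exp_of_nat_mult[symmetric] exp_add exp_diff exp_minus field_simps)
    also have "real k * (t * (1 - x)) + real (n - k) * (- (t * x)) = t * (real k - real n * x)"
      unfolding k by (simp add: algebra_simps)
    finally show "Bernstein n k x * exp (t * (real k - real n * x)) = real (n choose k) * ?p ^ k * ?q ^ (n - k)"
      by (simp add: Bernstein_def mult.assoc)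
  qed
  also have "\<dots> = (?p + ?q) ^ n" by (rule binomial_ring[symmetric])
  also have "\<dots> \<le> exp (x * (1 - x) * t\<^sup>2) ^ n"
  proof (rule power_mono)
    have "\<bar>t\<bar> * (1 - x) \<le> 1 * 1" "\<bar>t\<bar> * x \<le> 1 * 1" using x t by (intro mult_mono; simp)+
    then have "?p + ?q \<le> x * (1 + t * (1 - x) + (t * (1 - x))\<^sup>2) + (1 - x) * (1 + - (t * x) + (- (t * x))\<^sup>2)"
      using x by (intro add_mono mult_left_mono exp_le_quadratic) (auto simp: abs_mult)
    also have "\<dots> = 1 + x * (1 - x) * t\<^sup>2" by (simp add: power2_eq_square algebra_simps)
    also have "\<dots> \<le> exp (x * (1 - x) * t\<^sup>2)" by (rule exp_ge_add_one_self)
    finally show "?p + ?q \<le> exp (x * (1 - x) * t\<^sup>2)" .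
    show "0 \<le> ?p + ?q" using x by simp
  qed
  also have "\<dots> = exp (real n * (x * (1 - x)) * t\<^sup>2)" by (simp add: exp_of_nat_mult[symmetric] mult.assoc)
  finally show ?thesis .
qed

lemma Bernstein_abs_mgf_le:
  fixes x t :: real
  assumes x: "0 \<le> x" "x \<le> 1" and t: "0 \<le> t" "t \<le> 1"
  shows "(\<Sum>k\<le>n. Bernstein n k x * exp (t * \<bar>real k - real n * x\<bar>)) \<le> 2 * exp (real n * (x * (1 - x)) * t\<^sup>2)"
proof -
  have "(\<Sum>k\<le>n. Bernstein n k x * exp (t * \<bar>real k - real n * x\<bar>)) \<le>
     (\<Sum>k\<le>n. Bernstein n k x * exp (t * (real k - real n * x)) + Bernstein n k x * exp (- t * (real k - real n * x)))"
  proof (rule sum_mono)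
    fix k
    have "exp (t * \<bar>z\<bar>) \<le> exp (t * z) + exp (- t * z)" for z
      by (cases "z \<ge> 0") (auto simp: add_increasing add_increasing2)
    then show "Bernstein n k x * exp (t * \<bar>real k - real n * x\<bar>) \<le> Bernstein n k x * exp (t * (real k - real n * x)) + Bernstein n k x * exp (- t * (real k - real n * x))"
      unfolding distrib_left[symmetric] using x by (intro mult_left_mono Bernstein_nonneg)
  qed
  also have "\<dots> \<le> exp (real n * (x * (1 - x)) * t\<^sup>2) + exp (real n * (x * (1 - x)) * (- t)\<^sup>2)"
    unfolding sum.distrib using x t by (intro add_mono Bernstein_mgf_le) auto
  finally show ?thesis by simp
qed

lemma mult_one_minus_le: "(x::real) * (1 - x) \<le> 1/4"
  using zero_le_power2[of "x - 1/2"] by (simp add: power2_eq_square algebra_simps)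

text \<open>The degree m is kept apart from the scale n because second derivatives produce the
  kernel of degree n - 2, while the weight is still measured at the scale 1 / sqrt n.\<close>

lemma Bernstein_abs_mgf_sqrt_le:
  fixes x :: real
  assumes x: "0 \<le> x" "x \<le> 1" and n: "0 < n" "m \<le> n"
  shows "(\<Sum>k\<le>m. Bernstein m k x * exp (\<bar>real k - real m * x\<bar> / sqrt (real n))) \<le> 2 * exp 1"
proof -
  have "sqrt (real n) \<ge> 1" using n by simp
  then have "(\<Sum>k\<le>m. Bernstein m k x * exp ((1 / sqrt (real n)) * \<bar>real k - real m * x\<bar>))
      \<le> 2 * exp (real m * (x * (1 - x)) * (1 / sqrt (real n))\<^sup>2)"
    using x by (intro Bernstein_abs_mgf_le) auto
  also have "real m * (x * (1 - x)) * (1 / sqrt (real n))\<^sup>2 = (real m / real n) * (x * (1 - x))"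
    using n by (simp add: power_divide)
  also have "\<dots> \<le> 1 * (1/4)"
    using x n by (intro mult_mono mult_one_minus_le) auto
  finally show ?thesis by (auto simp: order_trans)
qed

text \<open>Apply ln z \<le> z - 1 to z = (1 + u) / \<alpha>. The constant \<alpha>^\<alpha> exp (1
  - \<alpha>) is the maximum of (1 + u)^\<alpha> exp (-u) over u > -1.\<close>

lemma one_plus_powr_le_exp:
  fixes u \<alpha> :: real
  assumes "u \<ge> 0" "\<alpha> > 0"
  shows "(1 + u) powr \<alpha> \<le> exp (1 - \<alpha> + \<alpha> * ln \<alpha>) * exp u"
proof -
  have "ln ((1 + u) / \<alpha>) \<le> (1 + u) / \<alpha> - 1" using assms by (intro ln_le_minus_one) simp
  then have "\<alpha> * (ln (1 + u) - ln \<alpha>) \<le> \<alpha> * ((1 + u) / \<alpha> - 1)"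
    using assms by (intro mult_left_mono) (auto simp: ln_div)
  also have "\<dots> = 1 + u - \<alpha>" using assms by (simp add: field_simps)
  finally have "\<alpha> * ln (1 + u) \<le> (1 - \<alpha> + \<alpha> * ln \<alpha>) + u" by (simp add: algebra_simps)
  then show ?thesis using assms by (simp add: powr_def exp_add[symmetric])
qed

text \<open>The weight \<open>wbar\<close>, smoothed at the scale \<open>1 / sqrt n\<close> of the oscillation of the Bernstein kernel.\<close>

definition smooth_dist :: "real \<Rightarrow> nat \<Rightarrow> real \<Rightarrow> real" where
  "smooth_dist \<xi> n y = \<bar>y - \<xi>\<bar> + 1 / sqrt (real n)"

lemma smooth_dist_pos: "0 < n \<Longrightarrow> smooth_dist \<xi> n y > 0"
  by (simp add: smooth_dist_def add_nonneg_pos)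

definition weight_const :: "real \<Rightarrow> real" where
  "weight_const \<alpha> = exp (1 - \<alpha> + \<alpha> * ln \<alpha>)"

lemma weight_const_pos: "weight_const \<alpha> > 0"
  by (simp add: weight_const_def)

lemma wbar_le_smooth_dist:
  assumes n: "0 < n" and a: "\<alpha> > 0"
  shows "wbar \<xi> \<alpha> x \<le> weight_const \<alpha> * smooth_dist \<xi> n (real k / real n) powr \<alpha> * exp (\<bar>real k - real n * x\<bar> / sqrt (real n))"
proof -
  let ?y = "real k / real n" and ?u = "sqrt (real n) * \<bar>x - real k / real n\<bar>"
  have s: "sqrt (real n) > 0" using n by simp
  have "\<bar>x - \<xi>\<bar> \<le> \<bar>?y - \<xi>\<bar> + \<bar>x - ?y\<bar>" by linarith
  also have "\<dots> \<le> smooth_dist \<xi> n ?y * (1 + ?u)"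
    using s by (simp add: smooth_dist_def field_simps)
  finally have "\<bar>x - \<xi>\<bar> powr \<alpha> \<le> (smooth_dist \<xi> n ?y * (1 + ?u)) powr \<alpha>"
    using a by (intro powr_mono2) auto
  also have "\<dots> = smooth_dist \<xi> n ?y powr \<alpha> * (1 + ?u) powr \<alpha>"
    using smooth_dist_pos[OF n, of \<xi> ?y] by (intro powr_mult) 
  also have "\<dots> \<le> smooth_dist \<xi> n ?y powr \<alpha> * (weight_const \<alpha> * exp ?u)"
    unfolding weight_const_def using a by (intro mult_left_mono one_plus_powr_le_exp) auto
  also have "?u = \<bar>real k - real n * x\<bar> / sqrt (real n)"
  proof -
    have "\<bar>x - ?y\<bar> = \<bar>real k - real n * x\<bar> / real n"
    proof -
      have "x - ?y = - (real k - real n * x) / real n" using n by (simp add: field_simps)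
      then show ?thesis by (simp only: abs_divide abs_minus_cancel abs_of_nat)
    qed
    moreover have "sqrt (real n) / real n = 1 / sqrt (real n)"
      using s by (simp add: divide_eq_eq power2_eq_square[symmetric] field_simps)
    ultimately show ?thesis by (metis mult.commute mult.left_neutral times_divide_eq_left times_divide_eq_right)
  qed
  finally show ?thesis by (simp add: wbar_def mult_ac)
qed

text \<open>The case split is forced by truncated subtraction: for k = 0 the index
  \<open>k - 1\<close> is 0 again, while the term has to vanish. At k = n + 1 the last term vanishes
  by itself, through its binomial coefficient.\<close>

lemma DERIV_Bernstein_Suc:
  assumes "k \<le> Suc n"
  shows "(Bernstein (Suc n) k has_real_derivative real (Suc n) * ((if k = 0 then 0 else Bernstein n (k - 1) x) - Bernstein n k x)) (at x)"
proof (cases k)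
  case 0
  have "((\<lambda>x. (1 - x) ^ Suc n) has_real_derivative (1 + real n) * ((0 - 1) * (1 - x) ^ n)) (at x)"
    by (intro DERIV_power_Suc DERIV_diff DERIV_const DERIV_ident)
  moreover have "Bernstein (Suc n) 0 = (\<lambda>x. (1 - x) ^ Suc n)" by (auto simp: Bernstein_def)
  ultimately show ?thesis unfolding 0 by (simp add: Bernstein_def)
next
  case (Suc j)
  then have j: "j \<le> n" using assms by simp
  have 1: "real (Suc n choose Suc j) * real (Suc j) = real (Suc n) * real (n choose j)"
    using Suc_times_binomial_eq[of n j] by (metis of_nat_mult mult.commute)
  have 2: "real (Suc n choose Suc j) * real (n - j) = real (Suc n) * real (n choose Suc j)"
  proof -
    have "(Suc n - Suc j) * (Suc n choose Suc j) = Suc n * (n choose Suc j)"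
      using binomial_absorb_comp[of "Suc n" "Suc j"] by simp
    then show ?thesis by (metis diff_Suc_Suc of_nat_mult mult.commute)
  qed
  have a: "((\<lambda>x. x ^ Suc j) has_real_derivative (1 + real j) * (1 * x ^ j)) (at x)"
    by (intro DERIV_power_Suc DERIV_ident)
  have b: "((\<lambda>x. (1 - x) ^ (n - j)) has_real_derivative real (n - j) * ((0 - 1) * (1 - x) ^ (n - j - Suc 0))) (at x)"
    by (intro DERIV_power DERIV_diff DERIV_const DERIV_ident)
  have "Bernstein (Suc n) k = (\<lambda>x. real (Suc n choose Suc j) * (x ^ Suc j * (1 - x) ^ (n - j)))"
    unfolding Suc by (simp add: Bernstein_def fun_eq_iff mult.assoc)
  then have "(Bernstein (Suc n) k has_real_derivative
     real (Suc n choose Suc j) * (real (Suc j) * x ^ j * (1 - x) ^ (n - j) - x ^ Suc j * (real (n - j) * (1 - x) ^ (n - j - 1)))) (at x)"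
    using DERIV_cmult[OF DERIV_mult[OF a b], of "real (Suc n choose Suc j)"] by (simp add: mult_ac)
  also have "real (Suc n choose Suc j) * (real (Suc j) * x ^ j * (1 - x) ^ (n - j) - x ^ Suc j * (real (n - j) * (1 - x) ^ (n - j - 1)))
     = (real (Suc n choose Suc j) * real (Suc j)) * x ^ j * (1 - x) ^ (n - j) - (real (Suc n choose Suc j) * real (n - j)) * x ^ Suc j * (1 - x) ^ (n - j - 1)"
    by (simp add: algebra_simps)
  also have "\<dots> = real (Suc n) * (Bernstein n j x - Bernstein n (Suc j) x)"
    unfolding 1 2 Bernstein_def by (simp add: algebra_simps)
  finally show ?thesis using Suc by simp
qed

lemma DERIV_Bernstein_sum:
  "((\<lambda>x. \<Sum>k\<le>Suc n. a k * Bernstein (Suc n) k x) has_real_derivative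
     real (Suc n) * (\<Sum>k\<le>n. (a (Suc k) - a k) * Bernstein n k x)) (at x)"
proof -
  have "((\<lambda>x. \<Sum>k\<le>Suc n. a k * Bernstein (Suc n) k x) has_real_derivative
     (\<Sum>k\<le>Suc n. a k * (real (Suc n) * ((if k = 0 then 0 else Bernstein n (k - 1) x) - Bernstein n k x)))) (at x)"
    by (intro DERIV_sum DERIV_cmult DERIV_Bernstein_Suc) simp
  also have "(\<Sum>k\<le>Suc n. a k * (real (Suc n) * ((if k = 0 then 0 else Bernstein n (k - 1) x) - Bernstein n k x)))
     = real (Suc n) * ((\<Sum>k\<le>Suc n. a k * (if k = 0 then 0 else Bernstein n (k - 1) x)) - (\<Sum>k\<le>Suc n. a k * Bernstein n k x))"
    unfolding sum_subtractf[symmetric] sum_distrib_left by (intro sum.cong) (simp_all only: right_diff_distrib mult_ac)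
  also have "(\<Sum>k\<le>Suc n. a k * (if k = 0 then 0 else Bernstein n (k - 1) x)) = (\<Sum>k\<le>n. a (Suc k) * Bernstein n k x)"
    by (subst sum.atMost_Suc_shift) simp
  also have "(\<Sum>k\<le>Suc n. a k * Bernstein n k x) = (\<Sum>k\<le>n. a k * Bernstein n k x)"
    by (simp add: Bernstein_def)
  also have "(\<Sum>k\<le>n. a (Suc k) * Bernstein n k x) - (\<Sum>k\<le>n. a k * Bernstein n k x) = (\<Sum>k\<le>n. (a (Suc k) - a k) * Bernstein n k x)"
    by (simp add: sum_subtractf left_diff_distrib)
  finally show ?thesis .
qed

lemma deriv_funpow_2: "(deriv ^^ 2) f = deriv (deriv f)"
  by (simp add: numeral_2_eq_2)

lemma deriv2_Bernstein_sum:
  "(deriv ^^ 2) (\<lambda>x. \<Sum>k\<le>m+2. a k * Bernstein (m+2) k x) x =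
     real (m+2) * real (m+1) * (\<Sum>k\<le>m. (a (k+2) - 2 * a (k+1) + a k) * Bernstein m k x)"
proof -
  have 1: "deriv (\<lambda>x. \<Sum>k\<le>m+2. a k * Bernstein (m+2) k x) =
     (\<lambda>x. real (m+2) * (\<Sum>k\<le>Suc m. (a (Suc k) - a k) * Bernstein (Suc m) k x))"
    using DERIV_imp_deriv[OF DERIV_Bernstein_sum[of a "Suc m"]] by (auto simp: fun_eq_iff)
  have "((\<lambda>x. real (m+2) * (\<Sum>k\<le>Suc m. (a (Suc k) - a k) * Bernstein (Suc m) k x)) has_real_derivative
     real (m+2) * (real (Suc m) * (\<Sum>k\<le>m. ((a (Suc (Suc k)) - a (Suc k)) - (a (Suc k) - a k)) * Bernstein m k x))) (at x)"
    by (intro DERIV_cmult DERIV_Bernstein_sum)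
  from DERIV_imp_deriv[OF this] show ?thesis
    unfolding deriv_funpow_2 1 by (simp add: mult.assoc algebra_simps)
qed

text \<open>Here the coefficients are not differenced; the basis polynomials are differentiated
  through their logarithmic derivative (k - n x) / (x (1 - x)). In this form the second derivative
  is a weighted second moment, of size n / (x (1 - x)) where n x (1 - x) >= 1, instead of the n^2
  that second differences of merely bounded coefficients would cost.\<close>

lemma deriv2_Bernstein_sum_interior:
  assumes x: "0 < x" "x < 1"
  shows "(deriv ^^ 2) (\<lambda>x. \<Sum>k\<le>n. a k * Bernstein n k x) x =
     (\<Sum>k\<le>n. a k * Bernstein n k x *
       (((real k - real n * x)\<^sup>2 - real n * (x * (1 - x)) - (real k - real n * x) * (1 - 2 * x)) / (x * (1 - x))\<^sup>2))"
proof -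
  have D1: "(Bernstein n k has_real_derivative Bernstein n k t * ((real k - real n * t) / (t * (1 - t)))) (at t)"
    if t: "0 < t" "t < 1" and k: "k \<le> n" for k t
  proof -
    have pw: "t * (real j * t ^ (j - 1)) = real j * t ^ j" for j and t :: real by (cases j) auto
    let ?E = "(real k * t ^ (k - 1)) * (1 - t) ^ (n - k) - t ^ k * (real (n - k) * (1 - t) ^ (n - k - 1))"
    have d: "(Bernstein n k has_real_derivative real (n choose k) * ?E) (at t)"
      unfolding Bernstein_def by (auto intro!: derivative_eq_intros simp: algebra_simps)
    have "(t * (1 - t)) * ?E
       = (t * (real k * t ^ (k - 1))) * (1 - t) * (1 - t) ^ (n - k) - t * t ^ k * ((1 - t) * (real (n - k) * (1 - t) ^ (n - k - 1)))"
      by (simp add: algebra_simps)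
    also have "\<dots> = t ^ k * (1 - t) ^ (n - k) * (real k - real n * t)"
      unfolding pw using k by (simp add: of_nat_diff algebra_simps)
    finally have "?E * (t * (1 - t)) = t ^ k * (1 - t) ^ (n - k) * (real k - real n * t)" by (simp only: mult.commute)
    moreover have "t * (1 - t) \<noteq> 0" using t by simp
    ultimately have "?E = t ^ k * (1 - t) ^ (n - k) * (real k - real n * t) / (t * (1 - t))"
      using nonzero_eq_divide_eq by blast
    then have "real (n choose k) * ?E = Bernstein n k t * ((real k - real n * t) / (t * (1 - t)))"
      by (simp only: Bernstein_def times_divide_eq_right mult_ac)
    with d show ?thesis by simp
  qed
  let ?B1 = "\<lambda>t. \<Sum>k\<le>n. a k * (Bernstein n k t * ((real k - real n * t) / (t * (1 - t))))"
  have d1: "deriv (\<lambda>x. \<Sum>k\<le>n. a k * Bernstein n k x) t = ?B1 t" if "t \<in> {0<..<1}" for t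
    using that by (intro DERIV_imp_deriv DERIV_sum DERIV_cmult D1) auto
  have D2: "((\<lambda>t. Bernstein n k t * ((real k - real n * t) / (t * (1 - t)))) has_real_derivative
       Bernstein n k x * (((real k - real n * x)\<^sup>2 - real n * (x * (1 - x)) - (real k - real n * x) * (1 - 2 * x)) / (x * (1 - x))\<^sup>2)) (at x)"
    if k: "k \<le> n" for k
  proof -
    have q: "((\<lambda>t. (real k - real n * t) / (t * (1 - t))) has_real_derivative
        (- real n * (x * (1 - x)) - (real k - real n * x) * (1 - 2 * x)) / (x * (1 - x))\<^sup>2) (at x)"
      using x by (auto intro!: derivative_eq_intros simp: power2_eq_square algebra_simps)
    have "((\<lambda>t. Bernstein n k t * ((real k - real n * t) / (t * (1 - t)))) has_real_derivative
        (Bernstein n k x * ((real k - real n * x) / (x * (1 - x)))) * ((real k - real n * x) / (x * (1 - x)))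
        + ((- real n * (x * (1 - x)) - (real k - real n * x) * (1 - 2 * x)) / (x * (1 - x))\<^sup>2) * Bernstein n k x) (at x)"
      by (rule DERIV_mult[OF D1[OF x k] q])
    also have "(Bernstein n k x * ((real k - real n * x) / (x * (1 - x)))) * ((real k - real n * x) / (x * (1 - x)))
        + ((- real n * (x * (1 - x)) - (real k - real n * x) * (1 - 2 * x)) / (x * (1 - x))\<^sup>2) * Bernstein n k x
       = Bernstein n k x * (((real k - real n * x) / (x * (1 - x)))\<^sup>2 + (- real n * (x * (1 - x)) - (real k - real n * x) * (1 - 2 * x)) / (x * (1 - x))\<^sup>2)"
      by (simp only: power2_eq_square distrib_left mult_ac)
    also have "((real k - real n * x) / (x * (1 - x)))\<^sup>2 + (- real n * (x * (1 - x)) - (real k - real n * x) * (1 - 2 * x)) / (x * (1 - x))\<^sup>2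
       = ((real k - real n * x)\<^sup>2 - real n * (x * (1 - x)) - (real k - real n * x) * (1 - 2 * x)) / (x * (1 - x))\<^sup>2"
      unfolding power_divide add_divide_distrib[symmetric] by simp
    finally show ?thesis .
  qed
  have "(?B1 has_real_derivative (\<Sum>k\<le>n. a k * (Bernstein n k x *
       (((real k - real n * x)\<^sup>2 - real n * (x * (1 - x)) - (real k - real n * x) * (1 - 2 * x)) / (x * (1 - x))\<^sup>2)))) (at x)"
    by (intro DERIV_sum DERIV_cmult D2) simp
  note B1 = this
  \<comment> \<open>\<open>?B1\<close> is known to be the first derivative only inside (0,1), so
    differentiating again needs equality on a neighbourhood of x.\<close>
  have ev: "eventually (\<lambda>t. ?B1 t = deriv (\<lambda>x. \<Sum>k\<le>n. a k * Bernstein n k x) t) (nhds x)"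
    using eventually_nhds_in_open[of "{0<..<1}" x] x by (auto elim!: eventually_mono simp: d1)
  have "(deriv (\<lambda>x. \<Sum>k\<le>n. a k * Bernstein n k x) has_real_derivative (\<Sum>k\<le>n. a k * (Bernstein n k x *
       (((real k - real n * x)\<^sup>2 - real n * (x * (1 - x)) - (real k - real n * x) * (1 - 2 * x)) / (x * (1 - x))\<^sup>2)))) (at x)"
    by (rule iffD1[OF DERIV_cong_ev[OF refl ev refl] B1])
  then show ?thesis unfolding deriv_funpow_2 by (simp add: DERIV_imp_deriv mult.assoc)
qed

section \<open>Weighted bounds for the second derivative\<close>

lemma wbar_mult_le:
  assumes n: "0 < n" and a: "\<alpha> > 0" and c: "\<bar>c\<bar> * smooth_dist \<xi> n (real k / real n) powr \<alpha> \<le> M"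
  shows "wbar \<xi> \<alpha> x * \<bar>c\<bar> \<le> weight_const \<alpha> * M * exp (\<bar>real k - real n * x\<bar> / sqrt (real n))"
proof -
  let ?E = "exp (\<bar>real k - real n * x\<bar> / sqrt (real n))"
  have "wbar \<xi> \<alpha> x * \<bar>c\<bar> \<le> (weight_const \<alpha> * smooth_dist \<xi> n (real k / real n) powr \<alpha> * ?E) * \<bar>c\<bar>"
    by (intro mult_right_mono wbar_le_smooth_dist n a) auto
  also have "\<dots> = (weight_const \<alpha> * ?E) * (\<bar>c\<bar> * smooth_dist \<xi> n (real k / real n) powr \<alpha>)" by simp
  also have "\<dots> \<le> (weight_const \<alpha> * ?E) * M"
    using weight_const_pos[of \<alpha>] by (intro mult_left_mono c) auto
  finally show ?thesis by (simp add: mult_ac)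
qed

lemma wbar_nonneg: "wbar \<xi> \<alpha> x \<ge> 0"
  by (simp add: wbar_def)

text \<open>The second differences of the coefficients are only bounded, not small, but near the
  endpoints the factor n (n - 1) x (1 - x) is at most n.\<close>

lemma Bernstein_deriv2_bound_edge:
  assumes a: "\<alpha> > 0" and x: "0 < x" "x < 1" and edge: "real (m+2) * (x * (1 - x)) \<le> 1" and M: "M \<ge> 0"
    and c: "\<And>k. k \<le> m+2 \<Longrightarrow> \<bar>c k\<bar> * smooth_dist \<xi> (m+2) (real k / real (m+2)) powr \<alpha> \<le> M"
  shows "wbar \<xi> \<alpha> x * (x * (1 - x)) * \<bar>(deriv ^^ 2) (\<lambda>x. \<Sum>k\<le>m+2. c k * Bernstein (m+2) k x) x\<bar>
     \<le> 40 * exp 3 * weight_const \<alpha> * real (m+2) * M"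
proof -
  define n where "n = m + 2"
  have n: "n > 0" by (simp add: n_def)
  let ?w = "wbar \<xi> \<alpha> x" and ?X = "x * (1 - x)"
  let ?E = "\<lambda>k. exp (\<bar>real k - real m * x\<bar> / sqrt (real n))"
  have X: "0 < ?X" using x by simp
  have W: "weight_const \<alpha> * M \<ge> 0" using weight_const_pos[of \<alpha>] M by simp
  have s1: "1 \<le> sqrt (real n)" using n by simp
  have bnd: "?w * \<bar>c (k + i)\<bar> \<le> weight_const \<alpha> * M * (exp 2 * ?E k)" if "k \<le> m" "i \<le> 2" for k i
  proof -
    \<comment> \<open>The coefficients sit at k, k + 1, k + 2 and are compared with n x, the kernel
      index k with m x, where m = n - 2; the offset is at most 2 and costs the factor
      \<open>exp 2\<close>.\<close>
    have "\<bar>real (k + i) - real n * x\<bar> \<le> \<bar>real k - real m * x\<bar> + 2"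
    proof -
      have "\<bar>real i - 2 * x\<bar> \<le> 2" using x that by (auto simp: abs_le_iff)
      moreover have "real (k + i) - real n * x = (real k - real m * x) + (real i - 2 * x)"
        by (simp add: n_def algebra_simps)
      ultimately show ?thesis by linarith
    qed
    then have "\<bar>real (k + i) - real n * x\<bar> / sqrt (real n) \<le> (\<bar>real k - real m * x\<bar> + 2) / sqrt (real n)"
      by (intro divide_right_mono) auto
    also have "\<dots> = \<bar>real k - real m * x\<bar> / sqrt (real n) + 2 / sqrt (real n)" by (simp add: add_divide_distrib)
    also have "\<dots> \<le> \<bar>real k - real m * x\<bar> / sqrt (real n) + 2"
      using s1 by (simp add: divide_le_eq)
    finally have "exp (\<bar>real (k + i) - real n * x\<bar> / sqrt (real n)) \<le> exp 2 * ?E k"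
      by (simp add: exp_add[symmetric] add.commute)
    moreover have "?w * \<bar>c (k + i)\<bar> \<le> weight_const \<alpha> * M * exp (\<bar>real (k + i) - real n * x\<bar> / sqrt (real n))"
      using c[of "k + i"] that by (intro wbar_mult_le n a) (auto simp: n_def)
    ultimately show ?thesis using W by (meson mult_left_mono order_trans)
  qed
  have bnd2: "?w * \<bar>c (k + 2) - 2 * c (k + 1) + c k\<bar> \<le> 4 * (weight_const \<alpha> * M * (exp 2 * ?E k))" if "k \<le> m" for k
  proof -
    have "?w * \<bar>c (k + 2) - 2 * c (k + 1) + c k\<bar> \<le> ?w * (\<bar>c (k + 2)\<bar> + 2 * \<bar>c (k + 1)\<bar> + \<bar>c (k + 0)\<bar>)"
      using wbar_nonneg[of \<xi> \<alpha> x] by (intro mult_left_mono) auto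
    also have "\<dots> = ?w * \<bar>c (k + 2)\<bar> + 2 * (?w * \<bar>c (k + 1)\<bar>) + ?w * \<bar>c (k + 0)\<bar>" by (simp add: algebra_simps)
    finally show ?thesis using bnd[OF that, of 2] bnd[OF that, of 1] bnd[OF that, of 0] by linarith
  qed
  let ?S = "\<Sum>k\<le>m. (c (k+2) - 2 * c (k+1) + c k) * Bernstein m k x"
  have "?w * \<bar>?S\<bar> \<le> ?w * (\<Sum>k\<le>m. \<bar>c (k+2) - 2 * c (k+1) + c k\<bar> * Bernstein m k x)"
    using x wbar_nonneg[of \<xi> \<alpha> x]
    by (intro mult_left_mono order_trans[OF sum_abs] sum_mono) (auto simp: abs_mult Bernstein_nonneg)
  also have "\<dots> = (\<Sum>k\<le>m. (?w * \<bar>c (k+2) - 2 * c (k+1) + c k\<bar>) * Bernstein m k x)"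
    by (simp add: sum_distrib_left mult.assoc)
  also have "\<dots> \<le> (\<Sum>k\<le>m. (4 * (weight_const \<alpha> * M * (exp 2 * ?E k))) * Bernstein m k x)"
    using x by (intro sum_mono mult_right_mono bnd2 Bernstein_nonneg) auto
  also have "\<dots> = 4 * (weight_const \<alpha> * M) * exp 2 * (\<Sum>k\<le>m. Bernstein m k x * ?E k)"
    by (simp add: sum_distrib_left mult_ac)
  also have "\<dots> \<le> 4 * (weight_const \<alpha> * M) * exp 2 * (2 * exp 1)"
    using x W n by (intro mult_left_mono Bernstein_abs_mgf_sqrt_le) (auto simp: n_def)
  also have "\<dots> = 8 * exp 3 * (weight_const \<alpha> * M)" by (simp add: mult_exp_exp mult_ac)
  finally have S: "?w * \<bar>?S\<bar> \<le> 8 * exp 3 * (weight_const \<alpha> * M)" .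
  have "?w * ?X * \<bar>(deriv ^^ 2) (\<lambda>x. \<Sum>k\<le>m+2. c k * Bernstein (m+2) k x) x\<bar>
      = (real (m+2) * ?X) * real (m+1) * (?w * \<bar>?S\<bar>)"
    unfolding deriv2_Bernstein_sum using X by (simp add: abs_mult)
  also have "\<dots> \<le> 1 * real (m+2) * (8 * exp 3 * (weight_const \<alpha> * M))"
    by (rule mult_mono[OF mult_mono[OF edge] S]) (use wbar_nonneg[of \<xi> \<alpha> x] in auto)
  \<comment> \<open>Padding, so that both regimes end with the same constant.\<close>
  also have "\<dots> \<le> 5 * \<dots>"
  proof -
    have "0 \<le> 1 * real (m+2) * (8 * exp 3 * (weight_const \<alpha> * M))" using M weight_const_pos[of \<alpha>] by simp
    then show ?thesis by linarith
  qed
  also have "\<dots> = 40 * exp 3 * weight_const \<alpha> * real (m+2) * M" by (simp only: mult_ac)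
  finally show ?thesis .
qed

lemma Bernstein_deriv2_bound_interior:
  assumes a: "\<alpha> > 0" and n: "n > 0" and x: "0 < x" "x < 1" and int: "real n * (x * (1 - x)) \<ge> 1" and M: "M \<ge> 0"
    and c: "\<And>k. k \<le> n \<Longrightarrow> \<bar>c k\<bar> * smooth_dist \<xi> n (real k / real n) powr \<alpha> \<le> M"
  shows "wbar \<xi> \<alpha> x * (x * (1 - x)) * \<bar>(deriv ^^ 2) (\<lambda>x. \<Sum>k\<le>n. c k * Bernstein n k x) x\<bar>
     \<le> 40 * exp 3 * weight_const \<alpha> * real n * M"
proof -
  let ?w = "wbar \<xi> \<alpha> x" and ?X = "x * (1 - x)"
  have X: "0 < ?X" using x by simp
  have W: "weight_const \<alpha> * M \<ge> 0" using weight_const_pos[of \<alpha>] M by simp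
  \<comment> \<open>The reciprocal of the standard deviation of the binomial law at x: n x (1 - x)
    t^2 = 1 makes the exponential moment a constant, and t \<le> 1 is the assumption n x (1 - x) >=
    1.\<close>
  define t where "t = 1 / sqrt (real n * ?X)"
  have t: "0 \<le> t" "t \<le> 1" using int by (auto simp: t_def)
  have t2: "t\<^sup>2 = 1 / (real n * ?X)" using X n by (simp add: t_def power_divide)
  define z where "z k = real k - real n * x" for k
  define q where "q k = ((z k)\<^sup>2 - real n * ?X - z k * (1 - 2 * x)) / ?X\<^sup>2" for k
  have Xq: "?X * \<bar>q k\<bar> \<le> 18 * real n * exp (t * \<bar>z k\<bar> / 2)" for k
  proof -
    let ?v = "t * \<bar>z k\<bar>"
    have "\<bar>(z k)\<^sup>2 - real n * ?X - z k * (1 - 2 * x)\<bar> \<le> (z k)\<^sup>2 + real n * ?X + ((z k)\<^sup>2 + real n * ?X)"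
    proof -
      \<comment> \<open>The linear term is absorbed by the other two: |z| \<le> z^2 + 1, and 1 \<le>
        n x (1 - x) in this regime.\<close>
      have "\<bar>z k * (1 - 2 * x)\<bar> \<le> \<bar>z k\<bar> * 1"
        unfolding abs_mult using x by (intro mult_left_mono) (auto simp: abs_le_iff)
      also have "\<bar>z k\<bar> * 1 \<le> (z k)\<^sup>2 + 1"
        using zero_le_power2[of "\<bar>z k\<bar> - 1/2"] by (simp add: power2_eq_square algebra_simps)
      finally have "\<bar>z k * (1 - 2 * x)\<bar> \<le> (z k)\<^sup>2 + real n * ?X" using int by linarith
      moreover have "0 \<le> (z k)\<^sup>2" "0 \<le> real n * ?X" using X by auto
      ultimately show ?thesis by linarith
    qed
    also have "\<dots> = 2 * (real n * ?X) * (1 + ?v\<^sup>2)"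
    proof -
      have "p + r + (p + r) = 2 * r * (1 + p / r)" if "r \<noteq> 0" for p r :: real
        using that by (simp add: field_simps)
      moreover have "?v\<^sup>2 = (z k)\<^sup>2 / (real n * ?X)" by (simp add: power_mult_distrib t2)
      moreover have "real n * ?X \<noteq> 0" using x n by simp
      ultimately show ?thesis by metis
    qed
    finally have "?X * \<bar>q k\<bar> \<le> 2 * real n * (1 + ?v\<^sup>2)"
    proof -
      assume le: "\<bar>(z k)\<^sup>2 - real n * ?X - z k * (1 - 2 * x)\<bar> \<le> 2 * (real n * ?X) * (1 + ?v\<^sup>2)"
      have gen: "r * \<bar>p / r\<^sup>2\<bar> = \<bar>p\<bar> / r" if "r > 0" for p r :: real
        using that by (simp add: power2_eq_square abs_mult)
      have "?X * \<bar>q k\<bar> = \<bar>(z k)\<^sup>2 - real n * ?X - z k * (1 - 2 * x)\<bar> / ?X"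
        unfolding q_def by (rule gen[OF X])
      moreover have "\<bar>(z k)\<^sup>2 - real n * ?X - z k * (1 - 2 * x)\<bar> \<le> (2 * real n * (1 + ?v\<^sup>2)) * ?X"
        using le by (simp only: mult_ac)
      ultimately show ?thesis using X by (simp only: pos_divide_le_eq)
    qed
    also have "1 + ?v\<^sup>2 \<le> 9 * exp (?v / 2)"
    proof -
      have v0: "0 \<le> ?v / 2" using t by simp
      have "1 + ?v / 2 + (?v / 2)\<^sup>2 / 2 \<le> exp (?v / 2)" by (rule exp_lower_Taylor_quadratic[OF v0])
      moreover have "(?v / 2)\<^sup>2 / 2 = ?v\<^sup>2 / 8" by (simp add: power_divide)
      ultimately have "1 + ?v / 2 + ?v\<^sup>2 / 8 \<le> exp (?v / 2)" by simp
      then show ?thesis using v0 zero_le_power2[of ?v] by linarith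
    qed
    finally show ?thesis using n by simp
  qed
  have bnd: "?w * \<bar>c k\<bar> \<le> weight_const \<alpha> * M * exp (t * \<bar>z k\<bar> / 2)" if k: "k \<le> n" for k
  proof -
    have "?w * \<bar>c k\<bar> \<le> weight_const \<alpha> * M * exp (\<bar>real k - real n * x\<bar> / sqrt (real n))"
      by (intro wbar_mult_le n a c k)
    also have "\<dots> \<le> weight_const \<alpha> * M * exp (t * \<bar>z k\<bar> / 2)"
    proof -
      \<comment> \<open>Because sqrt (x (1 - x)) \<le> 1/2, the weight consumes only half of the
        exponent t |z|; the other half absorbs the quadratic factor \<open>q k\<close>.\<close>
      have "sqrt ?X \<le> 1 / 2" using mult_one_minus_le[of x] by (intro real_le_lsqrt) (auto simp: power2_eq_square)
      moreover have "1 / p \<le> 1 / (p * r) / 2" if "p > 0" "r > 0" "r \<le> 1 / 2" for p r :: real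
        using that by (simp add: field_simps)
      moreover have "t = 1 / (sqrt (real n) * sqrt ?X)" by (simp add: t_def real_sqrt_mult)
      ultimately have "1 / sqrt (real n) \<le> t / 2" using n X by simp
      then have "\<bar>z k\<bar> * (1 / sqrt (real n)) \<le> \<bar>z k\<bar> * (t / 2)" by (intro mult_left_mono) auto
      then show ?thesis using W by (intro mult_left_mono) (auto simp: z_def mult_ac)
    qed
    finally show ?thesis .
  qed
  have "?w * ?X * \<bar>\<Sum>k\<le>n. c k * Bernstein n k x * q k\<bar> \<le> ?w * ?X * (\<Sum>k\<le>n. \<bar>c k\<bar> * Bernstein n k x * \<bar>q k\<bar>)"
    using x wbar_nonneg[of \<xi> \<alpha> x]
    by (intro mult_left_mono order_trans[OF sum_abs] sum_mono) (auto simp: abs_mult Bernstein_nonneg)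
  also have "\<dots> = (\<Sum>k\<le>n. (?w * \<bar>c k\<bar>) * (?X * \<bar>q k\<bar>) * Bernstein n k x)"
    by (simp add: sum_distrib_left mult_ac)
  also have "\<dots> \<le> (\<Sum>k\<le>n. (weight_const \<alpha> * M * exp (t * \<bar>z k\<bar> / 2)) * (18 * real n * exp (t * \<bar>z k\<bar> / 2)) * Bernstein n k x)"
    using x X W wbar_nonneg[of \<xi> \<alpha> x] by (intro sum_mono mult_right_mono mult_mono bnd Xq Bernstein_nonneg) auto
  also have "\<dots> = (\<Sum>k\<le>n. 18 * real n * (weight_const \<alpha> * M) * (Bernstein n k x * exp (t * \<bar>real k - real n * x\<bar>)))"
  proof (rule sum.cong[OF refl])
    fix k
    have "exp (t * \<bar>z k\<bar>) = exp (t * \<bar>z k\<bar> / 2) * exp (t * \<bar>z k\<bar> / 2)" by (simp add: mult_exp_exp)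
    then show "(weight_const \<alpha> * M * exp (t * \<bar>z k\<bar> / 2)) * (18 * real n * exp (t * \<bar>z k\<bar> / 2)) * Bernstein n k x
      = 18 * real n * (weight_const \<alpha> * M) * (Bernstein n k x * exp (t * \<bar>real k - real n * x\<bar>))"
      unfolding z_def by (simp add: mult_ac)
  qed
  also have "\<dots> = 18 * real n * (weight_const \<alpha> * M) * (\<Sum>k\<le>n. Bernstein n k x * exp (t * \<bar>real k - real n * x\<bar>))"
    by (simp only: sum_distrib_left)
  also have "\<dots> \<le> 18 * real n * (weight_const \<alpha> * M) * (2 * exp (real n * ?X * t\<^sup>2))"
    using x t W by (intro mult_left_mono Bernstein_abs_mgf_le) auto
  also have "real n * ?X * t\<^sup>2 = 1" using t2 x n by simp
  also have "18 * real n * (weight_const \<alpha> * M) * (2 * exp 1) \<le> 40 * exp 3 * weight_const \<alpha> * real n * M"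
  proof -
    have "real n * (weight_const \<alpha> * M) * (36 * exp 1) \<le> real n * (weight_const \<alpha> * M) * (40 * exp 3)"
      using W by (intro mult_left_mono mult_mono) auto
    then show ?thesis by (simp add: mult_ac)
  qed
  finally show ?thesis
    unfolding deriv2_Bernstein_sum_interior[OF x] q_def z_def .
qed

lemma Bernstein_deriv2_bound:
  assumes a: "\<alpha> > 0" and n: "n \<ge> 2" and x: "0 < x" "x < 1" and M: "M \<ge> 0"
    and c: "\<And>k. k \<le> n \<Longrightarrow> \<bar>c k\<bar> * smooth_dist \<xi> n (real k / real n) powr \<alpha> \<le> M"
  shows "wbar \<xi> \<alpha> x * (x * (1 - x)) * \<bar>(deriv ^^ 2) (\<lambda>x. \<Sum>k\<le>n. c k * Bernstein n k x) x\<bar>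
     \<le> 40 * exp 3 * weight_const \<alpha> * real n * M"
proof (cases "real n * (x * (1 - x)) \<ge> 1")
  case True
  then show ?thesis using assms by (intro Bernstein_deriv2_bound_interior) auto
next
  case False
  obtain m where m: "n = m + 2" using n by (metis le_add_diff_inverse2)
  show ?thesis using assms False unfolding m by (intro Bernstein_deriv2_bound_edge) auto
qed

text \<open>The power of phi is linearised: with X = x (1 - x) and Y its value at (k + 1)/n, (X /
  Y)^lam \<le> 1 + X / Y splits the sum in two. In the second part the factor X / Y turns the kernel
  of degree m into that of degree n = m + 2, so both parts are exponential moments.\<close>

lemma Bernstein_second_diff_bound:
  assumes a: "\<alpha> > 0" and lam: "0 \<le> lam" "lam \<le> 1" and x: "0 \<le> x" "x \<le> 1" and D: "D \<ge> 0"
    and c: "\<And>k. k \<le> m \<Longrightarrow> \<bar>c (k+2) - 2 * c (k+1) + c k\<bar> * phi_pow (2 * lam) (real (k+1) / real (m+2))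
          * smooth_dist \<xi> (m+2) (real (k+1) / real (m+2)) powr \<alpha> \<le> D / (real (m+2))\<^sup>2"
  shows "wbar \<xi> \<alpha> x * phi_pow (2 * lam) x * \<bar>(deriv ^^ 2) (\<lambda>x. \<Sum>k\<le>m+2. c k * Bernstein (m+2) k x) x\<bar>
     \<le> 10 * exp 2 * weight_const \<alpha> * D"
proof -
  define n where "n = m + 2"
  have n: "n > 0" by (simp add: n_def)
  let ?w = "wbar \<xi> \<alpha> x" and ?X = "x * (1 - x)"
  define y where "y k = real (k+1) / real n" for k
  define Y where "Y k = y k * (1 - y k)" for k
  define c2 where "c2 k = c (k+2) - 2 * c (k+1) + c k" for k
  let ?E = "\<lambda>k. exp (\<bar>real (k+1) - real n * x\<bar> / sqrt (real n))"
  have X: "0 \<le> ?X" using x by simp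
  have W: "weight_const \<alpha> * D \<ge> 0" using weight_const_pos[of \<alpha>] D by simp
  have y01: "0 < y k" "y k < 1" if "k \<le> m" for k using that by (auto simp: y_def n_def field_simps)
  have Y: "Y k > 0" if "k \<le> m" for k using y01[OF that] by (simp add: Y_def)
  have phi: "phi_pow (2 * lam) x \<le> phi_pow (2 * lam) (y k) * (1 + ?X / Y k)" if k: "k \<le> m" for k
  proof (cases "0 < x \<and> x < 1")
    case True
    have "(?X / Y k) powr lam \<le> 1 + ?X / Y k"
      using Y[OF k] X lam by (intro powr_le_of_le) auto
    then have "?X powr lam / Y k powr lam \<le> 1 + ?X / Y k"
      using X Y[OF k] by (simp add: powr_divide)
    then have "?X powr lam \<le> (1 + ?X / Y k) * Y k powr lam"
      using Y[OF k] by (simp only: pos_divide_le_eq powr_gt_zero)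
    then show ?thesis
      using True y01[OF k] by (simp add: phi_pow_eq Y_def[symmetric] mult.commute[of "Y k powr lam"])
  next
    case False
    \<comment> \<open>At the endpoints the convention for the zeroth power matters: for
      \<open>lam\<close> = 0 both weights are 1, otherwise the left side is 0.\<close>
    then have x0: "x = 0 \<or> x = 1" using x by auto
    show ?thesis
    proof (cases "lam = 0")
      case True
      then show ?thesis using x0 by (auto simp: phi_pow_def)
    next
      case False
      then have "phi_pow (2 * lam) x = 0" using x0 by (auto simp: phi_pow_def phi_def)
      then show ?thesis using X Y[OF k] by (simp add: phi_pow_nonneg)
    qed
  qed
  have bnd: "?w * phi_pow (2 * lam) x * \<bar>c2 k\<bar> \<le> weight_const \<alpha> * D / (real n)\<^sup>2 * ((1 + ?X / Y k) * ?E k)" if k: "k \<le> m" for k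
  proof -
    have "?w * (phi_pow (2 * lam) x * \<bar>c2 k\<bar>)
      \<le> (weight_const \<alpha> * smooth_dist \<xi> n (y k) powr \<alpha> * ?E k) * ((phi_pow (2 * lam) (y k) * (1 + ?X / Y k)) * \<bar>c2 k\<bar>)"
      unfolding y_def
      using weight_const_pos[of \<alpha>] phi[OF k] X Y[OF k]
      by (intro mult_mono wbar_le_smooth_dist n a order_refl) (auto simp: y_def phi_pow_nonneg wbar_nonneg)
    also have "\<dots> = (weight_const \<alpha> * ((1 + ?X / Y k) * ?E k)) * (\<bar>c2 k\<bar> * phi_pow (2 * lam) (y k) * smooth_dist \<xi> n (y k) powr \<alpha>)"
      by (simp only: mult_ac)
    also have "\<dots> \<le> (weight_const \<alpha> * ((1 + ?X / Y k) * ?E k)) * (D / (real n)\<^sup>2)"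
      using c[OF k] weight_const_pos[of \<alpha>] X Y[OF k] unfolding c2_def y_def n_def
      by (intro mult_left_mono) auto
    finally show ?thesis by (simp add: mult_ac)
  qed
  have B: "?X / Y k * Bernstein m k x = real n / real (n - 1) * Bernstein n (k+1) x" if k: "k \<le> m" for k
  proof -
    have ch: "real (k+1) * real (n - (k+1)) * real (n choose (k+1)) = real n * real (n - 1) * real (m choose k)"
    proof -
      have "Suc k * (Suc (Suc m) choose Suc k) = Suc (Suc m) * (Suc m choose k)" using Suc_times_binomial_eq[of "Suc m" k] by (metis mult.commute)
      moreover have "(Suc m - k) * (Suc m choose k) = Suc m * (m choose k)" using binomial_absorb_comp[of "Suc m" k] by simp
      ultimately have "(Suc m - k) * (Suc k * (Suc (Suc m) choose Suc k)) = Suc (Suc m) * (Suc m * (m choose k))"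
        by (metis mult.left_commute)
      then have "(k+1) * (n - (k+1)) * (n choose (k+1)) = n * (n - 1) * (m choose k)"
      proof -
        assume eq: "(Suc m - k) * (Suc k * (Suc (Suc m) choose Suc k)) = Suc (Suc m) * (Suc m * (m choose k))"
        have e: "k + 1 = Suc k" "n - Suc k = Suc m - k" "n - 1 = Suc m" by (auto simp: n_def)
        have e2: "n = Suc (Suc m)" by (simp add: n_def)
        show ?thesis unfolding e unfolding e2 using eq by (simp only: mult_ac)
      qed
      then show ?thesis by (metis of_nat_mult)
    qed
    have Yk: "Y k = real (k+1) * real (n - (k+1)) / (real n)\<^sup>2"
      using k n by (simp add: Y_def y_def n_def of_nat_diff power2_eq_square field_simps)
    have pos: "real (k+1) * real (n - (k+1)) > 0" "real (n - 1) > 0" using k by (auto simp: n_def)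
    have pw: "?X * (x ^ k * (1 - x) ^ (m - k)) = x ^ (k+1) * (1 - x) ^ (n - (k+1))"
      using k by (simp add: n_def Suc_diff_le algebra_simps)
    have "?X / Y k * Bernstein m k x = (real n)\<^sup>2 / (real (k+1) * real (n - (k+1))) * real (m choose k) * (?X * (x ^ k * (1 - x) ^ (m - k)))"
      unfolding Yk Bernstein_def by (simp add: mult_ac)
    also have "(real n)\<^sup>2 / (real (k+1) * real (n - (k+1))) * real (m choose k) = real n / real (n - 1) * real (n choose (k+1))"
    proof -
      have "(real n)\<^sup>2 * real (m choose k) * real (n - 1) = real n * real (n choose (k+1)) * (real (k+1) * real (n - (k+1)))"
        using ch by (simp add: power2_eq_square mult_ac)
      moreover have "p / q * c = r / t * b" if "p * c * t = r * b * q" "q > 0" "t > 0" for p q c r t b :: real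
        using that by (simp add: field_simps)
      ultimately show ?thesis using pos by blast
    qed
    finally show ?thesis unfolding pw Bernstein_def by (simp add: mult_ac)
  qed
  let ?S = "\<Sum>k\<le>m. c2 k * Bernstein m k x"
  have "?w * phi_pow (2 * lam) x * \<bar>?S\<bar> \<le> ?w * phi_pow (2 * lam) x * (\<Sum>k\<le>m. \<bar>c2 k\<bar> * Bernstein m k x)"
    using x wbar_nonneg[of \<xi> \<alpha> x] phi_pow_nonneg[of "2 * lam" x]
    by (intro mult_left_mono order_trans[OF sum_abs] sum_mono) (auto simp: abs_mult Bernstein_nonneg)
  also have "\<dots> = (\<Sum>k\<le>m. (?w * phi_pow (2 * lam) x * \<bar>c2 k\<bar>) * Bernstein m k x)"
    by (simp add: sum_distrib_left mult.assoc)
  also have "\<dots> \<le> (\<Sum>k\<le>m. (weight_const \<alpha> * D / (real n)\<^sup>2 * ((1 + ?X / Y k) * ?E k)) * Bernstein m k x)"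
    using x by (intro sum_mono mult_right_mono bnd Bernstein_nonneg) auto
  also have "\<dots> = weight_const \<alpha> * D / (real n)\<^sup>2 * (\<Sum>k\<le>m. Bernstein m k x * ?E k + ?X / Y k * Bernstein m k x * ?E k)"
    unfolding sum_distrib_left by (intro sum.cong) (simp_all add: algebra_simps)
  also have "\<dots> \<le> weight_const \<alpha> * D / (real n)\<^sup>2 * (2 * exp 2 + 4 * exp 1)"
  proof (intro mult_left_mono)
    have "(\<Sum>k\<le>m. Bernstein m k x * ?E k) \<le> (\<Sum>k\<le>m. exp 1 * (Bernstein m k x * exp (\<bar>real k - real m * x\<bar> / sqrt (real n))))"
    proof (rule sum_mono)
      fix k
      have "\<bar>real (k+1) - real n * x\<bar> \<le> \<bar>real k - real m * x\<bar> + 1"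
      proof -
        have "real (k+1) - real n * x = (real k - real m * x) + (1 - 2 * x)" by (simp add: n_def algebra_simps)
        moreover have "\<bar>1 - 2 * x\<bar> \<le> 1" using x by (auto simp: abs_le_iff)
        ultimately show ?thesis by linarith
      qed
      then have "\<bar>real (k+1) - real n * x\<bar> / sqrt (real n) \<le> (\<bar>real k - real m * x\<bar> + 1) / sqrt (real n)"
        by (intro divide_right_mono) auto
      also have "\<dots> = \<bar>real k - real m * x\<bar> / sqrt (real n) + 1 / sqrt (real n)" by (simp add: add_divide_distrib)
      also have "\<dots> \<le> 1 + \<bar>real k - real m * x\<bar> / sqrt (real n)" using n by simp
      finally have "?E k \<le> exp 1 * exp (\<bar>real k - real m * x\<bar> / sqrt (real n))" by (simp add: mult_exp_exp)
      then have "Bernstein m k x * ?E k \<le> Bernstein m k x * (exp 1 * exp (\<bar>real k - real m * x\<bar> / sqrt (real n)))"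
        using x by (intro mult_left_mono Bernstein_nonneg)
      then show "Bernstein m k x * ?E k \<le> exp 1 * (Bernstein m k x * exp (\<bar>real k - real m * x\<bar> / sqrt (real n)))"
        by (simp add: mult_ac)
    qed
    also have "\<dots> \<le> exp 1 * (2 * exp 1)"
      unfolding sum_distrib_left[symmetric] using x n
      by (intro mult_left_mono Bernstein_abs_mgf_sqrt_le) (auto simp: n_def)
    also have "exp 1 * (2 * exp 1) = 2 * exp (2::real)" using mult_exp_exp[of 1 "1::real"] by simp
    finally have 1: "(\<Sum>k\<le>m. Bernstein m k x * ?E k) \<le> 2 * exp 2" .
    have r: "real n / real (n - 1) \<le> 2" by (simp add: n_def field_simps)
    \<comment> \<open>After the shift to k + 1 the sum runs over the indices 1 to n - 1 of the
      degree n kernel.\<close>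
    have "(\<Sum>k\<le>m. ?X / Y k * Bernstein m k x * ?E k) = (\<Sum>k\<le>m. real n / real (n - 1) * (Bernstein n (Suc k) x * exp (\<bar>real (Suc k) - real n * x\<bar> / sqrt (real n))))"
      by (intro sum.cong refl) (simp only: B atMost_iff mult.assoc Suc_eq_plus1)
    also have "\<dots> = real n / real (n - 1) * (\<Sum>k\<in>Suc ` {..m}. Bernstein n k x * exp (\<bar>real k - real n * x\<bar> / sqrt (real n)))"
      by (simp add: sum_distrib_left sum.reindex)
    also have "\<dots> \<le> 2 * (\<Sum>k\<le>n. Bernstein n k x * exp (\<bar>real k - real n * x\<bar> / sqrt (real n)))"
      using x r by (intro mult_mono sum_mono2 sum_nonneg) (auto simp: n_def Bernstein_nonneg)
    also have "\<dots> \<le> 2 * (2 * exp 1)" using x n by (intro mult_left_mono Bernstein_abs_mgf_sqrt_le) auto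
    finally have 2: "(\<Sum>k\<le>m. ?X / Y k * Bernstein m k x * ?E k) \<le> 4 * exp 1" by simp
    show "(\<Sum>k\<le>m. Bernstein m k x * ?E k + ?X / Y k * Bernstein m k x * ?E k) \<le> 2 * exp 2 + 4 * exp 1"
      unfolding sum.distrib using 1 2 by linarith
    show "0 \<le> weight_const \<alpha> * D / (real n)\<^sup>2" using W by simp
  qed
  also have "\<dots> \<le> weight_const \<alpha> * D / (real n)\<^sup>2 * (10 * exp 2)"
  proof (intro mult_left_mono)
    have "exp (1::real) \<le> exp 2" by simp
    moreover have "0 < exp (2::real)" by simp
    ultimately show "2 * exp 2 + 4 * exp 1 \<le> 10 * exp (2::real)" by linarith
    show "0 \<le> weight_const \<alpha> * D / (real n)\<^sup>2" using W by simp
  qed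
  finally have S: "?w * phi_pow (2 * lam) x * \<bar>?S\<bar> \<le> weight_const \<alpha> * D / (real n)\<^sup>2 * (10 * exp 2)" .
  have "?w * phi_pow (2 * lam) x * \<bar>(deriv ^^ 2) (\<lambda>x. \<Sum>k\<le>m+2. c k * Bernstein (m+2) k x) x\<bar>
      = (real (m+2) * real (m+1)) * (?w * phi_pow (2 * lam) x * \<bar>?S\<bar>)"
    unfolding deriv2_Bernstein_sum c2_def by (simp add: abs_mult)
  also have "\<dots> \<le> (real n)\<^sup>2 * (weight_const \<alpha> * D / (real n)\<^sup>2 * (10 * exp 2))"
    by (rule mult_mono[OF _ S]) (auto simp: n_def power2_eq_square wbar_nonneg phi_pow_nonneg intro!: mult_mono)
  also have "\<dots> = 10 * exp 2 * weight_const \<alpha> * D" using n by simp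
  finally show ?thesis .
qed

section \<open>The modified function\<close>

lemma psi_0: "x \<le> 0 \<Longrightarrow> psi x = 0" and psi_1: "x \<ge> 1 \<Longrightarrow> psi x = 1"
  by (auto simp: psi_def)

text \<open>The quadratic factor 6 y^2 - 15 y + 10 equals 5/8 + 6 (y - 5/4)^2 and is positive; the
  upper bound is the lower one reflected by x to 1 - x.\<close>

lemma psi_bounds: "0 \<le> psi x" "psi x \<le> 1"
proof -
  have pos: "10 * y ^ 3 - 15 * y ^ 4 + 6 * y ^ 5 \<ge> 0" if "0 \<le> y" for y :: real
  proof -
    have "10 * y ^ 3 - 15 * y ^ 4 + 6 * y ^ 5 = y ^ 3 * (5/8 + 6 * (y - 5/4)\<^sup>2)"
      by (simp add: power2_eq_square eval_nat_numeral algebra_simps)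
    then show ?thesis using that by simp
  qed
  show "0 \<le> psi x" using pos[of x] by (simp add: psi_def)
  have "10 * x ^ 3 - 15 * x ^ 4 + 6 * x ^ 5 = 1 - (10 * (1 - x) ^ 3 - 15 * (1 - x) ^ 4 + 6 * (1 - x) ^ 5)"
    by (simp add: eval_nat_numeral algebra_simps)
  moreover have "psi x = 10 * x ^ 3 - 15 * x ^ 4 + 6 * x ^ 5" if "0 < x" "x < 1" using that by (simp add: psi_def)
  ultimately have "psi x \<le> 1" if "0 < x" "x < 1" using pos[of "1 - x"] that by linarith
  then show "psi x \<le> 1" by (cases "0 < x \<and> x < 1") (auto simp: psi_def)
qed

lemma node_bounds:
  assumes "0 < n"
  shows "node \<xi> n c \<le> \<xi> + c / sqrt (real n)" "\<xi> + c / sqrt (real n) - 1 / real n < node \<xi> n c"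
proof -
  have s: "sqrt (real n) * sqrt (real n) = real n" "sqrt (real n) > 0" using assms by auto
  have "c / sqrt (real n) = c * sqrt (real n) / real n" using s by (simp add: field_simps)
  then have e: "\<xi> + c / sqrt (real n) = (real n * \<xi> + c * sqrt (real n)) / real n"
    using assms by (simp add: field_simps)
  show "node \<xi> n c \<le> \<xi> + c / sqrt (real n)"
    unfolding e node_def by (intro divide_right_mono) auto
  have "real n * \<xi> + c * sqrt (real n) - 1 < of_int \<lfloor>real n * \<xi> + c * sqrt (real n)\<rfloor>" by linarith
  then have "(real n * \<xi> + c * sqrt (real n) - 1) / real n < node \<xi> n c"
    unfolding node_def using assms by (intro divide_strict_right_mono) auto
  then show "\<xi> + c / sqrt (real n) - 1 / real n < node \<xi> n c" unfolding e by (simp add: diff_divide_distrib)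
qed

text \<open>Up to rounding, x1 and x4 are 4 / sqrt n apart, so they only fit into [0,1] if s = sqrt
  n satisfies 4 s < s^2 + 1, that is (s - 1) (s - 3) > 0. This makes the rounding error 1/n of a
  node at most a third of 1 / sqrt n.\<close>

lemma admissible_sqrt_gt:
  assumes "admissible \<xi> n"
  shows "sqrt (real n) > 3"
proof -
  define s where "s = sqrt (real n)"
  have n: "n > 0" using assms by (simp add: admissible_def)
  have s: "s * s = real n" "s \<ge> 1" using n by (auto simp: s_def)
  have "0 \<le> (of_int \<lfloor>real n * \<xi> + (-2) * s\<rfloor> :: real)" "of_int \<lfloor>real n * \<xi> + 2 * s\<rfloor> \<le> real n"
    using assms n by (auto simp: admissible_def node_def s_def zero_le_divide_iff divide_le_eq)
  then have "4 * s < s * s + 1" unfolding s(1) by linarith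
  then have "0 < (s - 1) * (s - 3)" by (simp add: algebra_simps)
  then show ?thesis using s(2) unfolding s_def[symmetric] by (simp add: zero_less_mult_iff)
qed

text \<open>\<open>Fbar\<close> mixes f and P with the weight \<open>psi1 * (1 - psi2)\<close>.
  Since \<open>psi2\<close> vanishes wherever \<open>psi1\<close> differs from 1, this product is
  the difference of the two, whose second differences need no product rule.\<close>

definition cutoff :: "real \<Rightarrow> nat \<Rightarrow> real \<Rightarrow> real" where
  "cutoff \<xi> n x = psi1 \<xi> n x - psi2 \<xi> n x"

lemma inverse_nat_le: "sqrt (real n) > 3 \<Longrightarrow> 1 / real n \<le> (1 / sqrt (real n)) / 3"
proof -
  assume s: "sqrt (real n) > 3"
  then have n: "n > 0" by (cases n) auto
  have "1 / real n = (1 / sqrt (real n)) * (1 / sqrt (real n))" by simp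
  also have "\<dots> \<le> (1 / sqrt (real n)) * (1 / 3)" using s n by (intro mult_left_mono divide_left_mono) auto
  finally show ?thesis by simp
qed

text \<open>Rounding moves a node to the left by less than 1/n, at most a third of 1 / sqrt n; the
  constants are simple values that survive this loss.\<close>

lemma nodes_order:
  assumes s: "sqrt (real n) > 3"
  shows "x1 \<xi> n \<le> \<xi> - 2 / sqrt (real n)" "x1 \<xi> n > \<xi> - 3 / sqrt (real n)" "x2 \<xi> n \<le> \<xi> - 1 / sqrt (real n)"
    "x2 \<xi> n - x1 \<xi> n > (1 / 2) / sqrt (real n)"
    "x3 \<xi> n > \<xi> + (1 / 2) / sqrt (real n)" "x4 \<xi> n - x3 \<xi> n > (1 / 2) / sqrt (real n)"
    "x4 \<xi> n > \<xi> + 1 / sqrt (real n)" "x4 \<xi> n \<le> \<xi> + 2 / sqrt (real n)" "x1 \<xi> n < x4 \<xi> n"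
proof -
  have n: "n > 0" using s by (cases n) auto
  define r q where "r = 1 / sqrt (real n)" and "q = 1 / real n"
  have e: "c / sqrt (real n) = c * r" for c by (simp add: r_def)
  have i: "q \<le> r / 3" and r: "r > 0" using inverse_nat_le[OF s] n by (auto simp: r_def q_def)
  have b: "node \<xi> n c \<le> \<xi> + c * r" "\<xi> + c * r - q < node \<xi> n c" for c
    using node_bounds[OF n, where c = c] unfolding e q_def[symmetric] by auto
  show "x1 \<xi> n \<le> \<xi> - 2 / sqrt (real n)" "x1 \<xi> n > \<xi> - 3 / sqrt (real n)" "x2 \<xi> n \<le> \<xi> - 1 / sqrt (real n)"
    "x2 \<xi> n - x1 \<xi> n > (1 / 2) / sqrt (real n)"
    "x3 \<xi> n > \<xi> + (1 / 2) / sqrt (real n)" "x4 \<xi> n - x3 \<xi> n > (1 / 2) / sqrt (real n)"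
    "x4 \<xi> n > \<xi> + 1 / sqrt (real n)" "x4 \<xi> n \<le> \<xi> + 2 / sqrt (real n)" "x1 \<xi> n < x4 \<xi> n"
    unfolding e using b[of "-2"] b[of "-1"] b[of 1] b[of 2] i r by linarith+
qed

lemma cutoff_props:
  assumes s: "sqrt (real n) > 3"
  shows cutoff_bounds: "0 \<le> cutoff \<xi> n x" "cutoff \<xi> n x \<le> 1"
    and cutoff_left: "x \<le> x1 \<xi> n \<Longrightarrow> cutoff \<xi> n x = 0"
    and cutoff_right: "x \<ge> x4 \<xi> n \<Longrightarrow> cutoff \<xi> n x = 0"
    and cutoff_middle: "\<lbrakk>x2 \<xi> n \<le> x; x \<le> x3 \<xi> n\<rbrakk> \<Longrightarrow> cutoff \<xi> n x = 1"
    and Fbar_eq: "Fbar \<xi> n f x = f x + cutoff \<xi> n x * (P \<xi> n f x - f x)"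
proof -
  note o = nodes_order[OF s, of \<xi>]
  have "n > 0" using s by (cases n) auto
  then have r: "(1 / 2) / sqrt (real n) > 0" "1 / sqrt (real n) > 0" by auto
  have d: "x2 \<xi> n - x1 \<xi> n > 0" "x4 \<xi> n - x3 \<xi> n > 0" "x2 \<xi> n < x3 \<xi> n" using o r by linarith+
  have p1_1: "psi1 \<xi> n x = 1" if "x \<ge> x2 \<xi> n" using that d unfolding psi1_def by (intro psi_1) simp
  have p1_0: "psi1 \<xi> n x = 0" if "x \<le> x1 \<xi> n" using that d unfolding psi1_def by (intro psi_0) (simp add: divide_nonpos_pos)
  have p2_1: "psi2 \<xi> n x = 1" if "x \<ge> x4 \<xi> n" using that d unfolding psi2_def by (intro psi_1) simp
  have p2_0: "psi2 \<xi> n x = 0" if "x \<le> x3 \<xi> n" using that d unfolding psi2_def by (intro psi_0) (simp add: divide_nonpos_pos)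
  have b: "0 \<le> psi1 \<xi> n x" "psi1 \<xi> n x \<le> 1" "0 \<le> psi2 \<xi> n x" "psi2 \<xi> n x \<le> 1"
    by (auto simp: psi1_def psi2_def psi_bounds)
  have c: "psi2 \<xi> n x = 0 \<or> psi1 \<xi> n x = 1" using p1_1 p2_0 d by linarith
  show "0 \<le> cutoff \<xi> n x" "cutoff \<xi> n x \<le> 1" using b c by (auto simp: cutoff_def)
  show "x \<le> x1 \<xi> n \<Longrightarrow> cutoff \<xi> n x = 0" using p1_0 p2_0 d by (simp add: cutoff_def)
  show "x \<ge> x4 \<xi> n \<Longrightarrow> cutoff \<xi> n x = 0" using p1_1 p2_1 d by (simp add: cutoff_def)
  show "\<lbrakk>x2 \<xi> n \<le> x; x \<le> x3 \<xi> n\<rbrakk> \<Longrightarrow> cutoff \<xi> n x = 1" using p1_1 p2_0 by (simp add: cutoff_def)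
  show "Fbar \<xi> n f x = f x + cutoff \<xi> n x * (P \<xi> n f x - f x)"
    using c by (auto simp: Fbar_def cutoff_def algebra_simps)
qed

text \<open>Meant for v = f z, with z = y away from \<xi>, or with z one of the nodes x1, x4 that
  determine P.\<close>

lemma smooth_dist_powr_le:
  assumes a: "\<alpha> > 0" and n: "0 < n" and y: "smooth_dist \<xi> n y \<le> 4 * \<bar>z - \<xi>\<bar>"
    and M: "\<bar>wbar \<xi> \<alpha> z * v\<bar> \<le> M"
  shows "\<bar>v\<bar> * smooth_dist \<xi> n y powr \<alpha> \<le> 4 powr \<alpha> * M"
proof -
  have "smooth_dist \<xi> n y powr \<alpha> \<le> (4 * \<bar>z - \<xi>\<bar>) powr \<alpha>"
    using a y smooth_dist_pos[OF n, of \<xi> y] by (intro powr_mono2) auto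
  also have "\<dots> = 4 powr \<alpha> * wbar \<xi> \<alpha> z" by (simp add: powr_mult wbar_def)
  finally have "\<bar>v\<bar> * smooth_dist \<xi> n y powr \<alpha> \<le> \<bar>v\<bar> * (4 powr \<alpha> * wbar \<xi> \<alpha> z)" by (intro mult_left_mono) auto
  also have "\<dots> = 4 powr \<alpha> * \<bar>wbar \<xi> \<alpha> z * v\<bar>" using wbar_nonneg[of \<xi> \<alpha> z] by (simp add: abs_mult)
  also have "\<dots> \<le> 4 powr \<alpha> * M" using M by (intro mult_left_mono) auto
  finally show ?thesis .
qed

text \<open>Where the cut-off is not 1, y has distance at least 1 / (2 sqrt n) from \<xi> and f(y)
  itself is controlled. Where it is not 0, y lies between x1 and x4, so |P| is at most |f(x1)| +
  |f(x4)|, and both nodes are at least 1 / sqrt n away from \<xi>.\<close>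

lemma Fbar_weighted_bound:
  assumes a: "\<alpha> > 0" and adm: "admissible \<xi> n"
    and M: "\<And>z. z \<in> {0..1} \<Longrightarrow> \<bar>wbar \<xi> \<alpha> z * f z\<bar> \<le> M" and y: "y \<in> {0..1}"
  shows "\<bar>Fbar \<xi> n f y\<bar> * smooth_dist \<xi> n y powr \<alpha> \<le> 2 * 4 powr \<alpha> * M"
proof -
  note s = admissible_sqrt_gt[OF adm]
  define r where "r = 1 / sqrt (real n)"
  have e: "c / sqrt (real n) = c * r" for c by (simp add: r_def)
  note o = nodes_order[OF s, of \<xi>, unfolded e]
  let ?\<chi> = "cutoff \<xi> n y" and ?d = "smooth_dist \<xi> n y powr \<alpha>"
  have n: "n > 0" using adm by (simp add: admissible_def)
  have r: "r > 0" using n by (simp add: r_def)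
  have sd: "smooth_dist \<xi> n y = \<bar>y - \<xi>\<bar> + r" by (simp add: smooth_dist_def r_def)
  have M0: "M \<ge> 0" using M[OF y] by linarith
  have x14: "x1 \<xi> n \<in> {0..1}" "x4 \<xi> n \<in> {0..1}" using adm o(9) by (auto simp: admissible_def)
  have f: "(1 - ?\<chi>) * \<bar>f y\<bar> * ?d \<le> (1 - ?\<chi>) * (4 powr \<alpha> * M)"
  proof (cases "x2 \<xi> n \<le> y \<and> y \<le> x3 \<xi> n")
    case True
    then show ?thesis using cutoff_middle[OF s, of \<xi> y] by simp
  next
    case False
    then have "\<bar>y - \<xi>\<bar> \<ge> r / 2" using o(3,5) r by (auto simp: abs_if not_le)
    moreover have "t + r \<le> 4 * t" if "r / 2 \<le> t" for t using that r by linarith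
    ultimately have "smooth_dist \<xi> n y \<le> 4 * \<bar>y - \<xi>\<bar>" unfolding sd by blast
    then have "\<bar>f y\<bar> * ?d \<le> 4 powr \<alpha> * M" by (rule smooth_dist_powr_le[OF a n _ M[OF y]])
    then show ?thesis using cutoff_bounds(2)[OF s, of \<xi> y] by (simp only: mult.assoc) (intro mult_left_mono; simp)
  qed
  have p: "?\<chi> * \<bar>P \<xi> n f y\<bar> * ?d \<le> ?\<chi> * (2 * 4 powr \<alpha> * M)"
  proof (cases "x1 \<xi> n < y \<and> y < x4 \<xi> n")
    case False
    then show ?thesis using cutoff_left[OF s, of y \<xi>] cutoff_right[OF s, of \<xi> y] by (auto simp: not_less)
  next
    case True
    have d: "smooth_dist \<xi> n y \<le> 4 * r" using True o(2,8) r unfolding sd by (auto simp: abs_if)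
    have "smooth_dist \<xi> n y \<le> 4 * \<bar>x1 \<xi> n - \<xi>\<bar>" "smooth_dist \<xi> n y \<le> 4 * \<bar>x4 \<xi> n - \<xi>\<bar>"
      using d o(1,7) r by (auto simp: abs_if)
    then have f14: "\<bar>f (x1 \<xi> n)\<bar> * ?d \<le> 4 powr \<alpha> * M" "\<bar>f (x4 \<xi> n)\<bar> * ?d \<le> 4 powr \<alpha> * M"
      by (auto intro: smooth_dist_powr_le[OF a n _ M[OF x14(1)]] smooth_dist_powr_le[OF a n _ M[OF x14(2)]])
    have "\<bar>P \<xi> n f y\<bar> \<le> \<bar>(y - x4 \<xi> n) / (x1 \<xi> n - x4 \<xi> n)\<bar> * \<bar>f (x1 \<xi> n)\<bar> + \<bar>(x1 \<xi> n - y) / (x1 \<xi> n - x4 \<xi> n)\<bar> * \<bar>f (x4 \<xi> n)\<bar>"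
      unfolding P_def abs_mult[symmetric] by (rule abs_triangle_ineq)
    also have "\<dots> \<le> 1 * \<bar>f (x1 \<xi> n)\<bar> + 1 * \<bar>f (x4 \<xi> n)\<bar>"
      using True by (intro add_mono mult_right_mono) (auto simp: abs_divide divide_le_eq)
    finally have "\<bar>P \<xi> n f y\<bar> * ?d \<le> (\<bar>f (x1 \<xi> n)\<bar> + \<bar>f (x4 \<xi> n)\<bar>) * ?d" by (intro mult_right_mono) auto
    also have "\<dots> \<le> 2 * 4 powr \<alpha> * M" using f14 by (simp add: distrib_right)
    finally show ?thesis using cutoff_bounds(1)[OF s, of \<xi> y] by (simp only: mult.assoc) (intro mult_left_mono; simp)
  qed
  have "\<bar>Fbar \<xi> n f y\<bar> \<le> (1 - ?\<chi>) * \<bar>f y\<bar> + ?\<chi> * \<bar>P \<xi> n f y\<bar>"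
  proof -
    have "Fbar \<xi> n f y = (1 - ?\<chi>) * f y + ?\<chi> * P \<xi> n f y" unfolding Fbar_eq[OF s] by (simp add: algebra_simps)
    then have "\<bar>Fbar \<xi> n f y\<bar> \<le> \<bar>(1 - ?\<chi>) * f y\<bar> + \<bar>?\<chi> * P \<xi> n f y\<bar>" by (simp only: abs_triangle_ineq)
    then show ?thesis using cutoff_bounds[OF s, of \<xi> y] by (simp add: abs_mult)
  qed
  then have "\<bar>Fbar \<xi> n f y\<bar> * ?d \<le> ((1 - ?\<chi>) * \<bar>f y\<bar> + ?\<chi> * \<bar>P \<xi> n f y\<bar>) * ?d" by (intro mult_right_mono) auto
  also have "\<dots> \<le> (1 - ?\<chi>) * (4 powr \<alpha> * M) + ?\<chi> * (2 * 4 powr \<alpha> * M)"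
    using f p by (simp add: distrib_right)
  also have "\<dots> \<le> (1 - ?\<chi>) * (2 * 4 powr \<alpha> * M) + ?\<chi> * (2 * 4 powr \<alpha> * M)"
    using cutoff_bounds[OF s, of \<xi> y] M0 by (intro add_right_mono mult_left_mono) auto
  also have "\<dots> = 2 * 4 powr \<alpha> * M" by (simp add: algebra_simps)
  finally show ?thesis .
qed

lemma Bbar_eq: "Bbar \<xi> n f = (\<lambda>x. \<Sum>k\<le>n. Fbar \<xi> n f (real k / real n) * Bernstein n k x)"
  by (simp add: Bbar_def bernstein_op_def fun_eq_iff)

lemma phi_pos: "0 < x \<Longrightarrow> x < 1 \<Longrightarrow> phi x > 0"
  by (simp add: phi_def)

lemma phi_square: "0 < x \<Longrightarrow> x < 1 \<Longrightarrow> phi x powr 2 = x * (1 - x)"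
  by (simp add: phi_def powr_half_sqrt[symmetric] powr_powr)

lemma Bbar_deriv2_bound_C:
  assumes a: "\<alpha> > 0" and lam: "0 \<le> lam" "lam \<le> 1"
  shows "\<exists>C>0. \<forall>f. \<forall>n. admissible \<xi> n \<longrightarrow> (\<forall>x\<in>{0..1}.
            ereal \<bar>wbar \<xi> \<alpha> x * phi_pow (2 * lam) x * (deriv ^^ 2) (Bbar \<xi> n f) x\<bar>
              \<le> ereal C * ereal (real n) * max_factor lam n x * wnorm \<xi> \<alpha> f)"
proof -
  define C where "C = 40 * exp 3 * weight_const \<alpha> * (2 * 4 powr \<alpha>)"
  have C: "C > 0" using weight_const_pos[of \<alpha>] by (simp add: C_def)
  have "ereal \<bar>wbar \<xi> \<alpha> x * phi_pow (2 * lam) x * (deriv ^^ 2) (Bbar \<xi> n f) x\<bar>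
      \<le> ereal C * ereal (real n) * max_factor lam n x * wnorm \<xi> \<alpha> f"
    if adm: "admissible \<xi> n" and x: "x \<in> {0..1}" for f n x
  proof -
    have s: "sqrt (real n) > 3" by (rule admissible_sqrt_gt[OF adm])
    have n: "n > 0" using adm by (simp add: admissible_def)
    have n2: "n \<ge> 2"
    proof (rule ccontr)
      assume "\<not> n \<ge> 2"
      then have "real n \<le> 1" by linarith
      then have "sqrt (real n) \<le> 1" by simp
      then show False using s by linarith
    qed
    have mf: "max_factor lam n x > 0" using n by (auto simp: max_factor_def less_max_iff_disj)
    have wn: "ereal \<bar>wbar \<xi> \<alpha> z * f z\<bar> \<le> wnorm \<xi> \<alpha> f" if "z \<in> {0..1}" for z
      unfolding wnorm_def by (rule SUP_upper[OF that])
    then have wn0: "wnorm \<xi> \<alpha> f \<ge> 0" using order_trans[OF _ wn[OF x], of 0] by simp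
    have Cn: "ereal C * ereal (real n) > 0" using C n by simp
    show ?thesis
    proof (cases "wnorm \<xi> \<alpha> f")
      case PInf
      have "ereal C * ereal (real n) * max_factor lam n x * wnorm \<xi> \<alpha> f = \<infinity>"
        unfolding PInf using C n mf by (cases "max_factor lam n x") auto
      then show ?thesis by (simp only: ereal_less_eq)
    next
      case MInf
      then show ?thesis using wn0 by simp
    next
      case (real M)
      have M0: "M \<ge> 0" using wn0 real by simp
      have M: "\<bar>wbar \<xi> \<alpha> z * f z\<bar> \<le> M" if "z \<in> {0..1}" for z using wn[OF that] real by simp
      have F: "\<bar>Fbar \<xi> n f (real k / real n)\<bar> * smooth_dist \<xi> n (real k / real n) powr \<alpha> \<le> 2 * 4 powr \<alpha> * M" if "k \<le> n" for k
        using that n by (intro Fbar_weighted_bound a adm M) auto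
      show ?thesis
      proof (cases "0 < x \<and> x < 1")
        case True
        have phi: "phi x > 0" using True by (simp add: phi_pos)
        let ?B = "(deriv ^^ 2) (Bbar \<xi> n f) x"
        have main: "wbar \<xi> \<alpha> x * (x * (1 - x)) * \<bar>?B\<bar> \<le> C * real n * M"
          using Bernstein_deriv2_bound[OF a n2 _ _ _ F, of x] True M0
          unfolding Bbar_eq C_def by (simp add: mult_ac)
        \<comment> \<open>Factoring out x (1 - x) = phi^2 reduces every \<open>lam\<close> to the
          estimate for \<open>lam\<close> = 1.\<close>
        have pp: "phi_pow (2 * lam) x = phi x powr (2 * (lam - 1)) * (x * (1 - x))"
        proof -
          have "phi x powr (2 * lam) = phi x powr (2 * (lam - 1)) * phi x powr 2"
            unfolding powr_add[symmetric] by (simp add: algebra_simps)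
          then show ?thesis using True phi phi_square[of x] by (auto simp: phi_pow_def)
        qed
        have pp2: "phi_pow (2 * (lam - 1)) x = phi x powr (2 * (lam - 1))" using phi by (simp add: phi_pow_def)
        have "\<bar>wbar \<xi> \<alpha> x * phi_pow (2 * lam) x * ?B\<bar> = phi x powr (2 * (lam - 1)) * (wbar \<xi> \<alpha> x * (x * (1 - x)) * \<bar>?B\<bar>)"
          unfolding pp using True wbar_nonneg[of \<xi> \<alpha> x] by (simp add: abs_mult)
        also have "\<dots> \<le> phi x powr (2 * (lam - 1)) * (C * real n * M)" using main by (intro mult_left_mono) auto
        also have "\<dots> \<le> max (real n powr (1 - lam)) (phi_pow (2 * (lam - 1)) x) * (C * real n * M)"
          unfolding pp2 using C M0 by (intro mult_right_mono) auto
        finally have "\<bar>wbar \<xi> \<alpha> x * phi_pow (2 * lam) x * ?B\<bar> \<le> C * real n * max (real n powr (1 - lam)) (phi_pow (2 * (lam - 1)) x) * M"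
          by (simp add: mult_ac)
        moreover have "max_factor lam n x = ereal (max (real n powr (1 - lam)) (phi_pow (2 * (lam - 1)) x))"
          unfolding max_factor_def by (rule if_not_P) (use phi in simp)
        ultimately show ?thesis unfolding real by (simp only: times_ereal.simps ereal_less_eq)
      next
        case False
        then have x0: "x = 0 \<or> x = 1" using x by auto
        then have phi: "phi x = 0" by (auto simp: phi_def)
        show ?thesis
        proof (cases "lam < 1")
          case False
          then have "phi_pow (2 * lam) x = 0" using phi by (simp add: phi_pow_def)
          moreover have "0 \<le> ereal C * ereal (real n) * max_factor lam n x * wnorm \<xi> \<alpha> f"
            using C mf wn0 by (intro ereal_0_le_mult) auto
          ultimately show ?thesis by (simp add: zero_ereal_def[symmetric])
        next
          case True
          then have mfi: "max_factor lam n x = \<infinity>" using phi by (simp add: max_factor_def)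
          show ?thesis
          \<comment> \<open>In \<open>ereal\<close> infinity times 0 is 0, so for norm zero the
            infinite maximum gives nothing and the left side must vanish: \<open>Fbar\<close> is 0
            at all points k/n.\<close>
          proof (cases "M = 0")
            case True
            have "Fbar \<xi> n f (real k / real n) = 0" if "k \<le> n" for k
            proof -
              have "smooth_dist \<xi> n (real k / real n) powr \<alpha> > 0" using smooth_dist_pos[OF n, of \<xi> "real k / real n"] by simp
              moreover have "\<bar>Fbar \<xi> n f (real k / real n)\<bar> * smooth_dist \<xi> n (real k / real n) powr \<alpha> \<le> 0"
                using F[OF that] True by simp
              ultimately show ?thesis by (simp add: mult_le_0_iff)
            qed
            then have "Bbar \<xi> n f = (\<lambda>x. 0)" unfolding Bbar_eq by (auto intro!: sum.neutral)
            then have "(deriv ^^ 2) (Bbar \<xi> n f) x = 0" by (simp add: deriv_funpow_2)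
            then show ?thesis using True real by (simp add: zero_ereal_def[symmetric])
          next
            case False
            then have "M > 0" using M0 by simp
            then have "ereal C * ereal (real n) * max_factor lam n x * wnorm \<xi> \<alpha> f = \<infinity>"
              unfolding mfi real using C n by simp
            then show ?thesis by (simp only: ereal_less_eq)
          qed
        qed
      qed
    qed
  qed
  then show ?thesis using C by blast
qed

section \<open>Second differences of the modified function\<close>

definition dpsi :: "real \<Rightarrow> real" where
  "dpsi x = (if 0 < x \<and> x < 1 then 30 * (x * (1 - x))\<^sup>2 else 0)"

lemma psi_reflect: "psi x = 1 - psi (1 - x)"
proof (cases "0 < x \<and> x < 1")
  case True
  then show ?thesis by (simp add: psi_def eval_nat_numeral algebra_simps)
qed (auto simp: psi_def)

text \<open>A bound of order o(h) yields derivative 0 at the gluing point 0, and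
  \<open>psi_reflect\<close> transfers this to 1. The constant is 10 + 6.\<close>

lemma psi_quadratic_at_0: "\<bar>psi h\<bar> \<le> 16 * h\<^sup>2"
proof (cases "0 < h \<and> h < 1")
  case True
  then have "h ^ 3 \<le> h\<^sup>2" "h ^ 5 \<le> h\<^sup>2" "0 \<le> h ^ 4" by (auto intro!: power_decreasing)
  moreover have "psi h = 10 * h ^ 3 - 15 * h ^ 4 + 6 * h ^ 5" using True by (simp add: psi_def)
  ultimately show ?thesis using psi_bounds[of h] by linarith
next
  case False
  show ?thesis
  proof (cases "h \<le> 0")
    case True
    then show ?thesis by (simp add: psi_0)
  next
    case False
    then have "1 \<le> h\<^sup>2" using \<open>\<not> (0 < h \<and> h < 1)\<close> by (simp add: one_le_power)
    then show ?thesis using psi_bounds[of h] by linarith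
  qed
qed

lemma DERIV_psi_0: "(psi has_real_derivative 0) (at 0)"
  unfolding DERIV_def
proof (rule Lim_null_comparison)
  show "eventually (\<lambda>h. norm ((psi (0 + h) - psi 0) / h) \<le> 16 * \<bar>h\<bar>) (at 0)"
  proof (rule eventuallyI)
    fix h :: real
    show "norm ((psi (0 + h) - psi 0) / h) \<le> 16 * \<bar>h\<bar>"
    proof (cases "h = 0")
      case False
      have "\<bar>psi h\<bar> \<le> (16 * \<bar>h\<bar>) * \<bar>h\<bar>" using psi_quadratic_at_0[of h] by (simp add: power2_eq_square)
      then show ?thesis using False by (simp add: psi_0 pos_divide_le_eq)
    qed simp
  qed
  show "((\<lambda>h. 16 * \<bar>h\<bar>) \<longlongrightarrow> 0) (at (0::real))" by (auto intro!: tendsto_eq_intros)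
qed

lemma DERIV_psi: "(psi has_real_derivative dpsi x) (at x)"
proof -
  consider "x < 0" | "x = 0" | "0 < x" "x < 1" | "x = 1" | "x > 1" by linarith
  then show ?thesis
  proof cases
    case 1
    have "((\<lambda>x. 0) has_real_derivative 0) (at x)" by simp
    then have "(psi has_real_derivative 0) (at x)"
      by (rule has_field_derivative_transform_within_open[of _ _ _ "{..<0}"]) (use 1 in \<open>auto simp: psi_def\<close>)
    then show ?thesis using 1 by (simp add: dpsi_def)
  next
    case 2
    then show ?thesis using DERIV_psi_0 by (simp add: dpsi_def)
  next
    case 3
    have "((\<lambda>x. 10 * x ^ 3 - 15 * x ^ 4 + 6 * x ^ 5) has_real_derivative 30 * (x * (1 - x))\<^sup>2) (at x)"
      by (auto intro!: derivative_eq_intros simp: eval_nat_numeral algebra_simps)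
    then have "(psi has_real_derivative 30 * (x * (1 - x))\<^sup>2) (at x)"
      by (rule has_field_derivative_transform_within_open[of _ _ _ "{0<..<1}"]) (use 3 in \<open>auto simp: psi_def\<close>)
    then show ?thesis using 3 by (simp add: dpsi_def)
  next
    case 4
    have "((\<lambda>x. 1 - psi (1 - x)) has_real_derivative 0 - 0 * (0 - 1)) (at 1)"
      by (intro DERIV_diff DERIV_const DERIV_chain2[of psi] DERIV_ident) (use DERIV_psi_0 in simp)
    moreover have "(\<lambda>x. 1 - psi (1 - x)) = psi" by (rule ext) (rule psi_reflect[symmetric])
    ultimately show ?thesis using 4 by (simp add: dpsi_def)
  next
    case 5
    have "((\<lambda>x. 1) has_real_derivative 0) (at x)" by simp
    then have "(psi has_real_derivative 0) (at x)"
      by (rule has_field_derivative_transform_within_open[of _ _ _ "{1<..}"]) (use 5 in \<open>auto simp: psi_def\<close>)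
    then show ?thesis using 5 by (simp add: dpsi_def)
  qed
qed

text \<open>Clamping the argument makes \<open>dpsi\<close> a single polynomial expression, so the
  Lipschitz estimate needs no case distinction at 0 and 1.\<close>

lemma dpsi_clamp: "dpsi x = 30 * (max 0 (min 1 x) * (1 - max 0 (min 1 x)))\<^sup>2"
  by (auto simp: dpsi_def max_def min_def)

lemma dpsi_le_2: "\<bar>dpsi x\<bar> \<le> 2"
proof (cases "0 < x \<and> x < 1")
  case True
  then have "(x * (1 - x))\<^sup>2 \<le> (1/4)\<^sup>2" by (intro power_mono mult_one_minus_le) auto
  moreover have "(1/4::real)\<^sup>2 = 1/16" by (simp add: power2_eq_square)
  moreover have "dpsi x = 30 * (x * (1 - x))\<^sup>2" using True by (simp add: dpsi_def)
  ultimately show ?thesis using zero_le_power2[of "x * (1 - x)"] by linarith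
qed (auto simp: dpsi_def)

lemma dpsi_lipschitz: "\<bar>dpsi x - dpsi y\<bar> \<le> 15 * \<bar>x - y\<bar>"
proof -
  define c d where "c = max 0 (min 1 x)" and "d = max 0 (min 1 y)"
  have cd: "0 \<le> c" "c \<le> 1" "0 \<le> d" "d \<le> 1" "\<bar>c - d\<bar> \<le> \<bar>x - y\<bar>"
    by (auto simp: c_def d_def)
  \<comment> \<open>A difference of squares: for c, d in [0,1] the sum factor is at most 1/2 and |1
    - c - d| at most 1, so 30 becomes 15.\<close>
  have "(c * (1 - c))\<^sup>2 - (d * (1 - d))\<^sup>2 = (c * (1 - c) + d * (1 - d)) * ((c - d) * (1 - c - d))"
    by (simp add: power2_eq_square algebra_simps)
  then have "\<bar>(c * (1 - c))\<^sup>2 - (d * (1 - d))\<^sup>2\<bar> = \<bar>c * (1 - c) + d * (1 - d)\<bar> * (\<bar>c - d\<bar> * \<bar>1 - c - d\<bar>)"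
    by (simp only: abs_mult)
  also have "\<dots> \<le> (1/2) * (\<bar>x - y\<bar> * 1)"
  proof (intro mult_mono)
    show "\<bar>c * (1 - c) + d * (1 - d)\<bar> \<le> 1/2" using cd mult_one_minus_le[of c] mult_one_minus_le[of d] by simp
  qed (use cd in \<open>auto simp: abs_le_iff\<close>)
  finally have "\<bar>(c * (1 - c))\<^sup>2 - (d * (1 - d))\<^sup>2\<bar> \<le> (1/2) * (\<bar>x - y\<bar> * 1)" .
  moreover have "\<bar>30 * p - 30 * q\<bar> = 30 * \<bar>p - q\<bar>" for p q :: real
    unfolding right_diff_distrib[symmetric] by (simp only: abs_mult abs_numeral)
  ultimately show ?thesis unfolding dpsi_clamp c_def[symmetric] d_def[symmetric] by simp
qed

lemma psi_lipschitz: "\<bar>psi x - psi y\<bar> \<le> 2 * \<bar>x - y\<bar>"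
proof -
  have "\<bar>psi v - psi u\<bar> \<le> 2 * \<bar>v - u\<bar>" if uv: "u < v" for u v
  proof -
    obtain z where "psi v - psi u = (v - u) * dpsi z" using MVT2[OF uv, of psi dpsi] DERIV_psi by blast
    then have "\<bar>psi v - psi u\<bar> = \<bar>v - u\<bar> * \<bar>dpsi z\<bar>" by (simp add: abs_mult)
    also have "\<dots> \<le> \<bar>v - u\<bar> * 2" by (intro mult_left_mono dpsi_le_2) auto
    finally show ?thesis by simp
  qed
  from this[of x y] this[of y x] show ?thesis by (cases x y rule: linorder_cases) (auto simp: abs_minus_commute)
qed

lemma psi_second_diff:
  assumes "\<delta> > 0"
  shows "\<bar>psi (a + \<delta>) - 2 * psi a + psi (a - \<delta>)\<bar> \<le> 30 * \<delta>\<^sup>2"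
proof -
  obtain z1 where z1: "a < z1" "z1 < a + \<delta>" "psi (a + \<delta>) - psi a = (a + \<delta> - a) * dpsi z1"
    using MVT2[of a "a + \<delta>" psi dpsi] DERIV_psi assms by auto
  obtain z2 where z2: "a - \<delta> < z2" "z2 < a" "psi a - psi (a - \<delta>) = (a - (a - \<delta>)) * dpsi z2"
    using MVT2[of "a - \<delta>" a psi dpsi] DERIV_psi assms by auto
  have "psi (a + \<delta>) - 2 * psi a + psi (a - \<delta>) = \<delta> * (dpsi z1 - dpsi z2)"
    using z1(3) z2(3) by (simp add: algebra_simps)
  then have "\<bar>psi (a + \<delta>) - 2 * psi a + psi (a - \<delta>)\<bar> = \<delta> * \<bar>dpsi z1 - dpsi z2\<bar>" using assms by (simp add: abs_mult)
  also have "\<dots> \<le> \<delta> * (15 * \<bar>z1 - z2\<bar>)" using assms by (intro mult_left_mono dpsi_lipschitz) auto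
  also have "\<dots> \<le> \<delta> * (15 * (2 * \<delta>))" using assms z1 z2 by (intro mult_left_mono) auto
  finally show ?thesis by (simp add: power2_eq_square)
qed

text \<open>A transition wider than 1 / (2 sqrt n) rescales psi by a factor below 2 sqrt n; hence
  the constants 2 * 2 for one difference and 30 * 4 for two.\<close>

lemma psi_scaled_bounds:
  assumes L: "L > (1 / 2) / sqrt (real n)" and n: "n > 0" and h: "h > 0"
  shows "\<bar>psi ((u - b) / L) - psi ((v - b) / L)\<bar> \<le> 4 * sqrt (real n) * \<bar>u - v\<bar>"
    "\<bar>second_diff (\<lambda>x. psi ((x - b) / L)) h y\<bar> \<le> 120 * real n * h\<^sup>2"
proof -
  have s: "sqrt (real n) > 0" using n by simp
  then have L0: "L > 0" using L less_trans[of 0 "(1 / 2) / sqrt (real n)" L] by simp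
  have iL: "1 / L \<le> 2 * sqrt (real n)" using L L0 s by (simp add: field_simps)
  have "\<bar>psi ((u - b) / L) - psi ((v - b) / L)\<bar> \<le> 2 * \<bar>(u - b) / L - (v - b) / L\<bar>" by (rule psi_lipschitz)
  also have "(u - b) / L - (v - b) / L = (1 / L) * (u - v)" by (simp add: diff_divide_distrib)
  also have "2 * \<bar>(1 / L) * (u - v)\<bar> = 2 * ((1 / L) * \<bar>u - v\<bar>)" using L0 by (simp add: abs_mult)
  also have "\<dots> \<le> 2 * ((2 * sqrt (real n)) * \<bar>u - v\<bar>)" using iL by (intro mult_left_mono mult_right_mono) auto
  finally show "\<bar>psi ((u - b) / L) - psi ((v - b) / L)\<bar> \<le> 4 * sqrt (real n) * \<bar>u - v\<bar>" by simp
  have "second_diff (\<lambda>x. psi ((x - b) / L)) h y = psi ((y - b) / L + h / L) - 2 * psi ((y - b) / L) + psi ((y - b) / L - h / L)"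
    unfolding second_diff_def by (simp add: add_divide_distrib diff_divide_distrib algebra_simps)
  also have "\<bar>\<dots>\<bar> \<le> 30 * (h / L)\<^sup>2" using h L0 by (intro psi_second_diff) simp
  also have "h / L = (1 / L) * h" by simp
  also have "((1 / L) * h)\<^sup>2 \<le> ((2 * sqrt (real n)) * h)\<^sup>2"
    using iL h L0 by (intro power_mono mult_right_mono) auto
  finally show "\<bar>second_diff (\<lambda>x. psi ((x - b) / L)) h y\<bar> \<le> 120 * real n * h\<^sup>2"
    by (simp add: power_mult_distrib)
qed

lemma cutoff_smooth:
  assumes s: "sqrt (real n) > 3" and h: "h > 0"
  shows "\<bar>cutoff \<xi> n u - cutoff \<xi> n v\<bar> \<le> 8 * sqrt (real n) * \<bar>u - v\<bar>"
    "\<bar>second_diff (cutoff \<xi> n) h y\<bar> \<le> 240 * real n * h\<^sup>2"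
proof -
  have n: "n > 0" using s by (cases n) auto
  note o = nodes_order[OF s, of \<xi>]
  note b1 = psi_scaled_bounds[OF o(4) n h, of _ "x1 \<xi> n"] and b2 = psi_scaled_bounds[OF o(6) n h, of _ "x3 \<xi> n"]
  show "\<bar>cutoff \<xi> n u - cutoff \<xi> n v\<bar> \<le> 8 * sqrt (real n) * \<bar>u - v\<bar>"
    using b1(1)[of u v] b2(1)[of u v] unfolding cutoff_def psi1_def psi2_def by linarith
  have "second_diff (cutoff \<xi> n) h y = second_diff (\<lambda>x. psi ((x - x1 \<xi> n) / (x2 \<xi> n - x1 \<xi> n))) h y
     - second_diff (\<lambda>x. psi ((x - x3 \<xi> n) / (x4 \<xi> n - x3 \<xi> n))) h y"
    by (simp add: second_diff_def cutoff_def psi1_def psi2_def)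
  then show "\<bar>second_diff (cutoff \<xi> n) h y\<bar> \<le> 240 * real n * h\<^sup>2"
    using psi_scaled_bounds(2)[OF o(4) n h, of "x1 \<xi> n" y] psi_scaled_bounds(2)[OF o(6) n h, of "x3 \<xi> n" y] by linarith
qed

section \<open>Second differences of the blend of f and its chord\<close>

lemma second_diff_mult:
  "second_diff (\<lambda>x. k x * q x) h y = k y * second_diff q h y + q y * second_diff k h y
    + (k (y + h) - k y) * (q (y + h) - q y) + (k (y - h) - k y) * (q (y - h) - q y)"
  by (simp add: second_diff_def algebra_simps)

lemma P_affine:
  assumes "x1 \<xi> n < x4 \<xi> n"
  shows "P \<xi> n f x = P \<xi> n f z + (x - z) * ((f (x4 \<xi> n) - f (x1 \<xi> n)) / (x4 \<xi> n - x1 \<xi> n))"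
proof -
  have D: "x4 \<xi> n - x1 \<xi> n \<noteq> 0" "x1 \<xi> n - x4 \<xi> n \<noteq> 0" using assms by auto
  have u1: "(x - x4 \<xi> n) / (x1 \<xi> n - x4 \<xi> n) = 1 - (x - x1 \<xi> n) / (x4 \<xi> n - x1 \<xi> n)" for x
    using D by (simp add: divide_simps) (simp add: algebra_simps)
  have u2: "(x1 \<xi> n - x) / (x1 \<xi> n - x4 \<xi> n) = (x - x1 \<xi> n) / (x4 \<xi> n - x1 \<xi> n)" for x
    using D by (simp add: divide_simps) (simp add: algebra_simps)
  have "(1 - t) * a + t * b = a + t * (b - a)" for t a b :: real by (simp add: algebra_simps)
  then have pe: "P \<xi> n f x = f (x1 \<xi> n) + (x - x1 \<xi> n) / (x4 \<xi> n - x1 \<xi> n) * (f (x4 \<xi> n) - f (x1 \<xi> n))" for x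
    unfolding P_def u1 u2 .
  show ?thesis unfolding pe by (simp add: diff_divide_distrib algebra_simps)
qed

lemma second_diff_P: "x1 \<xi> n < x4 \<xi> n \<Longrightarrow> second_diff (P \<xi> n f) h y = 0"
  unfolding second_diff_def using P_affine[of \<xi> n f "y + h" y] P_affine[of \<xi> n f "y - h" y] by simp

lemma P_x1: "x1 \<xi> n < x4 \<xi> n \<Longrightarrow> P \<xi> n f (x1 \<xi> n) = f (x1 \<xi> n)"
  by (simp add: P_def)

text \<open>Throughout the window |t - \<xi>| is at least a sixth of the smoothed distance at y, so
  the weight can be frozen there: M = 6^\<alpha> K / d bounds \<open>deriv g\<close> times the power
  of phi, and \<open>second_diff_phi_weighted_le\<close> applies.\<close>

lemma second_diff_weighted_outside:
  assumes a: "\<alpha> > 0" and lam: "0 \<le> lam" "lam \<le> 1"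
    and cf: "continuous_on {0..1} f" and f: "\<And>t. t \<in> {0<..<1} \<Longrightarrow> (f has_real_derivative g t) (at t)"
    and ac: "locally_abs_cont_on {0<..<1} g" and N: "negligible N" and K: "K \<ge> 0"
    and le: "\<And>t. t \<in> {0<..<1} - N \<Longrightarrow> wbar \<xi> \<alpha> t * phi_pow (2 * lam) t * \<bar>deriv g t\<bar> \<le> K"
    and h: "h > 0" "0 \<le> y - h" "y + h \<le> 1" and n: "n > 0"
    and far: "\<And>t. t \<in> {y-h<..<y+h} \<Longrightarrow> smooth_dist \<xi> n y \<le> 6 * \<bar>t - \<xi>\<bar>"
  shows "\<bar>second_diff f h y\<bar> * phi_pow (2 * lam) y * smooth_dist \<xi> n y powr \<alpha> \<le> 9 * 6 powr \<alpha> * K * h\<^sup>2"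
proof -
  define d where "d = smooth_dist \<xi> n y powr \<alpha>"
  have sd: "smooth_dist \<xi> n y > 0" by (rule smooth_dist_pos[OF n])
  have d: "d > 0" using sd by (simp add: d_def)
  define M where "M = 6 powr \<alpha> * K / d"
  have M: "M \<ge> 0" using K d by (simp add: M_def)
  have "\<bar>second_diff f h y\<bar> * phi_pow (2 * lam) y \<le> 9 * M * h\<^sup>2"
  proof (rule second_diff_phi_weighted_le[OF cf f ac N h lam M])
    fix t assume t: "t \<in> {y-h<..<y+h} - N"
    have "d \<le> (6 * \<bar>t - \<xi>\<bar>) powr \<alpha>"
      unfolding d_def using far[of t] t a sd by (intro powr_mono2) auto
    then have dle: "d \<le> 6 powr \<alpha> * wbar \<xi> \<alpha> t" by (simp add: powr_mult wbar_def)
    have "d * (\<bar>deriv g t\<bar> * phi_pow (2 * lam) t) \<le> (6 powr \<alpha> * wbar \<xi> \<alpha> t) * (\<bar>deriv g t\<bar> * phi_pow (2 * lam) t)"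
      by (intro mult_right_mono dle) (simp add: phi_pow_nonneg)
    also have "\<dots> = 6 powr \<alpha> * (wbar \<xi> \<alpha> t * phi_pow (2 * lam) t * \<bar>deriv g t\<bar>)" by (simp only: mult_ac)
    also have "\<dots> \<le> 6 powr \<alpha> * K" using t h by (intro mult_left_mono le) auto
    finally show "\<bar>deriv g t\<bar> * phi_pow (2 * lam) t \<le> M"
      unfolding M_def using d by (simp add: pos_le_divide_eq mult.commute)
  qed
  then have "\<bar>second_diff f h y\<bar> * phi_pow (2 * lam) y * d \<le> (9 * M * h\<^sup>2) * d" using d by (intro mult_right_mono) auto
  also have "\<dots> = 9 * 6 powr \<alpha> * K * h\<^sup>2" using d by (simp add: M_def)
  finally show ?thesis by (simp add: d_def)
qed

lemma phi_pow_le_1: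
  assumes "0 < y" "y < 1" "0 \<le> lam" 
  shows "phi_pow (2 * lam) y \<le> 1"
proof -
  have "(y * (1 - y)) powr lam \<le> 1 powr lam" using assms mult_le_one[of y "1 - y"] by (intro powr_mono2) auto
  then show ?thesis using assms by (simp add: phi_pow_eq)
qed

text \<open>Put r = 1 / sqrt n and q = P - f. The slope of the chord is a value of f', so q has
  Lipschitz constant V; it vanishes at x1, hence q = O(V r). In the product rule every term with a
  difference of the cut-off is then O(V r h), and the remaining one is at most |second_diff f|
  because P is affine. The constant 1936 is 8 * 240 + 8 + 8.\<close>

lemma Fbar_second_diff_transition:
  assumes n: "sqrt (real n) > 8" and h: "h = 1 / real n" and V: "V \<ge> 0"
    and near: "x1 \<xi> n - h < y" "y < x4 \<xi> n + h"
    and f: "\<And>t. t \<in> {\<xi> - 4 / sqrt (real n)..\<xi> + 4 / sqrt (real n)} \<Longrightarrow> (f has_real_derivative g t) (at t)"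
    and g: "\<And>s t. \<lbrakk>s \<in> {\<xi> - 4 / sqrt (real n)..\<xi> + 4 / sqrt (real n)}; t \<in> {\<xi> - 4 / sqrt (real n)..\<xi> + 4 / sqrt (real n)}\<rbrakk>
         \<Longrightarrow> \<bar>g s - g t\<bar> \<le> V"
  shows "\<bar>second_diff (\<lambda>x. cutoff \<xi> n x * (P \<xi> n f x - f x)) h y\<bar>
     \<le> \<bar>second_diff f h y\<bar> + 1936 * V * h / sqrt (real n)"
proof -
  have s: "sqrt (real n) > 3" using n by linarith
  have n0: "n > 0" using n by (cases n) auto
  define r where "r = 1 / sqrt (real n)"
  have e: "c / sqrt (real n) = c * r" for c by (simp add: r_def)
  note o = nodes_order[OF s, of \<xi>, unfolded e]
  have r: "r > 0" using n0 by (simp add: r_def)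
  have rr: "r * r = h" using n0 by (simp add: r_def h)
  have h0: "h > 0" using n0 by (simp add: h)
  have r8: "r < 1/8" using n n0 by (simp add: r_def field_simps)
  have h8: "h \<le> r / 8"
  proof -
    have "r * r \<le> r * (1/8)" using r r8 by (intro mult_left_mono) auto
    then show ?thesis using rr by simp
  qed
  have nh: "real n * h = 1" using n0 by (simp add: h)
  have "sqrt (real n) * r = 1" using n0 by (simp add: r_def)
  then have sh: "sqrt (real n) * h = r" unfolding rr[symmetric] by (metis mult.assoc mult_1)
  let ?I = "{\<xi> - 4 * r..\<xi> + 4 * r}"
  have I: "y \<in> ?I" "y + h \<in> ?I" "y - h \<in> ?I" "x1 \<xi> n \<in> ?I" "x4 \<xi> n \<in> ?I"
    using near o h8 r by auto
  have f': "(f has_real_derivative g t) (at t)" if "t \<in> ?I" for t using f that by (simp add: e)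
  have g': "\<bar>g p - g t\<bar> \<le> V" if "p \<in> ?I" "t \<in> ?I" for p t using g that by (simp add: e)
  have mvt: "\<exists>z\<in>?I. f t - f p = (t - p) * g z" if pt: "p \<in> ?I" "t \<in> ?I" "p < t" for p t
  proof -
    obtain z where "z > p" "z < t" "f t - f p = (t - p) * g z"
      using MVT2[OF pt(3), of f g] f' pt by auto
    then show ?thesis using pt by (intro bexI[of _ z]) auto
  qed
  obtain \<theta> where \<theta>: "\<theta> \<in> ?I" "f (x4 \<xi> n) - f (x1 \<xi> n) = (x4 \<xi> n - x1 \<xi> n) * g \<theta>"
    using mvt[OF I(4,5) o(9)] by blast
  define q where "q x = P \<xi> n f x - f x" for x
  have P: "P \<xi> n f x = P \<xi> n f z + (x - z) * g \<theta>" for x z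
    using P_affine[OF o(9), of f x z] \<theta>(2) o(9) by simp
  have q0: "\<bar>q t - q p\<bar> \<le> V * \<bar>t - p\<bar>" if pt: "p \<in> ?I" "t \<in> ?I" "p < t" for p t
  proof -
    obtain z where z: "z \<in> ?I" "f t - f p = (t - p) * g z" using mvt[OF pt] by blast
    have "q t - q p = (t - p) * (g \<theta> - g z)" using P[of t p] z(2) by (simp add: q_def algebra_simps)
    then have "\<bar>q t - q p\<bar> = \<bar>t - p\<bar> * \<bar>g \<theta> - g z\<bar>" by (simp only: abs_mult)
    also have "\<dots> \<le> \<bar>t - p\<bar> * V" using \<theta>(1) z(1) by (intro mult_left_mono g') auto
    finally show ?thesis by (simp add: mult.commute)
  qed
  have q: "\<bar>q t - q p\<bar> \<le> V * \<bar>t - p\<bar>" if "p \<in> ?I" "t \<in> ?I" for p t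
    using q0[of p t] q0[of t p] that by (cases p t rule: linorder_cases) (auto simp: abs_minus_commute)
  have qy: "\<bar>q y\<bar> \<le> V * (8 * r)"
  proof -
    have "q (x1 \<xi> n) = 0" using P_x1[OF o(9)] by (simp add: q_def)
    then have "\<bar>q y\<bar> \<le> V * \<bar>y - x1 \<xi> n\<bar>" using q[OF I(4) I(1)] by simp
    also have "\<dots> \<le> V * (8 * r)" using V I(1,4) by (intro mult_left_mono) auto
    finally show ?thesis .
  qed
  have "second_diff q h y = second_diff (P \<xi> n f) h y - second_diff f h y"
    by (simp add: second_diff_def q_def)
  then have sq: "\<bar>second_diff q h y\<bar> = \<bar>second_diff f h y\<bar>" by (simp add: second_diff_P[OF o(9)])
  have sc: "\<bar>second_diff (cutoff \<xi> n) h y\<bar> \<le> 240 * h"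
  proof -
    have "240 * real n * h\<^sup>2 = 240 * (real n * h) * h" by (simp add: power2_eq_square)
    then show ?thesis using cutoff_smooth(2)[OF s h0, of \<xi> y] unfolding nh by simp
  qed
  have cd: "\<bar>cutoff \<xi> n (y + h) - cutoff \<xi> n y\<bar> \<le> 8 * r" "\<bar>cutoff \<xi> n (y - h) - cutoff \<xi> n y\<bar> \<le> 8 * r"
    using cutoff_smooth(1)[OF s h0, of \<xi> "y + h" y] cutoff_smooth(1)[OF s h0, of \<xi> "y - h" y] h0 sh
    by (simp_all add: mult.assoc)
  have qd: "\<bar>q (y + h) - q y\<bar> \<le> V * h" "\<bar>q (y - h) - q y\<bar> \<le> V * h"
    using q[OF I(1) I(2)] q[OF I(1) I(3)] h0 by simp_all
  have t1: "\<bar>cutoff \<xi> n y * second_diff q h y\<bar> \<le> \<bar>second_diff f h y\<bar>"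
    unfolding abs_mult sq using cutoff_bounds[OF s, of \<xi> y] by (simp add: mult_left_le_one_le)
  have t2: "\<bar>q y * second_diff (cutoff \<xi> n) h y\<bar> \<le> (V * (8 * r)) * (240 * h)"
    unfolding abs_mult using qy sc V r by (intro mult_mono) auto
  have t3: "\<bar>(cutoff \<xi> n (y + h) - cutoff \<xi> n y) * (q (y + h) - q y)\<bar> \<le> (8 * r) * (V * h)"
    unfolding abs_mult using cd qd V r by (intro mult_mono) auto
  have t4: "\<bar>(cutoff \<xi> n (y - h) - cutoff \<xi> n y) * (q (y - h) - q y)\<bar> \<le> (8 * r) * (V * h)"
    unfolding abs_mult using cd qd V r by (intro mult_mono) auto
  have tri: "\<bar>a + b + c + d\<bar> \<le> \<bar>a\<bar> + \<bar>b\<bar> + \<bar>c\<bar> + \<bar>d\<bar>" for a b c d :: real by linarith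
  have "\<bar>second_diff (\<lambda>x. cutoff \<xi> n x * q x) h y\<bar>
     \<le> \<bar>second_diff f h y\<bar> + (V * (8 * r)) * (240 * h) + (8 * r) * (V * h) + (8 * r) * (V * h)"
    unfolding second_diff_mult by (rule order_trans[OF tri]) (intro add_mono t1 t2 t3 t4)
  also have "\<dots> = \<bar>second_diff f h y\<bar> + 1936 * V * h / sqrt (real n)" by (simp add: e algebra_simps)
  finally show "\<bar>second_diff (\<lambda>x. cutoff \<xi> n x * (P \<xi> n f x - f x)) h y\<bar>
     \<le> \<bar>second_diff f h y\<bar> + 1936 * V * h / sqrt (real n)" by (simp add: q_def)
qed

text \<open>A window inside [x2,x3] sees only the chord, with second difference 0, and a window off
  (x1,x4) sees only f. In between, the correction is O(V r h) with r = 1 / sqrt n and V =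
  O(r^(1-\<alpha>)), and the weight O(r^\<alpha>) turns this into O(h r^2) = O(h^2).\<close>

lemma Fbar_second_diff_bound_large:
  assumes a: "\<alpha> > 0" and lam: "0 \<le> lam" "lam \<le> 1" and xi: "0 < \<xi>" "\<xi> < 1"
    and cf: "continuous_on {0..1} f" and f: "\<And>t. t \<in> {0<..<1} \<Longrightarrow> (f has_real_derivative g t) (at t)"
    and ac: "locally_abs_cont_on {0<..<1} g" and N: "negligible N" and K: "K \<ge> 0"
    and le: "\<And>t. t \<in> {0<..<1} - N \<Longrightarrow> wbar \<xi> \<alpha> t * phi_pow (2 * lam) t * \<bar>deriv g t\<bar> \<le> K"
  shows "\<exists>D\<ge>0. \<exists>n0. \<forall>n\<ge>n0. \<forall>y. 0 \<le> y - 1 / real n \<and> y + 1 / real n \<le> 1 \<longrightarrow>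
     \<bar>second_diff (Fbar \<xi> n f) (1 / real n) y\<bar> * phi_pow (2 * lam) y * smooth_dist \<xi> n y powr \<alpha> \<le> D / (real n)\<^sup>2"
proof -
  obtain C \<rho>\<^sub>0 where C: "C \<ge> 0" "\<rho>\<^sub>0 > 0" "{\<xi>-\<rho>\<^sub>0..\<xi>+\<rho>\<^sub>0} \<subseteq> {0<..<1}"
    "\<And>\<rho> s t. \<lbrakk>0 < \<rho>; \<rho> \<le> \<rho>\<^sub>0; s \<in> {\<xi>-\<rho>..\<xi>+\<rho>}; t \<in> {\<xi>-\<rho>..\<xi>+\<rho>}\<rbrakk> \<Longrightarrow> \<bar>g s - g t\<bar> \<le> C * \<rho> powr (1 - \<alpha>)"
    using deriv_variation_near_singularity[OF xi a lam ac N K le] by blast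
  define A where "A = 9 * 6 powr \<alpha> * K"
  \<comment> \<open>B collects the constant of the transition estimate, the radius 4 r in V and the
    bound 5 r of the smoothed distance. A is doubled in D because f enters both directly and through
    its product with the cut-off.\<close>
  define B where "B = 1936 * C * 4 powr (1 - \<alpha>) * 5 powr \<alpha>"
  have AB: "A \<ge> 0" "B \<ge> 0" using K C(1) by (auto simp: A_def B_def)
  define D where "D = 2 * A + B"
  \<comment> \<open>Beyond this n the interval of radius 4 / sqrt n around \<xi> lies where the
    variation of f' is controlled, and 1/n is at most an eighth of 1 / sqrt n.\<close>
  obtain n0 where n0: "(max 8 (4 / \<rho>\<^sub>0))\<^sup>2 < real n0" using reals_Archimedean2 by blast
  have main: "\<bar>second_diff (Fbar \<xi> n f) (1 / real n) y\<bar> * phi_pow (2 * lam) y * smooth_dist \<xi> n y powr \<alpha> \<le> D / (real n)\<^sup>2"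
    if nn: "n \<ge> n0" and y: "0 \<le> y - 1 / real n" "y + 1 / real n \<le> 1" for n y
  proof -
    have big: "max 8 (4 / \<rho>\<^sub>0) < sqrt (real n)"
    proof (rule real_less_rsqrt)
      have "real n0 \<le> real n" using nn by simp
      then show "(max 8 (4 / \<rho>\<^sub>0))\<^sup>2 < real n" using n0 by linarith
    qed
    then have s8: "sqrt (real n) > 8" and s: "sqrt (real n) > 3" by auto
    have n: "n > 0" using s by (cases n) auto
    define h where "h = 1 / real n"
    define r where "r = 1 / sqrt (real n)"
    have e: "c / sqrt (real n) = c * r" for c by (simp add: r_def)
    note o = nodes_order[OF s, of \<xi>, unfolded e]
    have r: "r > 0" using n by (simp add: r_def)
    have rr: "r * r = h" using n by (simp add: r_def h_def)
    have h0: "h > 0" using n by (simp add: h_def)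
    have r8: "r < 1/8" using s8 n by (simp add: r_def field_simps)
    have h8: "h \<le> r / 8"
    proof -
      have "r * r \<le> r * (1/8)" using r r8 by (intro mult_left_mono) auto
      then show ?thesis using rr by simp
    qed
    have r0: "4 * r \<le> \<rho>\<^sub>0"
    proof -
      have "4 / \<rho>\<^sub>0 < sqrt (real n)" using big by simp
      then show ?thesis using C(2) n by (simp add: r_def field_simps)
    qed
    have y': "0 \<le> y - h" "y + h \<le> 1" using y by (auto simp: h_def)
    have y01: "0 < y" "y < 1" using y' h0 by auto
    define d where "d = smooth_dist \<xi> n y powr \<alpha>"
    define p where "p = phi_pow (2 * lam) y"
    have p: "0 \<le> p" "p \<le> 1" unfolding p_def using phi_pow_le_1[OF y01 lam(1)] by (auto simp: phi_pow_nonneg)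
    have d: "d \<ge> 0" by (simp add: d_def)
    have F: "second_diff (Fbar \<xi> n f) h y = second_diff f h y + second_diff (\<lambda>x. cutoff \<xi> n x * (P \<xi> n f x - f x)) h y"
      unfolding second_diff_def Fbar_eq[OF s] by simp
    have hn: "h\<^sup>2 = 1 / (real n)\<^sup>2" by (simp add: h_def power_divide)
    have "\<bar>second_diff (Fbar \<xi> n f) h y\<bar> * p * d \<le> D * h\<^sup>2"
    proof (cases "x2 \<xi> n \<le> y - h \<and> y + h \<le> x3 \<xi> n")
      case True
      then have "cutoff \<xi> n (y - h) = 1" "cutoff \<xi> n y = 1" "cutoff \<xi> n (y + h) = 1"
        using h0 by (auto intro!: cutoff_middle[OF s])
      then have "second_diff (Fbar \<xi> n f) h y = second_diff (P \<xi> n f) h y"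
        unfolding second_diff_def Fbar_eq[OF s] by simp
      then have "second_diff (Fbar \<xi> n f) h y = 0" using second_diff_P[OF o(9)] by simp
      then show ?thesis using AB by (simp add: D_def)
    next
      case False
      have sd: "smooth_dist \<xi> n y = \<bar>y - \<xi>\<bar> + r" by (simp add: smooth_dist_def r_def)
      \<comment> \<open>The window sticks out of [x2,x3], which reaches at least r / 2 to each side
        of \<xi>; since its length 2 h is at most r / 4, it keeps distance r / 4 from \<xi>. This
        gives the factor 6.\<close>
      have far: "smooth_dist \<xi> n y \<le> 6 * \<bar>t - \<xi>\<bar>" if t: "t \<in> {y-h<..<y+h}" for t
      proof -
        have "t \<le> \<xi> - r / 4 \<or> t \<ge> \<xi> + r / 4" using False t o(3,5) h8 r by auto
        then show ?thesis unfolding sd using t h8 r by (auto simp: abs_if)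
      qed
      have sf: "\<bar>second_diff f h y\<bar> * p * d \<le> A * h\<^sup>2"
        unfolding A_def p_def d_def
        using second_diff_weighted_outside[OF a lam cf f ac N K le h0 y' n far] .
      show ?thesis
      proof (cases "y + h \<le> x1 \<xi> n \<or> y - h \<ge> x4 \<xi> n")
        case True
        then have "cutoff \<xi> n (y - h) = 0" "cutoff \<xi> n y = 0" "cutoff \<xi> n (y + h) = 0"
          using h0 cutoff_left[OF s, of _ \<xi>] cutoff_right[OF s, of \<xi>] by auto
        then have "second_diff (\<lambda>x. cutoff \<xi> n x * (P \<xi> n f x - f x)) h y = 0" by (simp add: second_diff_def)
        moreover have "A * h\<^sup>2 \<le> D * h\<^sup>2" using AB by (intro mult_right_mono) (auto simp: D_def)
        ultimately show ?thesis using sf by (simp add: F)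
      next
        case False
        then have near: "x1 \<xi> n - h < y" "y < x4 \<xi> n + h" by auto
        define V where "V = C * (4 * r) powr (1 - \<alpha>)"
        have V: "V \<ge> 0" using C(1) by (simp add: V_def)
        have tr: "\<bar>second_diff (\<lambda>x. cutoff \<xi> n x * (P \<xi> n f x - f x)) h y\<bar>
            \<le> \<bar>second_diff f h y\<bar> + 1936 * V * h / sqrt (real n)"
        proof (rule Fbar_second_diff_transition[OF s8 h_def V near])
          fix t assume "t \<in> {\<xi> - 4 / sqrt (real n)..\<xi> + 4 / sqrt (real n)}"
          then have "t \<in> {\<xi>-\<rho>\<^sub>0..\<xi>+\<rho>\<^sub>0}" using r0 by (auto simp: e)
          then show "(f has_real_derivative g t) (at t)" using C(3) by (intro f) auto
        next
          fix u t assume "u \<in> {\<xi> - 4 / sqrt (real n)..\<xi> + 4 / sqrt (real n)}" "t \<in> {\<xi> - 4 / sqrt (real n)..\<xi> + 4 / sqrt (real n)}"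
          then show "\<bar>g u - g t\<bar> \<le> V" unfolding V_def e using r r0 by (intro C(4)) auto
        qed
        have sd5: "smooth_dist \<xi> n y \<le> 5 * r"
          unfolding sd using near o(2,8) h8 r by (auto simp: abs_if)
        have d5: "d \<le> 5 powr \<alpha> * r powr \<alpha>"
        proof -
          have "d \<le> (5 * r) powr \<alpha>" unfolding d_def using sd5 smooth_dist_pos[OF n, of \<xi> y] a
            by (intro powr_mono2) (auto simp: e)
          then show ?thesis by (simp add: powr_mult)
        qed
        have Vr: "V * r powr \<alpha> = C * 4 powr (1 - \<alpha>) * r"
        proof -
          have "r powr (1 - \<alpha>) * r powr \<alpha> = r" using r by (simp add: powr_add[symmetric])
          then show ?thesis unfolding V_def powr_mult by (simp add: mult.assoc)
        qed
        have t2: "(1936 * V * h / sqrt (real n)) * p * d \<le> B * h\<^sup>2"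
        proof -
          have "(1936 * V * h / sqrt (real n)) * p * d \<le> (1936 * V * h * r) * 1 * (5 powr \<alpha> * r powr \<alpha>)"
            unfolding e using V h0 r p d d5 by (intro mult_mono) auto
          also have "\<dots> = 1936 * h * r * 5 powr \<alpha> * (V * r powr \<alpha>)" by (simp only: mult_ac mult_1)
          also have "\<dots> = B * (h * (r * r))" unfolding Vr B_def by (simp only: mult_ac)
          finally show ?thesis by (simp add: rr power2_eq_square)
        qed
        have "\<bar>second_diff (Fbar \<xi> n f) h y\<bar> \<le> 2 * \<bar>second_diff f h y\<bar> + 1936 * V * h / sqrt (real n)"
          using tr abs_triangle_ineq[of "second_diff f h y" "second_diff (\<lambda>x. cutoff \<xi> n x * (P \<xi> n f x - f x)) h y"]
          unfolding F by linarith
        then have "\<bar>second_diff (Fbar \<xi> n f) h y\<bar> * p * d \<le> (2 * \<bar>second_diff f h y\<bar> + 1936 * V * h / sqrt (real n)) * p * d"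
          using p d by (intro mult_right_mono) auto
        also have "\<dots> = 2 * (\<bar>second_diff f h y\<bar> * p * d) + (1936 * V * h / sqrt (real n)) * p * d" by (simp add: algebra_simps)
        also have "\<dots> \<le> 2 * (A * h\<^sup>2) + B * h\<^sup>2" using sf t2 by (intro add_mono mult_left_mono) auto
        also have "\<dots> = D * h\<^sup>2" by (simp add: D_def algebra_simps)
        finally show ?thesis .
      qed
    qed
    then show ?thesis by (simp add: h_def p_def d_def power_divide)
  qed
  show ?thesis
    by (rule exI[of _ D]) (use AB main in \<open>auto simp: D_def intro!: exI[of _ n0]\<close>)
qed

section \<open>Conclusion\<close>

text \<open>Below the threshold only finitely many n and, for each, finitely many k remain; their
  values are summed into the constant, which may depend on f.\<close>

lemma Fbar_second_diff_bound:
  assumes a: "\<alpha> > 0" and lam: "0 \<le> lam" "lam \<le> 1" and xi: "0 < \<xi>" "\<xi> < 1"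
    and cf: "continuous_on {0..1} f" and f: "\<And>t. t \<in> {0<..<1} \<Longrightarrow> (f has_real_derivative g t) (at t)"
    and ac: "locally_abs_cont_on {0<..<1} g" and N: "negligible N" and K: "K \<ge> 0"
    and le: "\<And>t. t \<in> {0<..<1} - N \<Longrightarrow> wbar \<xi> \<alpha> t * phi_pow (2 * lam) t * \<bar>deriv g t\<bar> \<le> K"
  obtains D where "D \<ge> 0"
    "\<And>n k. k + 2 \<le> n \<Longrightarrow> \<bar>Fbar \<xi> n f (real (k+2) / real n) - 2 * Fbar \<xi> n f (real (k+1) / real n) + Fbar \<xi> n f (real k / real n)\<bar>
        * phi_pow (2 * lam) (real (k+1) / real n) * smooth_dist \<xi> n (real (k+1) / real n) powr \<alpha> \<le> D / (real n)\<^sup>2"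
proof -
  obtain D n0 where D: "D \<ge> 0" and large: "\<And>n y. n \<ge> n0 \<Longrightarrow> 0 \<le> y - 1 / real n \<Longrightarrow> y + 1 / real n \<le> 1 \<Longrightarrow>
     \<bar>second_diff (Fbar \<xi> n f) (1 / real n) y\<bar> * phi_pow (2 * lam) y * smooth_dist \<xi> n y powr \<alpha> \<le> D / (real n)\<^sup>2"
    using Fbar_second_diff_bound_large[OF a lam xi cf f ac N K le] by blast
  define T where "T n k = \<bar>Fbar \<xi> n f (real (k+2) / real n) - 2 * Fbar \<xi> n f (real (k+1) / real n) + Fbar \<xi> n f (real k / real n)\<bar>
        * phi_pow (2 * lam) (real (k+1) / real n) * smooth_dist \<xi> n (real (k+1) / real n) powr \<alpha>" for n k
  have T0: "T n k \<ge> 0" for n k by (simp add: T_def phi_pow_nonneg)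
  define E where "E n = (real n)\<^sup>2 * (\<Sum>k\<le>n. T n k)" for n
  have E0: "E n \<ge> 0" for n using T0 by (auto simp: E_def intro!: mult_nonneg_nonneg sum_nonneg)
  define D' where "D' = D + (\<Sum>n<n0. E n)"
  have D': "D \<le> D'" "D' \<ge> 0" using D E0 by (auto simp: D'_def sum_nonneg)
  have "T n k \<le> D' / (real n)\<^sup>2" if k: "k + 2 \<le> n" for n k
  proof (cases "n \<ge> n0")
    case True
    have n: "real n > 0" using k by simp
    let ?y = "real (k+1) / real n"
    have pm: "?y + 1 / real n = real (k+2) / real n" "?y - 1 / real n = real k / real n"
      by (simp_all add: add_divide_distrib[symmetric] diff_divide_distrib[symmetric])
    have "T n k \<le> D / (real n)\<^sup>2"
      using large[OF True, of ?y] k n unfolding T_def second_diff_def pm by (simp add: divide_le_eq)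
    also have "\<dots> \<le> D' / (real n)\<^sup>2" using D' by (intro divide_right_mono) auto
    finally show ?thesis .
  next
    case False
    have n: "(real n)\<^sup>2 > 0" using k by simp
    have "T n k \<le> (\<Sum>k\<le>n. T n k)" using k T0 by (intro member_le_sum) auto
    then have "(real n)\<^sup>2 * T n k \<le> E n" unfolding E_def using n by (intro mult_left_mono) auto
    also have "\<dots> \<le> (\<Sum>n<n0. E n)" using False E0 by (intro member_le_sum) auto
    also have "\<dots> \<le> D'" using D by (simp add: D'_def)
    finally show ?thesis using n by (simp add: pos_le_divide_eq mult.commute)
  qed
  then show thesis using that[of D'] D'(2) unfolding T_def by blast
qed

text \<open>At \<xi> the cut-off is 1, so the value of f there is multiplied by 0, and P only
  samples x1 and x4, which differ from \<xi>. Thus f may be replaced by its differentiable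
  version.\<close>

lemma Fbar_fun_upd:
  assumes "sqrt (real n) > 3"
  shows "Fbar \<xi> n (f(\<xi> := c)) x = Fbar \<xi> n f x"
proof -
  define r where "r = 1 / sqrt (real n)"
  have e: "c / sqrt (real n) = c * r" for c by (simp add: r_def)
  have r: "r > 0" using assms by (cases n) (auto simp: r_def)
  note o = nodes_order[OF assms, of \<xi>, unfolded e]
  have ne: "x1 \<xi> n \<noteq> \<xi>" "x4 \<xi> n \<noteq> \<xi>" using o(1,7) r by auto
  have P: "P \<xi> n (f(\<xi> := c)) x = P \<xi> n f x" using ne by (simp add: P_def)
  show ?thesis
  proof (cases "x = \<xi>")
    case True
    have "cutoff \<xi> n x = 1" using True o(3,5) r by (intro cutoff_middle[OF assms]) auto
    then show ?thesis by (simp add: Fbar_eq[OF assms] P)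
  qed (simp add: Fbar_eq[OF assms] P)
qed

lemma AE_lebesgue_on_negligible:
  assumes "AE x in lebesgue_on S. Q x" "S \<in> sets lebesgue"
  obtains N where "negligible N" "\<And>x. x \<in> S - N \<Longrightarrow> Q x"
proof -
  have "AE x in lebesgue. x \<in> S \<longrightarrow> Q x" using assms by (simp add: AE_restrict_space_iff)
  then obtain N where "N \<in> null_sets lebesgue" "{x \<in> space lebesgue. \<not> (x \<in> S \<longrightarrow> Q x)} \<subseteq> N"
    unfolding eventually_ae_filter by blast
  then show thesis using that[of N] by (auto simp: negligible_iff_null_sets)
qed

text \<open>Packages the version of f that is differentiable on all of (0,1). The point \<xi> joins
  the null set because the norm is formed with \<open>deriv\<close> of f itself, which is known to
  agree with that of the new version only away from \<xi>.\<close>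

lemma W2_regular_version:
  assumes xi: "0 < \<xi>" "\<xi> < 1" and W: "f \<in> W2 \<xi> \<alpha> lam"
  obtains c g K N where "continuous_on {0..1} (f(\<xi> := c))"
    "\<And>t. t \<in> {0<..<1} \<Longrightarrow> (f(\<xi> := c) has_real_derivative g t) (at t)"
    "locally_abs_cont_on {0<..<1} g" "negligible N" "K \<ge> 0" "w2norm \<xi> \<alpha> lam f = ereal K"
    "\<And>t. t \<in> {0<..<1} - N \<Longrightarrow> wbar \<xi> \<alpha> t * phi_pow (2 * lam) t * \<bar>deriv g t\<bar> \<le> K"
proof -
  obtain c where diff: "\<And>x. x \<in> {0<..<1} \<Longrightarrow> f(\<xi> := c) differentiable (at x)"
    and ac: "locally_abs_cont_on {0<..<1} (deriv (f(\<xi> := c)))"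
    using W unfolding W2_def mem_Collect_eq by blast
  have fC: "continuous_on ({0..1} - {\<xi>}) f" and fin: "w2norm \<xi> \<alpha> lam f < \<infinity>"
    using W unfolding W2_def C_wbar_def by auto
  let ?f = "f(\<xi> := c)"
  define g where "g = deriv ?f"
  have der: "(?f has_real_derivative g t) (at t)" if "t \<in> {0<..<1}" for t
    using diff[OF that] unfolding g_def by (simp add: DERIV_deriv_iff_real_differentiable)
  have "continuous_on ({0..1} - {\<xi>}) ?f \<longleftrightarrow> continuous_on ({0..1} - {\<xi>}) f"
    by (rule continuous_on_cong) auto
  then have fC': "continuous_on ({0..1} - {\<xi>}) ?f" using fC by simp
  have cont: "continuous_on {0..1} ?f"
    unfolding continuous_on_eq_continuous_within
  proof
    fix x :: real assume x: "x \<in> {0..1}"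
    show "continuous (at x within {0..1}) ?f"
    proof (cases "x = \<xi>")
      case True
      then have "isCont ?f x" using der[of x] xi by (auto intro: DERIV_isCont)
      then show ?thesis by (rule continuous_at_imp_continuous_at_within)
    next
      case False
      then have "continuous (at x within {0..1} - {\<xi>}) ?f"
        using fC' x unfolding continuous_on_eq_continuous_within by blast
      moreover have "at x within {0..1} - {\<xi>} = at x within {0..1}"
        by (rule at_within_nhd[of x "- {\<xi>}"]) (use False in auto)
      ultimately show ?thesis by simp
    qed
  qed
  have ae: "AE x in lebesgue_on {0<..<1}. ereal \<bar>wbar \<xi> \<alpha> x * phi_pow (2 * lam) x * (deriv ^^ 2) f x\<bar> \<le> w2norm \<xi> \<alpha> lam f"
    unfolding w2norm_def by (rule esssup_AE)
  obtain N0 where N0: "negligible N0"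
    "\<And>x. x \<in> {0<..<1} - N0 \<Longrightarrow> ereal \<bar>wbar \<xi> \<alpha> x * phi_pow (2 * lam) x * (deriv ^^ 2) f x\<bar> \<le> w2norm \<xi> \<alpha> lam f"
    using AE_lebesgue_on_negligible[OF ae] by auto
  \<comment> \<open>Since (0,1) has positive measure, the essential bound holds at some point, and
    this makes the norm nonnegative.\<close>
  have "\<not> negligible {0<..<1::real}" by (simp add: negligible_iff_measure)
  then have "\<not> {0<..<1} \<subseteq> N0" using negligible_subset[OF N0(1)] by blast
  then obtain z where z: "z \<in> {0<..<1} - N0" by blast
  have "0 \<le> ereal \<bar>wbar \<xi> \<alpha> z * phi_pow (2 * lam) z * (deriv ^^ 2) f z\<bar>" by simp
  also have "\<dots> \<le> w2norm \<xi> \<alpha> lam f" by (rule N0(2)[OF z])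
  finally have "0 \<le> w2norm \<xi> \<alpha> lam f" .
  then obtain K where K: "w2norm \<xi> \<alpha> lam f = ereal K" "K \<ge> 0"
    using fin by (cases "w2norm \<xi> \<alpha> lam f") auto
  show thesis
  proof (rule that[OF cont der, of "N0 \<union> {\<xi>}" K])
    show "locally_abs_cont_on {0<..<1} g" using ac unfolding g_def .
    show "negligible (N0 \<union> {\<xi>})" using N0(1) by simp
    fix t assume t: "t \<in> {0<..<1} - (N0 \<union> {\<xi>})"
    have "eventually (\<lambda>u. u \<in> - {\<xi>}) (nhds t)" using t by (intro eventually_nhds_in_open) auto
    then have "eventually (\<lambda>u. deriv f u = g u) (nhds t)"
    proof eventually_elim
      case (elim u)
      then have "eventually (\<lambda>v. v \<in> - {\<xi>}) (nhds u)" by (intro eventually_nhds_in_open) auto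
      then have "eventually (\<lambda>v. f v = ?f v) (nhds u)" by eventually_elim auto
      then show ?case unfolding g_def by (rule deriv_cong_ev) simp
    qed
    then have "deriv (deriv f) t = deriv g t" by (rule deriv_cong_ev) simp
    then have "\<bar>wbar \<xi> \<alpha> t * phi_pow (2 * lam) t * deriv g t\<bar> \<le> K"
      using N0(2)[of t] t K(1) by (simp add: deriv_funpow_2)
    then show "wbar \<xi> \<alpha> t * phi_pow (2 * lam) t * \<bar>deriv g t\<bar> \<le> K"
      by (simp add: abs_mult wbar_nonneg phi_pow_nonneg)
  qed (use K in auto)
qed

text \<open>The chord of an affine function is the function itself, so the modification changes no
  value at the points k/n and all second differences vanish. This settles norm zero.\<close>

lemma Bbar_affine:
  assumes s: "sqrt (real n) > 3" and aff: "\<And>t. t \<in> {0..1} \<Longrightarrow> f t = p + q * t"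
    and adm: "admissible \<xi> n" and n: "n = m + 2"
  shows "(deriv ^^ 2) (Bbar \<xi> n f) x = 0"
proof -
  note o = nodes_order[OF s, of \<xi>]
  have x14: "x1 \<xi> n \<in> {0..1}" "x4 \<xi> n \<in> {0..1}" using adm o(9) by (auto simp: admissible_def)
  have P: "P \<xi> n f t = p + q * t" for t
  proof -
    have "P \<xi> n f t = f (x1 \<xi> n) + (t - x1 \<xi> n) * ((f (x4 \<xi> n) - f (x1 \<xi> n)) / (x4 \<xi> n - x1 \<xi> n))"
      using P_affine[OF o(9), of f t "x1 \<xi> n"] P_x1[OF o(9), of f] by simp
    also have "(f (x4 \<xi> n) - f (x1 \<xi> n)) / (x4 \<xi> n - x1 \<xi> n) = q"
      using o(9) aff[OF x14(1)] aff[OF x14(2)] by (simp add: divide_eq_eq algebra_simps)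
    finally show ?thesis using aff[OF x14(1)] by (simp add: algebra_simps)
  qed
  have F: "Fbar \<xi> n f (real k / real n) = p + q * (real k / real n)" if "k \<le> n" for k
  proof -
    have "real k / real n \<in> {0..1}" using that n by (simp add: divide_le_eq)
    then show ?thesis unfolding Fbar_eq[OF s] P by (simp add: aff)
  qed
  have "Fbar \<xi> n f (real (k+2) / real n) - 2 * Fbar \<xi> n f (real (k+1) / real n) + Fbar \<xi> n f (real k / real n) = 0"
    if "k \<le> m" for k
  proof -
    have "real (k+2) / real n - 2 * (real (k+1) / real n) + real k / real n = 0"
      by (simp add: add_divide_distrib)
    then have "q * (real (k+2) / real n - 2 * (real (k+1) / real n) + real k / real n) = 0" by simp
    moreover have "k + 2 \<le> n" "k + 1 \<le> n" "k \<le> n" using that n by auto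
    moreover have "p + q * u - 2 * (p + q * v) + (p + q * w) = q * (u - 2 * v + w)" for u v w
      by (simp add: algebra_simps)
    ultimately show ?thesis by (simp only: F)
  qed
  then show ?thesis
    unfolding Bbar_eq n deriv2_Bernstein_sum by (auto intro!: sum.neutral simp: n)
qed

lemma Bbar_deriv2_bound_W2:
  assumes a: "\<alpha> > 0" and lam: "0 \<le> lam" "lam \<le> 1" and xi: "0 < \<xi>" "\<xi> < 1" and W: "f \<in> W2 \<xi> \<alpha> lam"
  shows "\<exists>C>0. \<forall>n. admissible \<xi> n \<longrightarrow> (\<forall>x\<in>{0..1}.
            ereal \<bar>wbar \<xi> \<alpha> x * phi_pow (2 * lam) x * (deriv ^^ 2) (Bbar \<xi> n f) x\<bar>
              \<le> ereal C * w2norm \<xi> \<alpha> lam f)"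
proof -
  obtain c g K N where cf: "continuous_on {0..1} (f(\<xi> := c))"
    and der: "\<And>t. t \<in> {0<..<1} \<Longrightarrow> (f(\<xi> := c) has_real_derivative g t) (at t)"
    and ac: "locally_abs_cont_on {0<..<1} g" and N: "negligible N" and K: "K \<ge> 0" "w2norm \<xi> \<alpha> lam f = ereal K"
    and le: "\<And>t. t \<in> {0<..<1} - N \<Longrightarrow> wbar \<xi> \<alpha> t * phi_pow (2 * lam) t * \<bar>deriv g t\<bar> \<le> K"
    using W2_regular_version[OF xi W] by metis
  let ?f = "f(\<xi> := c)"
  have B: "Bbar \<xi> n f = Bbar \<xi> n ?f" if "admissible \<xi> n" for n
    unfolding Bbar_eq Fbar_fun_upd[OF admissible_sqrt_gt[OF that]] ..
  have nm: "\<exists>m. n = m + 2" if "admissible \<xi> n" for n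
  proof -
    have s: "sqrt (real n) > 3" by (rule admissible_sqrt_gt[OF that])
    have "n \<noteq> 0" using s by (cases n) auto
    moreover have "n \<noteq> 1" using s by (cases "n = 1") auto
    ultimately show ?thesis by presburger
  qed
  show ?thesis
  \<comment> \<open>For norm zero the right side is 0 whatever C is, so the second derivative must
    vanish exactly: g is constant and f is affine on [0,1].\<close>
  proof (cases "K = 0")
    case True
    have g: "g t = g (1/2)" if t: "t \<in> {0<..<1}" for t
    proof -
      have const: "\<bar>g v - g u\<bar> \<le> 0 - 0" if uv: "u \<in> {0<..<1}" "v \<in> {0<..<1}" "u \<le> v" for u v
      proof (rule abs_cont_on_increment_le[where g = g and s = u and t = v and H' = "\<lambda>x. 0" and N = "N \<union> {\<xi>}" and H = "\<lambda>x. 0"])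
        show "abs_cont_on {u..v} g" using uv by (intro locally_abs_cont_onD[OF ac]) auto
        show "negligible (N \<union> {\<xi>})" using N by simp
        show "\<bar>deriv g t\<bar> \<le> 0" if t: "t \<in> {u..v} - (N \<union> {\<xi>})" for t
        proof -
          have t01: "0 < t" "t < 1" using t uv by auto
          have "wbar \<xi> \<alpha> t > 0" using t by (simp add: wbar_def)
          moreover have "phi_pow (2 * lam) t > 0" using t01 by (simp add: phi_pow_eq)
          ultimately have "wbar \<xi> \<alpha> t * phi_pow (2 * lam) t > 0" by simp
          moreover have "wbar \<xi> \<alpha> t * phi_pow (2 * lam) t * \<bar>deriv g t\<bar> \<le> wbar \<xi> \<alpha> t * phi_pow (2 * lam) t * 0"
            using le[of t] t t01 True by simp
          ultimately show ?thesis by (simp only: mult_le_cancel_left_pos)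
        qed
      qed (use uv N in auto)
      show ?thesis using const[of t "1/2"] const[of "1/2" t] t by (cases "t \<le> 1/2") auto
    qed
    define q where "q = g (1/2)"
    have aff: "?f t = ?f 0 + q * t" if t: "t \<in> {0..1}" for t
    proof -
      have "?f t - q * t = ?f 0 - q * 0"
      proof (rule DERIV_isconst2[of 0 1 "\<lambda>t. ?f t - q * t"])
        show "continuous_on {0..1} (\<lambda>t. ?f t - q * t)" by (intro continuous_intros cf)
        show "((\<lambda>t. ?f t - q * t) has_real_derivative 0) (at x)" if "0 < x" "x < 1" for x
        proof -
          have "((\<lambda>t. ?f t - q * t) has_real_derivative g x - q * 1) (at x)"
            using that by (intro DERIV_diff DERIV_cmult DERIV_ident der) auto
          then show ?thesis using g[of x] that by (simp add: q_def)
        qed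
      qed (use t in auto)
      then show ?thesis by simp
    qed
    have "(deriv ^^ 2) (Bbar \<xi> n f) x = 0" if adm: "admissible \<xi> n" for n x
    proof -
      obtain m where m: "n = m + 2" using nm[OF adm] by blast
      show ?thesis unfolding B[OF adm] by (rule Bbar_affine[OF admissible_sqrt_gt[OF adm] aff adm m])
    qed
    then show ?thesis using True K(2) by (intro exI[of _ 1]) (auto simp: zero_ereal_def[symmetric])
  next
    case False
    then have K0: "K > 0" using K(1) by simp
    obtain D where D: "D \<ge> 0"
      "\<And>n k. k + 2 \<le> n \<Longrightarrow> \<bar>Fbar \<xi> n ?f (real (k+2) / real n) - 2 * Fbar \<xi> n ?f (real (k+1) / real n) + Fbar \<xi> n ?f (real k / real n)\<bar>
        * phi_pow (2 * lam) (real (k+1) / real n) * smooth_dist \<xi> n (real (k+1) / real n) powr \<alpha> \<le> D / (real n)\<^sup>2"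
      using Fbar_second_diff_bound[OF a lam xi cf der ac N K(1) le] by blast
    \<comment> \<open>D depends on f, so the positive norm can be divided out; adding 1 keeps C
      positive even if D is 0.\<close>
    define C where "C = (10 * exp 2 * weight_const \<alpha> * D + 1) / K"
    have "10 * exp 2 * weight_const \<alpha> * D \<ge> 0" using weight_const_pos[of \<alpha>] D(1) by simp
    then have "0 < 10 * exp 2 * weight_const \<alpha> * D + 1" by linarith
    then have C: "C > 0" "10 * exp 2 * weight_const \<alpha> * D \<le> C * K"
      unfolding C_def using K0 by (auto intro: divide_pos_pos)
    have "\<bar>wbar \<xi> \<alpha> x * phi_pow (2 * lam) x * (deriv ^^ 2) (Bbar \<xi> n f) x\<bar> \<le> C * K"
      if adm: "admissible \<xi> n" and x: "x \<in> {0..1}" for n x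
    proof -
      obtain m where m: "n = m + 2" using nm[OF adm] by blast
      have "wbar \<xi> \<alpha> x * phi_pow (2 * lam) x * \<bar>(deriv ^^ 2) (Bbar \<xi> n f) x\<bar> \<le> 10 * exp 2 * weight_const \<alpha> * D"
        unfolding B[OF adm] unfolding Bbar_eq m
        by (rule Bernstein_second_diff_bound[OF a lam _ _ D(1)]) (use x D(2)[of _ "m+2"] in auto)
      then show ?thesis using C(2) by (simp add: abs_mult wbar_nonneg phi_pow_nonneg)
    qed
    then show ?thesis using C(1) K(2) by (intro exI[of _ C]) auto
  qed
qed

theorem theorem2:
  fixes \<xi> \<alpha> lam :: real
  assumes "0 < \<xi>" "\<xi> < 1" and "\<alpha> > 0" and "0 \<le> lam" "lam \<le> 1"
  shows "(\<exists>C>0. \<forall>f\<in>C_wbar \<xi> \<alpha>. \<forall>n. admissible \<xi> n \<longrightarrow> (\<forall>x\<in>{0..1}.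
            ereal \<bar>wbar \<xi> \<alpha> x * phi_pow (2 * lam) x * (deriv ^^ 2) (Bbar \<xi> n f) x\<bar>
              \<le> ereal C * ereal (real n) * max_factor lam n x * wnorm \<xi> \<alpha> f))
       \<and> (\<forall>f\<in>W2 \<xi> \<alpha> lam. \<exists>C>0. \<forall>n. admissible \<xi> n \<longrightarrow> (\<forall>x\<in>{0..1}.
            ereal \<bar>wbar \<xi> \<alpha> x * phi_pow (2 * lam) x * (deriv ^^ 2) (Bbar \<xi> n f) x\<bar>
              \<le> ereal C * w2norm \<xi> \<alpha> lam f))"
  using Bbar_deriv2_bound_C[OF assms(3-5), of \<xi>] Bbar_deriv2_bound_W2[OF assms(3-5) assms(1,2)] by blast

end
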